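(* Let $\pi_1:V_1\to X_1$ and $\pi_2:V_2\to X_2$ be finite-dimensional locally trivial diffeological vector pseudo-bundles, let $(\tilde f,f)$ be a gluing of the former to the latter such that $f$ and $\tilde f^*$ are diffeomorphisms (of their domains with their images), and let $g_1,g_2$ be pseudo-metrics on $V_1,V_2$ compatible with this gluing. Let $v\in C\ell((V_1\cup_{\tilde f}V_2)^*,\tilde g^* )$ and $e\in\bigwedge(V_1\cup_{\tilde f}V_2)$ be such that $\pi^{\bigwedge}(e)=\pi^{C\ell}(v)$ (they lie over the same point of $X_1\cup_fX_2$). Then $$\Phi_{\cup,*}^{\bigwedge}(c^*(v)(e))=\tilde c_{*,\cup}\left(\Phi_{\cup,*}^{C\ell}(v)\right)\left(\Phi_{\cup,*}^{\bigwedge}(e)\right).$$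
   Context: Diffeological spaces, plots, smooth maps, and the subset, quotient, product, disjoint union and functional diffeologies are in the usual sense of Souriau. $E^*$ denotes the space of smooth linear maps $E\to\mathbb R$ on a diffeological vector space $E$, with the functional diffeology. Pseudo-bundles. A diffeological vector pseudo-bundle is a smooth surjective map $\pi:V\to X$ of diffeological spaces with a vector space structure on each fibre such that fibrewise addition $V\times_XV\to V$, scalar multiplication $\mathbb R\times V\to V$ and the zero section are smooth. The dual pseudo-bundle is $V^*=\bigcup_{x}(\pi^{-1}(x))^*$ with projection $\pi^*$; $q:U'\to V^*$ is a plot iff for every plot $p:U\to V$ the map $(u',u)\mapsto q(u')(p(u))$ is smooth on the set where $q(u')$ and $p(u)$ lie over the same point. $V\oplus V'$ is $V\times_XV'$ with the subset diffeology; $V\otimes V'$ is the fibrewise tensor product, with the finest pseudo-bundle diffeology making $V\times_XV'\to V\otimes V'$ smooth. A pseudo-metric on $V$ (finite-dimensional fibres) is a smooth section $g$ of $V^*\otimes V^*$ such that each $g(x)$ is a symmetric positive semi-definite form of rank $\dim((\pi^{-1}(x))^* )$. The dual pseudo-metric $g^*$ on $V^*$ is defined by $g^*(x)(\Psi_g(v),\Psi_g(w))=g(x)(v,w)$, where $\Psi_g(v)=g(\pi(v))(v,\cdot)$ (fibrewise surjective onto $V^*$). Gluing. For $h:Z_1\supseteq Y'\to Z_2$ smooth, $Z_1\cup_hZ_2=(Z_1\sqcup Z_2)/(z\sim h(z))$ with the quotient of the disjoint union diffeology. The natural inclusions of $Z_1\setminus Y'$ and of $Z_2$ have disjoint images covering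 it; they are denoted $i_1^{Z_1},i_2^{Z_2}$ for base spaces and $j_1^{Z_1},j_2^{Z_2}$ for total spaces. A gluing $(\tilde f,f)$ consists of a smooth $f:X_1\supseteq Y\to X_2$ and a smooth fibrewise linear lift $\tilde f:\pi_1^{-1}(Y)\to V_2$; it yields the pseudo-bundle $V_1\cup_{\tilde f}V_2\to X_1\cup_fX_2$. The map $\tilde f^*:(\pi_2^* )^{-1}(f(Y))\to V_1^*$ is $\xi\mapsto\xi\circ\tilde f|_{\pi_1^{-1}(y)}$ for $\xi\in(\pi_2^{-1}(f(y)))^*$; it lifts $f^{-1}$ and gives the gluing $V_2^*\cup_{\tilde f^*}V_1^*\to X_2\cup_{f^{-1}}X_1$. Pseudo-metrics $g_1,g_2$ are compatible with $(\tilde f,f)$ if $g_1(y)(v,w)=g_2(f(y))(\tilde f(v),\tilde f(w))$ for all $y\in Y$, $v,w\in\pi_1^{-1}(y)$. Then $\tilde g$ is the pseudo-metric on $V_1\cup_{\tilde f}V_2$ equal to $g_1$ (via $j_1^{V_1}$) over $i_1^{X_1}(X_1\setminus Y)$ and to $g_2$ (via $j_2^{V_2}$) over $i_2^{X_2}(X_2)$; $\tilde g^*$ is its dual. $\widetilde{g^*}$ is the pseudo-metric on $V_2^*\cup_{\tilde f^*}V_1^*$ equal to $g_2^*$ (via $j_1^{V_2^*}$) over $i_1^{X_2}(X_2\setminus f(Y))$ and to $g_1^*$ (via $j_2^{V_1^*}$) over $i_2^{X_1}(X_1)$. The diffeomorphism $\Phi_{\cup,*}:(V_1\cup_{\tilde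 f}V_2)^*\to V_2^*\cup_{\tilde f^*}V_1^*$ (which exists under the hypotheses) is $j_2^{V_1^*}\circ(j_1^{V_1})^*$ over $i_1^{X_1}(X_1\setminus Y)$, $j_2^{V_1^*}\circ\tilde f^*\circ(j_2^{V_2})^*$ over $i_2^{X_2}(f(Y))$, and $j_1^{V_2^*}\circ(j_2^{V_2})^*$ over $i_2^{X_2}(X_2\setminus f(Y))$, where $(j_i^{V_i})^*$ is fibrewise pre-composition with $j_i^{V_i}$. Clifford and exterior algebras. The dimensions of all fibres are assumed bounded. $C\ell(V,g)=\bigcup_xC\ell(\pi^{-1}(x),g(x))$, where the Clifford algebra is the quotient of the tensor algebra by the relations $v\otimes w+w\otimes v+2g(x)(v,w)=0$, with projection $\pi^{C\ell}$ and the quotient diffeology from the pseudo-bundle $T(V)$ of tensor algebras (finite direct sums of tensor powers, up to the maximal fibre dimension, suffice). $\mathrm{Alt}(v_1\otimes\cdots\otimes v_n)=\frac1{n!}\sum_\sigma\mathrm{sgn}(\sigma)v_{\sigma(1)}\otimes\cdots\otimes v_{\sigma(n)}$ (fibrewise), $\bigwedge_n(V)=\mathrm{Alt}(V^{\otimes n})$, $\bigwedge_*(V)=\bigoplus_n\bigwedge_n(V)$, $v_1\wedge\cdots\wedge v_n=\mathrm{Alt}(v_1\otimes\cdots\otimes v_n)$; $\bigwedge(V):=\bigwedge_*(V^* )$ with projection $\pi^{\bigwedge}$. $\Phi_{\cup,*}^{C\ell}:C\ell((V_1\cup_{\tilde f}V_2)^*,\tilde g^* )\to C\ell(V_2^*\cup_{\tilde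 f^*}V_1^*,\widetilde{g^*})$ is the map induced on the Clifford quotients by $\bigoplus_n\Phi_{\cup,*}^{\otimes n}$. $\Phi_{\cup,*}^{\bigwedge}:\bigwedge(V_1\cup_{\tilde f}V_2)\to\bigwedge_*(V_2^*\cup_{\tilde f^*}V_1^* )$ is the restriction of $\bigoplus_n\Phi_{\cup,*}^{\otimes n}$ to $\bigwedge(V_1\cup_{\tilde f}V_2)$. Actions. The standard Clifford action of $C\ell(V,g)$ on $\bigwedge_*(V)$ is the fibrewise algebra homomorphism into endomorphisms determined on $v\in V$ by $c(v)(v_1\wedge\cdots\wedge v_k)=v\wedge v_1\wedge\cdots\wedge v_k-\sum_{j=1}^k(-1)^{j+1}g(\pi(v))(v,v_j)\,v_1\wedge\cdots\wedge v_{j-1}\wedge v_{j+1}\wedge\cdots\wedge v_k$. $c^*$ is the standard action of $C\ell((V_1\cup_{\tilde f}V_2)^*,\tilde g^* )$ on $\bigwedge(V_1\cup_{\tilde f}V_2)=\bigwedge_*((V_1\cup_{\tilde f}V_2)^* )$; $\tilde c_{*,\cup}$ is the standard action of $C\ell(V_2^*\cup_{\tilde f^*}V_1^*,\widetilde{g^*})$ on $\bigwedge_*(V_2^*\cup_{\tilde f^*}V_1^* )$. *)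

theory Defs
  imports
    "HOL-Analysis.Analysis"
    "HOL-Algebra.Algebra"
    "HOL-Algebra.Algebraic_Closure_Type"
    "HOL-Library.Poly_Mapping"
    "HOL-Combinatorics.Permutations"
begin

section \<open>Diffeological spaces\<close>

text \<open>
  Following \<^const>\<open>Euclidean_space\<close>, a point of $\mathbb R^n$ is a function
  \<^typ>\<open>nat \<Rightarrow> real\<close> that vanishes from the index $n$ on.
\<close>

type_synonym point = "nat \<Rightarrow> real"

definition open_dom :: "nat \<Rightarrow> point set \<Rightarrow> bool" where
  "open_dom n U \<longleftrightarrow> openin (Euclidean_space n) U"

primrec Ck_on :: "nat \<Rightarrow> nat \<Rightarrow> point set \<Rightarrow> (point \<Rightarrow> real) \<Rightarrow> bool" where
  "Ck_on 0 n U f \<longleftrightarrow> continuous_on U f"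
| "Ck_on (Suc k) n U f \<longleftrightarrow> continuous_on U f \<and>
     (\<forall>i<n. \<exists>f'. (\<forall>x\<in>U. ((\<lambda>t. f (x(i := t))) has_real_derivative f' x) (at (x i))) \<and> Ck_on k n U f')"

definition smooth_fun :: "nat \<Rightarrow> point set \<Rightarrow> (point \<Rightarrow> real) \<Rightarrow> bool" where
  "smooth_fun n U f \<longleftrightarrow> (\<forall>k. Ck_on k n U f)"

definition smooth_dom_map :: "nat \<Rightarrow> point set \<Rightarrow> nat \<Rightarrow> point set \<Rightarrow> (point \<Rightarrow> point) \<Rightarrow> bool" where
  "smooth_dom_map m W n U F \<longleftrightarrow>
     open_dom m W \<and> open_dom n U \<and> F ` W \<subseteq> U \<and> (\<forall>j<n. smooth_fun m W (\<lambda>w. F w j))"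

text \<open>
  \<open>plot D n U p\<close> says that \<open>p\<close>, restricted to the open set \<open>U\<close> of $\mathbb R^n$, is a plot;
  the values of \<open>p\<close> outside \<open>U\<close> are irrelevant.
\<close>

record 'a diffeology =
  points :: "'a set"
  plot :: "nat \<Rightarrow> point set \<Rightarrow> (point \<Rightarrow> 'a) \<Rightarrow> bool"

definition diffeological_space :: "'a diffeology \<Rightarrow> bool" where
  "diffeological_space D \<longleftrightarrow>
     (\<forall>n U p. plot D n U p \<longrightarrow> open_dom n U \<and> p ` U \<subseteq> points D) \<and>
     (\<forall>n U. \<forall>x\<in>points D. open_dom n U \<longrightarrow> plot D n U (\<lambda>_. x)) \<and>
     (\<forall>n U p. open_dom n U \<and> (\<forall>u\<in>U. \<exists>W\<subseteq>U. open_dom n W \<and> u \<in> W \<and> plot D n W p) \<longrightarrow> plot D n U p) \<and>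
     (\<forall>n U p m W F q. plot D n U p \<and> smooth_dom_map m W n U F \<and> (\<forall>w\<in>W. q w = p (F w)) \<longrightarrow> plot D m W q)"

definition smooth_map :: "'a diffeology \<Rightarrow> 'b diffeology \<Rightarrow> ('a \<Rightarrow> 'b) \<Rightarrow> bool" where
  "smooth_map D D' f \<longleftrightarrow>
     f ` points D \<subseteq> points D' \<and> (\<forall>n U p. plot D n U p \<longrightarrow> plot D' n U (f \<circ> p))"

definition diffeomorphism :: "'a diffeology \<Rightarrow> 'b diffeology \<Rightarrow> ('a \<Rightarrow> 'b) \<Rightarrow> bool" where
  "diffeomorphism D D' f \<longleftrightarrow>
     bij_betw f (points D) (points D') \<and> smooth_map D D' f \<and> smooth_map D' D (inv_into (points D) f)"

definition sub_space :: "'a diffeology \<Rightarrow> 'a set \<Rightarrow> 'a diffeology" where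
  "sub_space D A = \<lparr>points = points D \<inter> A, plot = (\<lambda>n U p. plot D n U p \<and> p ` U \<subseteq> A)\<rparr>"

definition diffeo_onto_image :: "'a diffeology \<Rightarrow> 'a set \<Rightarrow> 'b diffeology \<Rightarrow> ('a \<Rightarrow> 'b) \<Rightarrow> bool" where
  "diffeo_onto_image D A D' f \<longleftrightarrow>
     diffeomorphism (sub_space D A) (sub_space D' (f ` points (sub_space D A))) f"

definition quotient_space :: "'a diffeology \<Rightarrow> ('a \<Rightarrow> 'b) \<Rightarrow> 'b diffeology" where
  "quotient_space D q =
     \<lparr>points = q ` points D,
      plot = (\<lambda>n U p. open_dom n U \<and>
        (\<forall>u\<in>U. \<exists>W\<subseteq>U. open_dom n W \<and> u \<in> W \<and> (\<exists>p'. plot D n W p' \<and> (\<forall>w\<in>W. p w = q (p' w)))))\<rparr>"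

definition prod_space :: "'a diffeology \<Rightarrow> 'b diffeology \<Rightarrow> ('a \<times> 'b) diffeology" where
  "prod_space D D' =
     \<lparr>points = points D \<times> points D',
      plot = (\<lambda>n U p. plot D n U (fst \<circ> p) \<and> plot D' n U (snd \<circ> p))\<rparr>"

definition sum_space :: "'a diffeology \<Rightarrow> 'b diffeology \<Rightarrow> ('a + 'b) diffeology" where
  "sum_space D D' =
     \<lparr>points = points D <+> points D',
      plot = (\<lambda>n U p. open_dom n U \<and>
        (\<forall>u\<in>U. \<exists>W\<subseteq>U. open_dom n W \<and> u \<in> W \<and>
          ((\<exists>q. plot D n W q \<and> (\<forall>w\<in>W. p w = Inl (q w))) \<or>
           (\<exists>q. plot D' n W q \<and> (\<forall>w\<in>W. p w = Inr (q w))))))\<rparr>"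

definition domain_space :: "nat \<Rightarrow> point set \<Rightarrow> point diffeology" where
  "domain_space n U = \<lparr>points = U, plot = (\<lambda>m W p. smooth_dom_map m W n U p)\<rparr>"

definition real_space :: "real diffeology" where
  "real_space = \<lparr>points = UNIV, plot = (\<lambda>n U p. open_dom n U \<and> smooth_fun n U p)\<rparr>"

text \<open>Openness in the D-topology.\<close>

definition D_open :: "'a diffeology \<Rightarrow> 'a set \<Rightarrow> bool" where
  "D_open D A \<longleftrightarrow> A \<subseteq> points D \<and> (\<forall>n U p. plot D n U p \<longrightarrow> open_dom n {u \<in> U. p u \<in> A})"


section \<open>Real vector spaces with explicit carriers\<close>

text \<open>
  Vector spaces and algebras over the reals are \<^typ>\<open>(real, 'v) module\<close> records; for mere vector
  spaces the fields \<^const>\<open>mult\<close> and \<^const>\<open>one\<close> of the record are unused.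
\<close>

abbreviation real_vs :: "(real, 'v) module \<Rightarrow> bool" where
  "real_vs E \<equiv> Module.module (ring_of_type_algebra :: real ring) E"

definition lin_map :: "(real, 'v) module \<Rightarrow> (real, 'w) module \<Rightarrow> ('v \<Rightarrow> 'w) \<Rightarrow> bool" where
  "lin_map E E' h \<longleftrightarrow> h \<in> carrier E \<rightarrow> carrier E' \<and>
     (\<forall>v\<in>carrier E. \<forall>w\<in>carrier E. h (v \<oplus>\<^bsub>E\<^esub> w) = h v \<oplus>\<^bsub>E'\<^esub> h w) \<and>
     (\<forall>c. \<forall>v\<in>carrier E. h (c \<odot>\<^bsub>E\<^esub> v) = c \<odot>\<^bsub>E'\<^esub> h v)"

definition has_dim :: "(real, 'v) module \<Rightarrow> nat \<Rightarrow> bool" where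
  "has_dim E n \<longleftrightarrow> (\<exists>b. (\<forall>i<n. b i \<in> carrier E) \<and>
     (\<forall>v\<in>carrier E. \<exists>!c. c \<in> {..<n} \<rightarrow>\<^sub>E UNIV \<and> v = (\<Oplus>\<^bsub>E\<^esub>i\<in>{..<n}. c i \<odot>\<^bsub>E\<^esub> b i)))"


section \<open>Tensor, Clifford and exterior algebras of a vector space\<close>

text \<open>
  The tensor algebra is the free associative algebra on the set of vectors modulo linearity of
  the generators. The free algebra consists of the finitely supported real functions on the free
  monoid; the multiplication of \<^typ>\<open>'a \<Rightarrow>\<^sub>0 real\<close> is the convolution.
\<close>

datatype 'a fword = FWord (letters: "'a list")

instantiation fword :: (type) monoid_add
begin
definition zero_fword :: "'a fword" where "zero_fword = FWord []"
definition plus_fword :: "'a fword \<Rightarrow> 'a fword \<Rightarrow> 'a fword" where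
  "plus_fword u w = FWord (letters u @ letters w)"
instance by standard (simp_all add: zero_fword_def plus_fword_def)
end

type_synonym 'v tens = "('v fword \<Rightarrow>\<^sub>0 real) set"
type_synonym 'v cliff = "'v tens set"

definition free_alg :: "(real, 'v) module \<Rightarrow> (real, 'v fword \<Rightarrow>\<^sub>0 real) module" where
  "free_alg E = \<lparr>carrier = {a. \<forall>u\<in>Poly_Mapping.keys a. set (letters u) \<subseteq> carrier E},
     mult = (*), one = 1, ring.zero = 0, add = (+),
     smult = (\<lambda>c a. Poly_Mapping.single (FWord []) c * a)\<rparr>"

definition alg_quot :: "(real, 'a) module \<Rightarrow> 'a set \<Rightarrow> (real, 'a set) module" where
  "alg_quot R I = \<lparr>carrier = carrier (R Quot I), mult = mult (R Quot I), one = one (R Quot I),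
     ring.zero = ring.zero (R Quot I), add = add (R Quot I),
     smult = (\<lambda>c A. the_elem ((\<lambda>a. I +>\<^bsub>R\<^esub> (c \<odot>\<^bsub>R\<^esub> a)) ` A))\<rparr>"

definition free_gen :: "'v \<Rightarrow> 'v fword \<Rightarrow>\<^sub>0 real" where
  "free_gen v = Poly_Mapping.single (FWord [v]) 1"

definition tensor_ideal :: "(real, 'v) module \<Rightarrow> ('v fword \<Rightarrow>\<^sub>0 real) set" where
  "tensor_ideal E = Idl\<^bsub>free_alg E\<^esub>
     ({free_gen (v \<oplus>\<^bsub>E\<^esub> w) - free_gen v - free_gen w |v w. v \<in> carrier E \<and> w \<in> carrier E} \<union>
      {free_gen (c \<odot>\<^bsub>E\<^esub> v) - c \<odot>\<^bsub>free_alg E\<^esub> free_gen v |c v. v \<in> carrier E})"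

definition tensor_alg :: "(real, 'v) module \<Rightarrow> (real, 'v tens) module" where
  "tensor_alg E = alg_quot (free_alg E) (tensor_ideal E)"

definition tensor_class :: "(real, 'v) module \<Rightarrow> ('v fword \<Rightarrow>\<^sub>0 real) \<Rightarrow> 'v tens" where
  "tensor_class E a = tensor_ideal E +>\<^bsub>free_alg E\<^esub> a"

text \<open>\<open>pure_tensor E [v\<^sub>1, \<dots>, v\<^sub>n]\<close> is $v_1\otimes\cdots\otimes v_n$.\<close>

definition pure_tensor :: "(real, 'v) module \<Rightarrow> 'v list \<Rightarrow> 'v tens" where
  "pure_tensor E vs = tensor_class E (Poly_Mapping.single (FWord vs) 1)"

text \<open>
  The direct sum of the tensor powers $E^{\otimes n}$, $n\in L$, inside the tensor algebra;
  $E^{\otimes n}$ itself is the case $L=\{n\}$.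
\<close>

definition tensors :: "(real, 'v) module \<Rightarrow> nat set \<Rightarrow> 'v tens set" where
  "tensors E L = tensor_class E `
     {a \<in> carrier (free_alg E). \<forall>u\<in>Poly_Mapping.keys a. length (letters u) \<in> L}"

text \<open>The algebra map $\bigoplus_n h^{\otimes n}$ induced by a linear map $h$.\<close>

definition free_map :: "('v \<Rightarrow> 'w) \<Rightarrow> ('v fword \<Rightarrow>\<^sub>0 real) \<Rightarrow> ('w fword \<Rightarrow>\<^sub>0 real)" where
  "free_map h a = (\<Sum>u\<in>Poly_Mapping.keys a.
     Poly_Mapping.single (FWord (map h (letters u))) (Poly_Mapping.lookup a u))"

definition tensor_hom :: "(real, 'w) module \<Rightarrow> ('v \<Rightarrow> 'w) \<Rightarrow> 'v tens \<Rightarrow> 'w tens" where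
  "tensor_hom E' h A = the_elem ((\<lambda>a. tensor_class E' (free_map h a)) ` A)"

definition clifford_ideal :: "(real, 'v) module \<Rightarrow> ('v \<Rightarrow> 'v \<Rightarrow> real) \<Rightarrow> 'v tens set" where
  "clifford_ideal E b = Idl\<^bsub>tensor_alg E\<^esub>
     {pure_tensor E [v, w] \<oplus>\<^bsub>tensor_alg E\<^esub> pure_tensor E [w, v]
        \<oplus>\<^bsub>tensor_alg E\<^esub> (2 * b v w) \<odot>\<^bsub>tensor_alg E\<^esub> \<one>\<^bsub>tensor_alg E\<^esub>
      |v w. v \<in> carrier E \<and> w \<in> carrier E}"

definition clifford_alg :: "(real, 'v) module \<Rightarrow> ('v \<Rightarrow> 'v \<Rightarrow> real) \<Rightarrow> (real, 'v cliff) module" where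
  "clifford_alg E b = alg_quot (tensor_alg E) (clifford_ideal E b)"

definition clifford_class :: "(real, 'v) module \<Rightarrow> ('v \<Rightarrow> 'v \<Rightarrow> real) \<Rightarrow> 'v tens \<Rightarrow> 'v cliff" where
  "clifford_class E b A = clifford_ideal E b +>\<^bsub>tensor_alg E\<^esub> A"

definition clifford_hom ::
  "(real, 'w) module \<Rightarrow> ('w \<Rightarrow> 'w \<Rightarrow> real) \<Rightarrow> ('v \<Rightarrow> 'w) \<Rightarrow> 'v cliff \<Rightarrow> 'w cliff" where
  "clifford_hom E' b' h C = the_elem ((\<lambda>A. clifford_class E' b' (tensor_hom E' h A)) ` C)"

definition free_alt :: "('v fword \<Rightarrow>\<^sub>0 real) \<Rightarrow> ('v fword \<Rightarrow>\<^sub>0 real)" where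
  "free_alt a = (\<Sum>u\<in>Poly_Mapping.keys a. \<Sum>\<sigma> | \<sigma> permutes {..<length (letters u)}.
     Poly_Mapping.single (FWord (permute_list \<sigma> (letters u)))
       (Poly_Mapping.lookup a u * of_int (sign \<sigma>) / fact (length (letters u))))"

definition Alt :: "(real, 'v) module \<Rightarrow> 'v tens \<Rightarrow> 'v tens" where
  "Alt E A = the_elem ((\<lambda>a. tensor_class E (free_alt a)) ` A)"

definition ext_power :: "(real, 'v) module \<Rightarrow> nat \<Rightarrow> 'v tens set" where
  "ext_power E n = Alt E ` tensors E {n}"

definition ext_carrier :: "(real, 'v) module \<Rightarrow> 'v tens set" where
  "ext_carrier E = {(\<Oplus>\<^bsub>tensor_alg E\<^esub>n\<in>{..N}. A n) |N A. \<forall>n\<le>N. A n \<in> ext_power E n}"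

definition ext_space :: "(real, 'v) module \<Rightarrow> (real, 'v tens) module" where
  "ext_space E = (tensor_alg E)\<lparr>carrier := ext_carrier E\<rparr>"

definition wedge :: "(real, 'v) module \<Rightarrow> 'v list \<Rightarrow> 'v tens" where
  "wedge E vs = Alt E (pure_tensor E vs)"

definition End_ring :: "(real, 'a) module \<Rightarrow> ('a \<Rightarrow> 'a) ring" where
  "End_ring M = \<lparr>carrier = {S \<in> carrier M \<rightarrow>\<^sub>E carrier M. lin_map M M S},
     mult = (\<lambda>S T. compose (carrier M) S T), one = (\<lambda>x\<in>carrier M. x),
     ring.zero = (\<lambda>x\<in>carrier M. \<zero>\<^bsub>M\<^esub>), add = (\<lambda>S T. \<lambda>x\<in>carrier M. S x \<oplus>\<^bsub>M\<^esub> T x)\<rparr>"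

text \<open>In the sum below \<open>j\<close> starts at 0, so that the sign $(-1)^{j+1}$ becomes \<open>(-1) ^ j\<close>.\<close>

definition is_standard_action ::
  "(real, 'v) module \<Rightarrow> ('v \<Rightarrow> 'v \<Rightarrow> real) \<Rightarrow> ('v cliff \<Rightarrow> 'v tens \<Rightarrow> 'v tens) \<Rightarrow> bool" where
  "is_standard_action E b c \<longleftrightarrow>
     c \<in> extensional (carrier (clifford_alg E b)) \<and>
     c \<in> ring_hom (clifford_alg E b) (End_ring (ext_space E)) \<and>
     (\<forall>r. \<forall>C\<in>carrier (clifford_alg E b). \<forall>e\<in>ext_carrier E.
        c (r \<odot>\<^bsub>clifford_alg E b\<^esub> C) e = r \<odot>\<^bsub>ext_space E\<^esub> c C e) \<and>
     (\<forall>v\<in>carrier E. \<forall>vs\<in>lists (carrier E).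
        c (clifford_class E b (pure_tensor E [v])) (wedge E vs) =
          wedge E (v # vs) \<ominus>\<^bsub>tensor_alg E\<^esub>
          (\<Oplus>\<^bsub>tensor_alg E\<^esub>j\<in>{..<length vs}.
             ((-1) ^ j * b v (vs ! j)) \<odot>\<^bsub>tensor_alg E\<^esub> wedge E (take j vs @ drop (Suc j) vs)))"

definition standard_action ::
  "(real, 'v) module \<Rightarrow> ('v \<Rightarrow> 'v \<Rightarrow> real) \<Rightarrow> 'v cliff \<Rightarrow> 'v tens \<Rightarrow> 'v tens" where
  "standard_action E b = (THE c. is_standard_action E b c)"


section \<open>Diffeological vector pseudo-bundles\<close>

record ('v, 'x) vbundle =
  total :: "'v diffeology"
  base :: "'x diffeology"
  proj :: "'v \<Rightarrow> 'x"
  fplus :: "'v \<Rightarrow> 'v \<Rightarrow> 'v"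
  fscale :: "real \<Rightarrow> 'v \<Rightarrow> 'v"
  fzero :: "'x \<Rightarrow> 'v"

definition fibre :: "('v, 'x) vbundle \<Rightarrow> 'x \<Rightarrow> (real, 'v) module" where
  "fibre V x = \<lparr>carrier = {v \<in> points (total V). proj V v = x}, mult = undefined, one = undefined,
     ring.zero = fzero V x, add = fplus V, smult = fscale V\<rparr>"

definition preim :: "('v, 'x) vbundle \<Rightarrow> 'x set \<Rightarrow> 'v set" where
  "preim V A = {v \<in> points (total V). proj V v \<in> A}"

definition fibre_prod :: "('v, 'x) vbundle \<Rightarrow> ('w, 'x) vbundle \<Rightarrow> ('v \<times> 'w) diffeology" where
  "fibre_prod V W = sub_space (prod_space (total V) (total W)) {(v, w). proj V v = proj W w}"

definition pseudo_bundle :: "('v, 'x) vbundle \<Rightarrow> bool" where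
  "pseudo_bundle V \<longleftrightarrow>
     diffeological_space (total V) \<and> diffeological_space (base V) \<and>
     smooth_map (total V) (base V) (proj V) \<and> proj V ` points (total V) = points (base V) \<and>
     (\<forall>x\<in>points (base V). real_vs (fibre V x)) \<and>
     smooth_map (fibre_prod V V) (total V) (\<lambda>(v, w). fplus V v w) \<and>
     smooth_map (prod_space real_space (total V)) (total V) (\<lambda>(c, v). fscale V c v) \<and>
     smooth_map (base V) (total V) (fzero V)"

definition finite_dim_bundle :: "('v, 'x) vbundle \<Rightarrow> bool" where
  "finite_dim_bundle V \<longleftrightarrow> (\<forall>x\<in>points (base V). \<exists>n. has_dim (fibre V x) n)"

definition bounded_dim_bundle :: "('v, 'x) vbundle \<Rightarrow> bool" where
  "bounded_dim_bundle V \<longleftrightarrow> (\<exists>N. \<forall>x\<in>points (base V). \<exists>n\<le>N. has_dim (fibre V x) n)"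

text \<open>
  The typical fibre of a local trivialisation around \<open>x\<close> may be taken to be the fibre at \<open>x\<close>, with
  its subset diffeology.
\<close>

definition locally_trivial :: "('v, 'x) vbundle \<Rightarrow> bool" where
  "locally_trivial V \<longleftrightarrow> (\<forall>x\<in>points (base V). \<exists>A h. D_open (base V) A \<and> x \<in> A \<and>
     diffeomorphism
       (prod_space (sub_space (base V) A) (sub_space (total V) (preim V {x})))
       (sub_space (total V) (preim V A)) h \<and>
     (\<forall>a\<in>A. (\<forall>v\<in>preim V {x}. proj V (h (a, v)) = a) \<and>
             lin_map (fibre V x) (fibre V a) (\<lambda>v. h (a, v))))"

text \<open>
  An element of the dual pseudo-bundle is a pair of a base point and a smooth linear functional on
  the fibre, extended by 0 outside the fibre. The condition that a plot of the dual projects to a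
  plot of the base is needed for the projection to be smooth at all: otherwise the zero functionals
  over the points of any curve whatsoever in the base would form a plot.
\<close>

definition dual_vectors :: "('v, 'x) vbundle \<Rightarrow> 'x \<Rightarrow> ('v \<Rightarrow> real) set" where
  "dual_vectors V x = {\<phi>.
     (\<forall>v\<in>carrier (fibre V x). \<forall>w\<in>carrier (fibre V x). \<phi> (fplus V v w) = \<phi> v + \<phi> w) \<and>
     (\<forall>c. \<forall>v\<in>carrier (fibre V x). \<phi> (fscale V c v) = c * \<phi> v) \<and>
     smooth_map (sub_space (total V) (preim V {x})) real_space \<phi> \<and>
     (\<forall>v. v \<notin> carrier (fibre V x) \<longrightarrow> \<phi> v = 0)}"

definition dual_bundle :: "('v, 'x) vbundle \<Rightarrow> ('x \<times> ('v \<Rightarrow> real), 'x) vbundle" where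
  "dual_bundle V = \<lparr>
     total = \<lparr>points = Sigma (points (base V)) (dual_vectors V),
       plot = (\<lambda>m U' q. open_dom m U' \<and> q ` U' \<subseteq> Sigma (points (base V)) (dual_vectors V) \<and>
         plot (base V) m U' (fst \<circ> q) \<and>
         (\<forall>n U p. plot (total V) n U p \<longrightarrow>
            smooth_map
              (sub_space (prod_space (domain_space m U') (domain_space n U))
                 {(u', u). fst (q u') = proj V (p u)})
              real_space (\<lambda>(u', u). snd (q u') (p u))))\<rparr>,
     base = base V,
     proj = fst,
     fplus = (\<lambda>\<xi> \<eta>. (fst \<xi>, \<lambda>v. snd \<xi> v + snd \<eta> v)),
     fscale = (\<lambda>c \<xi>. (fst \<xi>, \<lambda>v. c * snd \<xi> v)),
     fzero = (\<lambda>x. (x, \<lambda>_. 0))\<rparr>"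

text \<open>
  \<open>fibre_power V n\<close> is the \<open>n\<close>-fold fibre product of \<open>V\<close> with itself; recording the base point
  makes it the base when \<open>n = 0\<close>.
\<close>

definition fibre_power :: "('v, 'x) vbundle \<Rightarrow> nat \<Rightarrow> ('x \<times> 'v list) diffeology" where
  "fibre_power V n = \<lparr>
     points = {(x, vs). x \<in> points (base V) \<and> length vs = n \<and> set vs \<subseteq> carrier (fibre V x)},
     plot = (\<lambda>m U p. plot (base V) m U (fst \<circ> p) \<and>
       (\<forall>u\<in>U. length (snd (p u)) = n \<and> set (snd (p u)) \<subseteq> carrier (fibre V (fst (p u)))) \<and>
       (\<forall>i<n. plot (total V) m U (\<lambda>u. snd (p u) ! i)))\<rparr>"

text \<open>
  \<open>tensor_bundle L V\<close> is the direct sum of the $V^{\otimes n}$ with $n\in L$, with the finest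
  pseudo-bundle diffeology, i.e. the intersection of all of them, for which the maps
  $V\times_X\cdots\times_X V\to V^{\otimes n}$ are smooth. Thus \<open>tensor_bundle {2} V\<close> is
  $V\otimes V$ and \<open>tensor_bundle UNIV V\<close> is $T(V)$.
\<close>

definition tensor_points :: "nat set \<Rightarrow> ('v, 'x) vbundle \<Rightarrow> ('x \<times> 'v tens) set" where
  "tensor_points L V = Sigma (points (base V)) (\<lambda>x. tensors (fibre V x) L)"

definition tensor_bundle_with ::
  "nat set \<Rightarrow> ('v, 'x) vbundle \<Rightarrow> (nat \<Rightarrow> point set \<Rightarrow> (point \<Rightarrow> 'x \<times> 'v tens) \<Rightarrow> bool) \<Rightarrow>
   ('x \<times> 'v tens, 'x) vbundle" where
  "tensor_bundle_with L V P = \<lparr>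
     total = \<lparr>points = tensor_points L V, plot = P\<rparr>,
     base = base V,
     proj = fst,
     fplus = (\<lambda>(x, A) (_, B). (x, A \<oplus>\<^bsub>tensor_alg (fibre V x)\<^esub> B)),
     fscale = (\<lambda>c (x, A). (x, c \<odot>\<^bsub>tensor_alg (fibre V x)\<^esub> A)),
     fzero = (\<lambda>x. (x, \<zero>\<^bsub>tensor_alg (fibre V x)\<^esub>))\<rparr>"

definition tensor_bundle :: "nat set \<Rightarrow> ('v, 'x) vbundle \<Rightarrow> ('x \<times> 'v tens, 'x) vbundle" where
  "tensor_bundle L V = tensor_bundle_with L V
     (\<lambda>m U p. \<forall>P. pseudo_bundle (tensor_bundle_with L V P) \<and>
        (\<forall>n\<in>L. smooth_map (fibre_power V n) (total (tensor_bundle_with L V P))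
           (\<lambda>(x, vs). (x, pure_tensor (fibre V x) vs)))
        \<longrightarrow> P m U p)"

subsection \<open>Pseudo-metrics\<close>

text \<open>The bilinear form $(v,w)\mapsto\sum_i\xi_i(v)\eta_i(w)$ given by $\sum_i\xi_i\otimes\eta_i\in V^*\otimes V^*$.\<close>

definition tensor_form :: "('x \<times> ('v \<Rightarrow> real)) tens \<Rightarrow> 'v \<Rightarrow> 'v \<Rightarrow> real" where
  "tensor_form A v w = the_elem ((\<lambda>a. \<Sum>u | u \<in> Poly_Mapping.keys a \<and> length (letters u) = 2.
     Poly_Mapping.lookup a u * snd (letters u ! 0) v * snd (letters u ! 1) w) ` A)"

text \<open>The map $\Psi_g$.\<close>

definition flat :: "('v, 'x) vbundle \<Rightarrow> ('x \<Rightarrow> 'v \<Rightarrow> 'v \<Rightarrow> real) \<Rightarrow> 'v \<Rightarrow> 'x \<times> ('v \<Rightarrow> real)" where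
  "flat V g v = (proj V v,
     \<lambda>w. if w \<in> carrier (fibre V (proj V v)) then g (proj V v) v w else 0)"

text \<open>
  A pseudo-metric is represented by the family of bilinear forms corresponding to the values of a
  smooth section of $V^*\otimes V^*$. The rank of \<open>g x\<close> is the dimension of the image of the fibre
  under \<^const>\<open>flat\<close>.
\<close>

definition pseudo_metric :: "('v, 'x) vbundle \<Rightarrow> ('x \<Rightarrow> 'v \<Rightarrow> 'v \<Rightarrow> real) \<Rightarrow> bool" where
  "pseudo_metric V g \<longleftrightarrow>
     (\<exists>s. smooth_map (base V) (total (tensor_bundle {2} (dual_bundle V))) s \<and>
        (\<forall>x\<in>points (base V). fst (s x) = x \<and>
           (\<forall>v\<in>carrier (fibre V x). \<forall>w\<in>carrier (fibre V x). g x v w = tensor_form (snd (s x)) v w))) \<and>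
     (\<forall>x\<in>points (base V).
        (\<forall>v\<in>carrier (fibre V x). \<forall>w\<in>carrier (fibre V x). g x v w = g x w v) \<and>
        (\<forall>v\<in>carrier (fibre V x). 0 \<le> g x v v) \<and>
        (\<exists>n. has_dim (fibre (dual_bundle V) x) n \<and>
             has_dim ((fibre (dual_bundle V) x)\<lparr>carrier := flat V g ` carrier (fibre V x)\<rparr>) n))"

definition dual_metric ::
  "('v, 'x) vbundle \<Rightarrow> ('x \<Rightarrow> 'v \<Rightarrow> 'v \<Rightarrow> real) \<Rightarrow>
   'x \<Rightarrow> 'x \<times> ('v \<Rightarrow> real) \<Rightarrow> 'x \<times> ('v \<Rightarrow> real) \<Rightarrow> real" where
  "dual_metric V g x \<xi> \<eta> = (THE r. \<exists>v\<in>carrier (fibre V x). \<exists>w\<in>carrier (fibre V x).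
     flat V g v = \<xi> \<and> flat V g w = \<eta> \<and> r = g x v w)"

subsection \<open>Clifford and exterior pseudo-bundles\<close>

definition clifford_bundle ::
  "('v, 'x) vbundle \<Rightarrow> ('x \<Rightarrow> 'v \<Rightarrow> 'v \<Rightarrow> real) \<Rightarrow> ('x \<times> 'v cliff, 'x) vbundle" where
  "clifford_bundle V g = \<lparr>
     total = quotient_space (total (tensor_bundle UNIV V))
       (\<lambda>(x, A). (x, clifford_class (fibre V x) (g x) A)),
     base = base V,
     proj = fst,
     fplus = (\<lambda>(x, A) (_, B). (x, A \<oplus>\<^bsub>clifford_alg (fibre V x) (g x)\<^esub> B)),
     fscale = (\<lambda>c (x, A). (x, c \<odot>\<^bsub>clifford_alg (fibre V x) (g x)\<^esub> A)),
     fzero = (\<lambda>x. (x, \<zero>\<^bsub>clifford_alg (fibre V x) (g x)\<^esub>))\<rparr>"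

text \<open>\<open>exterior_bundle V\<close> is $\bigwedge_*(V)$, so that $\bigwedge(V)$ is \<open>exterior_bundle (dual_bundle V)\<close>.\<close>

definition exterior_bundle :: "('v, 'x) vbundle \<Rightarrow> ('x \<times> 'v tens, 'x) vbundle" where
  "exterior_bundle V = (tensor_bundle UNIV V)\<lparr>
     total := sub_space (total (tensor_bundle UNIV V))
       (Sigma (points (base V)) (\<lambda>x. ext_carrier (fibre V x)))\<rparr>"

definition clifford_action ::
  "('v, 'x) vbundle \<Rightarrow> ('x \<Rightarrow> 'v \<Rightarrow> 'v \<Rightarrow> real) \<Rightarrow> 'x \<times> 'v cliff \<Rightarrow> 'x \<times> 'v tens \<Rightarrow> 'x \<times> 'v tens" where
  "clifford_action V g a e =
     (fst a, standard_action (fibre V (fst a)) (g (fst a)) (snd a) (snd e))"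

text \<open>The map of bases covered by a fibrewise linear map of pseudo-bundles.\<close>

definition covered :: "('v, 'x) vbundle \<Rightarrow> ('w, 'y) vbundle \<Rightarrow> ('v \<Rightarrow> 'w) \<Rightarrow> 'x \<Rightarrow> 'y" where
  "covered V W h x = proj W (h (fzero V x))"

definition clifford_map ::
  "('v, 'x) vbundle \<Rightarrow> ('w, 'y) vbundle \<Rightarrow> ('y \<Rightarrow> 'w \<Rightarrow> 'w \<Rightarrow> real) \<Rightarrow> ('v \<Rightarrow> 'w) \<Rightarrow>
   'x \<times> 'v cliff \<Rightarrow> 'y \<times> 'w cliff" where
  "clifford_map V W g' h a =
     (let y = covered V W h (fst a) in (y, clifford_hom (fibre W y) (g' y) h (snd a)))"

definition tensor_map ::
  "('v, 'x) vbundle \<Rightarrow> ('w, 'y) vbundle \<Rightarrow> ('v \<Rightarrow> 'w) \<Rightarrow> 'x \<times> 'v tens \<Rightarrow> 'y \<times> 'w tens" where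
  "tensor_map V W h a = (let y = covered V W h (fst a) in (y, tensor_hom (fibre W y) h (snd a)))"

definition exterior_map ::
  "('v, 'x) vbundle \<Rightarrow> ('w, 'y) vbundle \<Rightarrow> ('v \<Rightarrow> 'w) \<Rightarrow> 'x \<times> 'v tens \<Rightarrow> 'y \<times> 'w tens" where
  "exterior_map V W h = restrict (tensor_map V W h) (points (total (exterior_bundle V)))"


section \<open>Gluing\<close>

definition glue_class ::
  "'a diffeology \<Rightarrow> 'b diffeology \<Rightarrow> 'a set \<Rightarrow> ('a \<Rightarrow> 'b) \<Rightarrow> 'a + 'b \<Rightarrow> ('a + 'b) set" where
  "glue_class D1 D2 Y h s = {t \<in> points D1 <+> points D2.
     equivclp (\<lambda>s t. \<exists>z\<in>Y. s = Inl z \<and> t = Inr (h z)) s t}"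

definition glue_space ::
  "'a diffeology \<Rightarrow> 'b diffeology \<Rightarrow> 'a set \<Rightarrow> ('a \<Rightarrow> 'b) \<Rightarrow> ('a + 'b) set diffeology" where
  "glue_space D1 D2 Y h = quotient_space (sum_space D1 D2) (glue_class D1 D2 Y h)"

text \<open>
  The data $(\tilde f,f)$ of a gluing of \<open>src\<close> to \<open>tgt\<close>: \<open>bmap\<close> is $f$, defined on \<open>locus\<close>, and
  \<open>tmap\<close> is $\tilde f$, defined over \<open>locus\<close>; their values elsewhere are irrelevant.
\<close>

record ('v, 'x, 'w, 'y) gluing =
  src :: "('v, 'x) vbundle"
  tgt :: "('w, 'y) vbundle"
  locus :: "'x set"
  bmap :: "'x \<Rightarrow> 'y"
  tmap :: "'v \<Rightarrow> 'w"

definition is_gluing :: "('v, 'x, 'w, 'y) gluing \<Rightarrow> bool" where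
  "is_gluing G \<longleftrightarrow>
     locus G \<subseteq> points (base (src G)) \<and>
     smooth_map (sub_space (base (src G)) (locus G)) (base (tgt G)) (bmap G) \<and>
     smooth_map (sub_space (total (src G)) (preim (src G) (locus G))) (total (tgt G)) (tmap G) \<and>
     (\<forall>y\<in>locus G. lin_map (fibre (src G) y) (fibre (tgt G) (bmap G y)) (tmap G))"

definition i1 :: "('v, 'x, 'w, 'y) gluing \<Rightarrow> 'x \<Rightarrow> ('x + 'y) set" where
  "i1 G x = glue_class (base (src G)) (base (tgt G)) (locus G) (bmap G) (Inl x)"

definition i2 :: "('v, 'x, 'w, 'y) gluing \<Rightarrow> 'y \<Rightarrow> ('x + 'y) set" where
  "i2 G x = glue_class (base (src G)) (base (tgt G)) (locus G) (bmap G) (Inr x)"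

definition j1 :: "('v, 'x, 'w, 'y) gluing \<Rightarrow> 'v \<Rightarrow> ('v + 'w) set" where
  "j1 G v = glue_class (total (src G)) (total (tgt G)) (preim (src G) (locus G)) (tmap G) (Inl v)"

definition j2 :: "('v, 'x, 'w, 'y) gluing \<Rightarrow> 'w \<Rightarrow> ('v + 'w) set" where
  "j2 G v = glue_class (total (src G)) (total (tgt G)) (preim (src G) (locus G)) (tmap G) (Inr v)"

definition glued :: "('v, 'x, 'w, 'y) gluing \<Rightarrow> (('v + 'w) set, ('x + 'y) set) vbundle" where
  "glued G = \<lparr>
     total = glue_space (total (src G)) (total (tgt G)) (preim (src G) (locus G)) (tmap G),
     base = glue_space (base (src G)) (base (tgt G)) (locus G) (bmap G),
     proj = (\<lambda>A. THE P.
       (\<exists>v\<in>points (total (src G)). A = j1 G v \<and> P = i1 G (proj (src G) v)) \<or>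
       (\<exists>v\<in>points (total (tgt G)). A = j2 G v \<and> P = i2 G (proj (tgt G) v))),
     fplus = (\<lambda>A B. THE C.
       (\<exists>x. \<exists>v\<in>carrier (fibre (src G) x). \<exists>w\<in>carrier (fibre (src G) x).
          A = j1 G v \<and> B = j1 G w \<and> C = j1 G (fplus (src G) v w)) \<or>
       (\<exists>x. \<exists>v\<in>carrier (fibre (tgt G) x). \<exists>w\<in>carrier (fibre (tgt G) x).
          A = j2 G v \<and> B = j2 G w \<and> C = j2 G (fplus (tgt G) v w))),
     fscale = (\<lambda>c A. THE C.
       (\<exists>v\<in>points (total (src G)). A = j1 G v \<and> C = j1 G (fscale (src G) c v)) \<or>
       (\<exists>v\<in>points (total (tgt G)). A = j2 G v \<and> C = j2 G (fscale (tgt G) c v))),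
     fzero = (\<lambda>P. THE C.
       (\<exists>x\<in>points (base (src G)). P = i1 G x \<and> C = j1 G (fzero (src G) x)) \<or>
       (\<exists>x\<in>points (base (tgt G)). P = i2 G x \<and> C = j2 G (fzero (tgt G) x)))\<rparr>"

text \<open>The inverses of the natural inclusions.\<close>

definition i1_inv :: "('v, 'x, 'w, 'y) gluing \<Rightarrow> ('x + 'y) set \<Rightarrow> 'x" where
  "i1_inv G = inv_into (points (base (src G)) - locus G) (i1 G)"

definition i2_inv :: "('v, 'x, 'w, 'y) gluing \<Rightarrow> ('x + 'y) set \<Rightarrow> 'y" where
  "i2_inv G = inv_into (points (base (tgt G))) (i2 G)"

definition j1_inv :: "('v, 'x, 'w, 'y) gluing \<Rightarrow> ('v + 'w) set \<Rightarrow> 'v" where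
  "j1_inv G = inv_into (points (total (src G)) - preim (src G) (locus G)) (j1 G)"

definition j2_inv :: "('v, 'x, 'w, 'y) gluing \<Rightarrow> ('v + 'w) set \<Rightarrow> 'w" where
  "j2_inv G = inv_into (points (total (tgt G))) (j2 G)"

definition compatible ::
  "('v, 'x, 'w, 'y) gluing \<Rightarrow> ('x \<Rightarrow> 'v \<Rightarrow> 'v \<Rightarrow> real) \<Rightarrow> ('y \<Rightarrow> 'w \<Rightarrow> 'w \<Rightarrow> real) \<Rightarrow> bool" where
  "compatible G g1 g2 \<longleftrightarrow>
     (\<forall>y\<in>locus G. \<forall>v\<in>carrier (fibre (src G) y). \<forall>w\<in>carrier (fibre (src G) y).
        g1 y v w = g2 (bmap G y) (tmap G v) (tmap G w))"

definition glue_metric ::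
  "('v, 'x, 'w, 'y) gluing \<Rightarrow> ('x \<Rightarrow> 'v \<Rightarrow> 'v \<Rightarrow> real) \<Rightarrow> ('y \<Rightarrow> 'w \<Rightarrow> 'w \<Rightarrow> real) \<Rightarrow>
   ('x + 'y) set \<Rightarrow> ('v + 'w) set \<Rightarrow> ('v + 'w) set \<Rightarrow> real" where
  "glue_metric G g1 g2 P A B =
     (if P \<in> i1 G ` (points (base (src G)) - locus G)
      then g1 (i1_inv G P) (j1_inv G A) (j1_inv G B)
      else g2 (i2_inv G P) (j2_inv G A) (j2_inv G B))"

text \<open>The map $\tilde f^*$, defined over the image of \<open>locus\<close>, for injective $f$.\<close>

definition tmap_dual :: "('v, 'x, 'w, 'y) gluing \<Rightarrow> 'y \<times> ('w \<Rightarrow> real) \<Rightarrow> 'x \<times> ('v \<Rightarrow> real)" where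
  "tmap_dual G \<xi> = (let y = inv_into (locus G) (bmap G) (fst \<xi>) in
     (y, \<lambda>v. if v \<in> carrier (fibre (src G) y) then snd \<xi> (tmap G v) else 0))"

definition dual_gluing ::
  "('v, 'x, 'w, 'y) gluing \<Rightarrow> ('y \<times> ('w \<Rightarrow> real), 'y, 'x \<times> ('v \<Rightarrow> real), 'x) gluing" where
  "dual_gluing G = \<lparr>src = dual_bundle (tgt G), tgt = dual_bundle (src G), locus = bmap G ` locus G,
     bmap = inv_into (locus G) (bmap G), tmap = tmap_dual G\<rparr>"

text \<open>The maps $(j_1^{V_1})^*$ and $(j_2^{V_2})^*$.\<close>

definition j1_dual :: "('v, 'x, 'w, 'y) gluing \<Rightarrow>
    ('x + 'y) set \<times> (('v + 'w) set \<Rightarrow> real) \<Rightarrow> 'x \<times> ('v \<Rightarrow> real)" where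
  "j1_dual G \<xi> = (let x = i1_inv G (fst \<xi>) in
     (x, \<lambda>v. if v \<in> carrier (fibre (src G) x) then snd \<xi> (j1 G v) else 0))"

definition j2_dual :: "('v, 'x, 'w, 'y) gluing \<Rightarrow>
    ('x + 'y) set \<times> (('v + 'w) set \<Rightarrow> real) \<Rightarrow> 'y \<times> ('w \<Rightarrow> real)" where
  "j2_dual G \<xi> = (let x = i2_inv G (fst \<xi>) in
     (x, \<lambda>v. if v \<in> carrier (fibre (tgt G) x) then snd \<xi> (j2 G v) else 0))"

text \<open>The diffeomorphism $\Phi_{\cup,*}$.\<close>

definition Phi :: "('v, 'x, 'w, 'y) gluing \<Rightarrow>
    ('x + 'y) set \<times> (('v + 'w) set \<Rightarrow> real) \<Rightarrow> (('y \<times> ('w \<Rightarrow> real)) + ('x \<times> ('v \<Rightarrow> real))) set" where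
  "Phi G \<xi> =
     (if fst \<xi> \<in> i1 G ` (points (base (src G)) - locus G)
        then j2 (dual_gluing G) (j1_dual G \<xi>)
      else if fst \<xi> \<in> i2 G ` bmap G ` locus G
        then j2 (dual_gluing G) (tmap_dual G (j2_dual G \<xi>))
      else j1 (dual_gluing G) (j2_dual G \<xi>))"

end

theory Submission
  imports Defs "HOL-Library.Function_Algebras"
begin

text \<open>
  The Clifford action is natural with respect to linear isometries, and on each fibre \<open>Phi G\<close> is
  one. For the first point, let $F$ be the free algebra on the vectors of $E$, and for
  \<open>v\<close> in $E$ put $d_v(a)=v\,a-\iota_v(a)$, where $\iota_v$ is the signed contraction of words. These
  operators make $F$ a module over itself. Every alternating function of words
  is unchanged by antisymmetrization of its argument; applied to $w\mapsto\mathrm{Alt}(v w)$ and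
  $w\mapsto\mathrm{Alt}(\iota_v w)$, this shows that $d_v$ descends to the exterior algebra, and a
  computation on words gives $\mathrm{Alt}(d_vd_w+d_wd_v)=-2b(v,w)\mathrm{Alt}$. Hence the
  standard action exists, and on representatives it is given by a formula in words that commutes
  with every linear isometry.

  For the second point, the rank condition makes $\Psi_g$ surjective onto the dual fibre, so that
  dual metrics are computed on preimages. Over \<open>f(Y)\<close> a functional $\xi$ with
  $\tilde f^*\xi=\Psi_{g_1}(u)$ equals $\Psi_{g_2}(\tilde f u)$, because $\tilde f^*$ is injective,
  and compatibility shows that $\tilde f^*$ is an isometry.
\<close>

subsection \<open>Linear maps on free algebras\<close>

text \<open>\<open>standard_action\<close> is a definite description over functions on cosets of
  cosets, so the equation can be used only once existence and uniqueness of the action are known for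
  both forms. Representatives remove the difficulty: a Clifford element is \<open>cl a\<close>, an
  exterior element is \<open>ec x\<close>, and the action becomes
  \<open>ec (cliff_act b a x)\<close>, where \<open>a\<close> and \<open>x\<close> are combinations
  of words. The exterior algebra is here the image of \<open>Alt\<close> inside the tensor algebra,
  not a quotient by an ideal. Hence \<open>x\<close> is determined only up to the kernel of
  \<open>ec\<close>, which the operators d_v must preserve. The Clifford relation too holds only up
  to this kernel: vw + wv is nonzero in the free algebra and disappears under \<open>Alt\<close>. A
  pseudo-metric may be degenerate, so a functional can have many preimages under
  \<open>flat\<close>; the value of the dual metric does not depend on the choice. Glued fibres are
  copies of the original ones, and all facts about glued metrics are carried pointwise along these
  copies.\<close>

abbreviation scal :: "real \<Rightarrow> 'v fword \<Rightarrow>\<^sub>0 real" where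
  "scal c \<equiv> Poly_Mapping.single (FWord []) c"

abbreviation word :: "'v list \<Rightarrow> 'v fword \<Rightarrow>\<^sub>0 real" where
  "word u \<equiv> Poly_Mapping.single (FWord u) 1"

lemma FWord_plus [simp]: "FWord u + FWord w = FWord (u @ w)"
  by (simp add: plus_fword_def)

lemma scal_one [simp]: "scal 1 = 1"
  by (metis single_one zero_fword_def)

lemma scal_add: "scal (a + b) = scal a + scal b"
  by (rule single_add)

lemma scal_minus: "scal (- a) = - scal a"
  by (rule single_uminus)

lemma scal_mult: "scal a * scal b = scal (a * b)"
  by (simp add: mult_single)

lemma scal_single: "scal c * Poly_Mapping.single u d = Poly_Mapping.single u (c * d)"
  by (cases u) (simp add: mult_single)

lemma scal_word: "scal c * word u = Poly_Mapping.single (FWord u) c"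
  by (simp add: mult_single)

lemma word_mult: "word u * word w = word (u @ w)"
  by (simp add: mult_single)

lemma word_Cons: "word (v # u) = free_gen v * word u"
  by (simp add: free_gen_def mult_single)

lemma word_gen_mult: "word p * (free_gen z * a) = word (p @ [z]) * a"
  by (simp add: free_gen_def mult_single mult.assoc[symmetric])

lemma poly_mapping_sum_singles: "(\<Sum>u\<in>Poly_Mapping.keys a. Poly_Mapping.single u (Poly_Mapping.lookup a u)) = a"
  by (rule poly_mapping_eqI) (auto simp: lookup_sum lookup_single when_def in_keys_iff sum.delta)

text \<open>The case of a single word is required only for words in the support of the given
  element. Membership in \<open>carrier (free_alg E)\<close> is a condition on the support, so
  induction inside that carrier follows from this form.\<close>

lemma poly_mapping_single_induct [case_names zero single add]:
  fixes a :: "'k \<Rightarrow>\<^sub>0 real"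
  assumes "P 0" and "\<And>u c. u \<in> Poly_Mapping.keys a \<Longrightarrow> P (Poly_Mapping.single u c)"
    and "\<And>x y. P x \<Longrightarrow> P y \<Longrightarrow> P (x + y)"
  shows "P a"
proof -
  have "P (\<Sum>u\<in>S. Poly_Mapping.single u (Poly_Mapping.lookup a u))" if "finite S" "S \<subseteq> Poly_Mapping.keys a" for S
    using that by (induction S) (auto intro: assms)
  from this[of "Poly_Mapping.keys a"] show ?thesis by (simp add: poly_mapping_sum_singles)
qed

lemma scal_central: "scal c * a = a * scal c"
proof (induction a rule: poly_mapping_single_induct)
  case (single u d) then show ?case by (cases u) (simp add: mult_single mult.commute)
qed (simp_all add: distrib_left distrib_right)

lemma scal_left_commute: "a * (scal c * b) = scal c * (a * b)"
  by (metis scal_central mult.assoc)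

lemmas scal_gen_commute = scal_left_commute[of "free_gen v" for v] scal_left_commute[of "word u" for u]

text \<open>Extension of a function of words to the free vector space on them.
  \<open>free_alt\<close>, \<open>contr b v\<close>, \<open>free_map h\<close> and
  \<open>cliff_act b\<close> (in the acting element) are all of this form, so linearity is proved
  once and identities are checked on words.\<close>

definition wlin :: "('v list \<Rightarrow> 'w fword \<Rightarrow>\<^sub>0 real) \<Rightarrow> ('v fword \<Rightarrow>\<^sub>0 real) \<Rightarrow> ('w fword \<Rightarrow>\<^sub>0 real)" where
  "wlin \<phi> a = (\<Sum>u\<in>Poly_Mapping.keys a. scal (Poly_Mapping.lookup a u) * \<phi> (letters u))"

lemma wlin_single [simp]: "wlin \<phi> (Poly_Mapping.single u c) = scal c * \<phi> (letters u)"
  by (simp add: wlin_def)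

lemma wlin_zero [simp]: "wlin \<phi> 0 = 0"
  by (simp add: wlin_def)

lemma wlin_add: "wlin \<phi> (a + b) = wlin \<phi> a + wlin \<phi> b"
  unfolding wlin_def by (rule setsum_keys_plus_distrib) (simp_all add: scal_add distrib_right)

lemma wlin_scal: "wlin \<phi> (scal c * a) = scal c * wlin \<phi> a"
proof (induction a rule: poly_mapping_single_induct)
  case (single u d) then show ?case
    by (simp add: scal_single mult.assoc[symmetric])
qed (simp_all add: distrib_left wlin_add)

lemma wlin_minus: "wlin \<phi> (- a) = - wlin \<phi> a"
  by (metis add_eq_0_iff wlin_add wlin_zero add.right_inverse)

lemma wlin_diff: "wlin \<phi> (a - b) = wlin \<phi> a - wlin \<phi> b"
  by (metis add_uminus_conv_diff wlin_add wlin_minus)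

lemma wlin_sum: "wlin \<phi> (\<Sum>i\<in>S. a i) = (\<Sum>i\<in>S. wlin \<phi> (a i))"
  by (induction S rule: infinite_finite_induct) (simp_all add: wlin_add)

lemma wlin_fun_add: "wlin (\<lambda>u. \<phi> u + \<psi> u) a = wlin \<phi> a + wlin \<psi> a"
  by (simp add: wlin_def distrib_left sum.distrib)

lemma wlin_fun_scal: "wlin (\<lambda>u. scal c * \<phi> u) a = scal c * wlin \<phi> a"
  unfolding wlin_def sum_distrib_left by (intro sum.cong refl scal_left_commute)

lemma wlin_linear_eqI:
  assumes "\<And>x y. L (x + y) = L x + L y" and "\<And>c x. L (scal c * x) = scal c * L x"
    and "\<And>l. FWord l \<in> Poly_Mapping.keys a \<Longrightarrow> L (word l) = \<phi> l"
  shows "L a = wlin \<phi> a"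
proof -
  have L0: "L 0 = 0" using assms(2)[of 0 0] by simp
  show ?thesis
  proof (induction a rule: poly_mapping_single_induct)
    case (single u d) then show ?case
      using assms(2)[of d "word (letters u)"] assms(3)[of "letters u"] by (cases u) (simp add: scal_word)
  qed (simp_all add: wlin_add assms(1) L0)
qed

subsection \<open>Alternating functions of words\<close>

text \<open>Only exchanges of neighbouring letters are demanded, which an induction over the prefix
  can verify; \<open>alternating_permute\<close> extends this to all permutations.\<close>

definition alternating :: "('v list \<Rightarrow> 'w fword \<Rightarrow>\<^sub>0 real) \<Rightarrow> bool" where
  "alternating \<phi> \<longleftrightarrow> (\<forall>p x y q. \<phi> (p @ x # y # q) = - \<phi> (p @ y # x # q))"

lemma alternatingD: "alternating \<phi> \<Longrightarrow> \<phi> (p @ x # y # q) = - \<phi> (p @ y # x # q)"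
  unfolding alternating_def by blast

text \<open>Moving \<open>x\<close> past the first letter \<open>z\<close> of the gap, exchanging
  across the shorter gap and moving \<open>z\<close> behind \<open>y\<close> costs three signs,
  hence one.\<close>

lemma alternating_swap:
  assumes "alternating \<phi>"
  shows "\<phi> (p @ x # q @ y # r) = - \<phi> (p @ y # q @ x # r)"
proof (induction q arbitrary: p)
  case Nil
  show ?case using alternatingD[OF assms, of p x y r] by simp
next
  case (Cons z q)
  have "\<phi> (p @ x # z # q @ y # r) = - \<phi> (p @ z # x # q @ y # r)"
    by (rule alternatingD[OF assms])
  moreover have "\<phi> ((p @ [z]) @ x # q @ y # r) = - \<phi> ((p @ [z]) @ y # q @ x # r)"
    by (rule Cons.IH)
  moreover have "\<phi> (p @ z # y # q @ x # r) = - \<phi> (p @ y # z # q @ x # r)"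
    by (rule alternatingD[OF assms])
  ultimately show ?case by simp
qed

text \<open>Splits the word at the two exchanged positions, so that a transposition of indices
  becomes the exchange of two letters treated by \<open>alternating_swap\<close>.\<close>

lemma permute_list_transpose:
  assumes "i < j" "j < length w"
  shows "\<exists>p x q y r. w = p @ x # q @ y # r \<and>
    permute_list (Transposition.transpose i j) w = p @ y # q @ x # r"
proof -
  define p where "p = take i w"
  define q where "q = take (j - Suc i) (drop (Suc i) w)"
  define r where "r = drop (Suc j) w"
  have w: "w = p @ w ! i # q @ w ! j # r"
    unfolding p_def q_def r_def using assms
    by (metis Cons_nth_drop_Suc append_take_drop_id drop_drop id_take_nth_drop le_add_diff_inverse2
        less_trans Suc_leI)
  have len: "length p = i" "length q = j - Suc i" using assms by (auto simp: p_def q_def)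
  have "permute_list (Transposition.transpose i j) w = p @ w ! j # q @ w ! i # r"
  proof (rule nth_equalityI)
    have "length w = length (p @ w ! i # q @ w ! j # r)" using w by simp
    then show "length (permute_list (Transposition.transpose i j) w) = length (p @ w ! j # q @ w ! i # r)"
      by simp
    fix k assume "k < length (permute_list (Transposition.transpose i j) w)"
    then have k: "k < length w" by simp
    have P: "Transposition.transpose i j permutes {..<length w}"
      using assms by (auto intro: permutes_swap_id)
    have *: "w ! k = (p @ w ! i # q @ w ! j # r) ! k" using w by simp
    show "permute_list (Transposition.transpose i j) w ! k = (p @ w ! j # q @ w ! i # r) ! k"
      unfolding permute_list_nth[OF P k]
    proof (cases "k = i \<or> k = j")
      case True
      then show "w ! Transposition.transpose i j k = (p @ w ! j # q @ w ! i # r) ! k"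
        using len assms by (auto simp: nth_append)
    next
      case False
      then show "w ! Transposition.transpose i j k = (p @ w ! j # q @ w ! i # r) ! k"
        using len assms * by (auto simp: nth_append nth_Cons' Transposition.transpose_def split: if_splits)
    qed
  qed
  with w show ?thesis by blast
qed

lemma sign_transpose_comp:
  assumes "\<tau> permutes S" and "finite S" and "a \<noteq> b"
  shows "sign (Transposition.transpose a b \<circ> \<tau>) = - sign \<tau>"
  using assms by (simp add: sign_compose permutation_swap_id permutes_imp_permutation sign_swap_id)

lemma alternating_permute:
  assumes "alternating \<phi>" and "\<sigma> permutes {..<length w}"
  shows "\<phi> (permute_list \<sigma> w) = scal (of_int (sign \<sigma>)) * \<phi> w"
proof -
  define n where "n = length w"
  from assms(2) have "\<sigma> permutes {..<n}" by (simp add: n_def)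
  \<comment> \<open>\<open>permute_list (T \<circ> \<tau>) w\<close> is
    \<open>permute_list \<tau> (permute_list T w)\<close>, so the induction hypothesis is needed at
    a different word of the same length; hence the quantifier over \<open>w\<close>.\<close>
  from this finite_lessThan have "\<forall>w. length w = n \<longrightarrow> \<phi> (permute_list \<sigma> w) = scal (of_int (sign \<sigma>)) * \<phi> w"
  proof (induction rule: permutes_induct)
    case id
    then show ?case by (simp add: sign_id)
  next
    case (swap a b \<tau>)
    show ?case
    proof (intro allI impI)
      fix w :: "'a list" assume w: "length w = n"
      define T where "T = Transposition.transpose a b"
      have "\<exists>i j. i < j \<and> j < n \<and> T = Transposition.transpose i j"
      proof (cases "a < b")
        case True then show ?thesis using swap by (auto simp: T_def)
      next
        case False then have "b < a" using swap by simp
        then show ?thesis using swap unfolding T_def by (metis lessThan_iff transpose_commute)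
      qed
      then obtain i j where ij: "i < j" "j < n" "T = Transposition.transpose i j" by blast
      from permute_list_transpose[of i j w] ij w obtain p x q y r where
        pq: "w = p @ x # q @ y # r" "permute_list T w = p @ y # q @ x # r" by auto
      have T: "\<phi> (permute_list T w) = - \<phi> w"
        unfolding pq(2) using alternating_swap[OF assms(1), of p x q y r] by (simp add: pq(1))
      have "permute_list (T \<circ> \<tau>) w = permute_list \<tau> (permute_list T w)"
        using swap w by (intro permute_list_compose) auto
      moreover have "sign (T \<circ> \<tau>) = - sign \<tau>"
        using swap unfolding T_def by (intro sign_transpose_comp) auto
      ultimately show "\<phi> (permute_list (Transposition.transpose a b \<circ> \<tau>) w) =
          scal (of_int (sign (Transposition.transpose a b \<circ> \<tau>))) * \<phi> w"
        using swap.IH T w by (simp add: T_def[symmetric] scal_minus)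
    qed
  qed
  with assms show ?thesis by (simp add: n_def)
qed

definition altw :: "'v list \<Rightarrow> 'v fword \<Rightarrow>\<^sub>0 real" where
  "altw w = (\<Sum>\<sigma> | \<sigma> permutes {..<length w}.
     scal (of_int (sign \<sigma>) / fact (length w)) * word (permute_list \<sigma> w))"

lemma free_alt_wlin: "free_alt = wlin altw"
  by (rule ext) (simp add: free_alt_def wlin_def altw_def sum_distrib_left mult_single)

text \<open>Each of the n! permutations contributes \<open>\<phi> w\<close> divided by n!, since the
  sign in \<open>altw\<close> cancels the sign produced by \<open>\<phi>\<close>. For
  \<open>\<phi> = altw\<close> this is idempotency of antisymmetrization.\<close>

lemma wlin_alternating_altw:
  assumes "alternating \<phi>"
  shows "wlin \<phi> (altw w) = \<phi> w"
proof -
  let ?n = "length w"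
  have "wlin \<phi> (altw w) = (\<Sum>\<sigma> | \<sigma> permutes {..<?n}.
      scal (of_int (sign \<sigma>) / fact ?n) * \<phi> (permute_list \<sigma> w))"
    by (simp add: altw_def wlin_sum mult_single)
  also have "\<dots> = (\<Sum>\<sigma> | \<sigma> permutes {..<?n}. scal (1 / fact ?n) * \<phi> w)"
  proof (rule sum.cong[OF refl])
    fix \<sigma> assume "\<sigma> \<in> {\<sigma>. \<sigma> permutes {..<?n}}"
    then have 1: "\<phi> (permute_list \<sigma> w) = scal (of_int (sign \<sigma>)) * \<phi> w"
      using alternating_permute[OF assms, of \<sigma>] by simp
    have 2: "real_of_int (sign \<sigma>) / fact ?n * of_int (sign \<sigma>) = 1 / fact ?n"
      by (metis mult.commute of_int_1 of_int_mult sign_idempotent times_divide_eq_right)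
    show "scal (of_int (sign \<sigma>) / fact ?n) * \<phi> (permute_list \<sigma> w) = scal (1 / fact ?n) * \<phi> w"
      unfolding 1 mult.assoc[symmetric] scal_mult 2 ..
  qed
  also have "\<dots> = \<phi> w"
  proof -
    have "of_nat m = (scal (of_nat m) :: 'b fword \<Rightarrow>\<^sub>0 real)" for m
      by (metis single_of_nat zero_fword_def)
    then have "(\<Sum>\<sigma> | \<sigma> permutes {..<?n}. scal (1 / fact ?n)) = (1 :: 'b fword \<Rightarrow>\<^sub>0 real)"
      by (simp only: sum_constant card_permutations[OF refl finite_lessThan] card_lessThan scal_mult) simp
    then show ?thesis unfolding sum_distrib_right[symmetric] by simp
  qed
  finally show ?thesis .
qed

text \<open>Exchanging two neighbours is composition with the transposition \<open>T\<close> of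
  their positions; reindexing the sum by \<open>T \<circ> \<sigma>\<close> turns each sign into its
  negative.\<close>

lemma alternating_altw: "alternating altw"
  unfolding alternating_def
proof (intro allI impI)
  fix p q :: "'v list" and x y
  let ?w = "p @ x # y # q" and ?w' = "p @ y # x # q"
  let ?i = "length p" and ?n = "length p + length q + 2"
  define T where "T = Transposition.transpose ?i (Suc ?i)"
  have T: "T permutes {..<?n}" unfolding T_def by (auto intro: permutes_swap_id)
  have w': "permute_list T ?w = ?w'"
  proof (rule nth_equalityI)
    fix k assume "k < length (permute_list T ?w)"
    then show "permute_list T ?w ! k = ?w' ! k"
      by (subst permute_list_nth) (use T in \<open>auto simp: T_def Transposition.transpose_def nth_append nth_Cons'\<close>)
  qed simp
  have "altw ?w' = (\<Sum>\<sigma> | \<sigma> permutes {..<?n}.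
      scal (of_int (sign \<sigma>) / fact ?n) * word (permute_list \<sigma> (permute_list T ?w)))"
    by (simp add: altw_def w')
  also have "\<dots> = (\<Sum>\<sigma> | \<sigma> permutes {..<?n}.
      - (scal (of_int (sign (T \<circ> \<sigma>)) / fact ?n) * word (permute_list (T \<circ> \<sigma>) ?w)))"
  proof (rule sum.cong[OF refl])
    fix \<sigma> assume "\<sigma> \<in> {\<sigma>. \<sigma> permutes {..<?n}}"
    then have s: "\<sigma> permutes {..<?n}" by simp
    then have "permute_list (T \<circ> \<sigma>) ?w = permute_list \<sigma> (permute_list T ?w)"
      by (intro permute_list_compose) simp
    moreover have "sign (T \<circ> \<sigma>) = - sign \<sigma>"
      unfolding T_def using s by (rule sign_transpose_comp) simp_all
    ultimately show "scal (of_int (sign \<sigma>) / fact ?n) * word (permute_list \<sigma> (permute_list T ?w)) =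
        - (scal (of_int (sign (T \<circ> \<sigma>)) / fact ?n) * word (permute_list (T \<circ> \<sigma>) ?w))"
      by (simp add: scal_minus)
  qed
  also have "\<dots> = - altw ?w"
    using setum_permutations_compose_left[OF T,
      of "\<lambda>\<sigma>. scal (of_int (sign \<sigma>) / fact ?n) * word (permute_list \<sigma> ?w)"]
    by (simp add: sum_negf altw_def)
  finally show "altw ?w = - altw ?w'" by simp
qed

lemma wlin_alternating:
  assumes "alternating \<phi>"
  shows "wlin \<phi> (free_alt a) = wlin \<phi> a"
proof (rule wlin_linear_eqI)
  fix u assume "FWord u \<in> Poly_Mapping.keys a"
  show "wlin \<phi> (free_alt (word u)) = \<phi> u"
    using wlin_alternating_altw[OF assms, of u] by (simp add: free_alt_wlin)
qed (simp_all add: free_alt_wlin wlin_add wlin_scal)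

lemma free_alt_add: "free_alt (a + b) = free_alt a + free_alt b"
  and free_alt_diff: "free_alt (a - b) = free_alt a - free_alt b"
  and free_alt_scal: "free_alt (scal c * a) = scal c * free_alt a"
  and free_alt_zero [simp]: "free_alt 0 = 0"
  by (simp_all add: free_alt_wlin wlin_add wlin_diff wlin_minus wlin_scal)

lemma free_alt_word: "free_alt (word w) = altw w"
  by (simp add: free_alt_wlin)

text \<open>On words this is \<open>alternating_altw\<close>. Antisymmetrization thus kills the
  two-sided ideal generated by all xy + yx, a fact behind both the alternation of contractions and
  the Clifford relation.\<close>

lemma free_alt_swap: "free_alt (word p * ((word [x, y] + word [y, x]) * a)) = 0"
proof (induction a rule: poly_mapping_single_induct)
  case (single u c)
  obtain q where u: "u = FWord q" by (cases u)
  have "word p * ((word [x, y] + word [y, x]) * Poly_Mapping.single u c)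
      = scal c * (word (p @ x # y # q) + word (p @ y # x # q))"
    by (simp add: u distrib_left distrib_right mult_single)
  then show ?case
    using alternatingD[OF alternating_altw, of p x y q] by (simp add: free_alt_scal free_alt_add free_alt_word)
qed (simp_all add: free_alt_add distrib_left)

lemma wlin_mult_left: "wlin (\<lambda>u. a * \<phi> u) x = a * wlin \<phi> x"
  unfolding wlin_def sum_distrib_left by (intro sum.cong refl scal_left_commute[symmetric])

lemma wlin_word [simp]: "wlin word a = a"
  by (rule wlin_linear_eqI[symmetric, where L = "\<lambda>a. a"]) simp_all

text \<open>Both sides are the linear extension of the alternating function
  \<open>\<lambda>w. altw (v # w)\<close>, evaluated at \<open>free_alt a\<close> and at
  \<open>a\<close>. Exterior multiplication can therefore be computed on arbitrary
  representatives.\<close>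

lemma free_alt_mult_free_alt: "free_alt (free_gen v * free_alt a) = free_alt (free_gen v * a)"
proof -
  have "alternating (\<lambda>w. altw (v # w))"
    unfolding alternating_def by (metis append_Cons alternatingD[OF alternating_altw])
  moreover have "wlin (\<lambda>w. altw (v # w)) x = free_alt (free_gen v * x)" for x
    by (rule wlin_linear_eqI[symmetric])
      (simp_all add: free_alt_add distrib_left scal_gen_commute free_alt_scal free_alt_word
        flip: word_Cons)
  ultimately show ?thesis by (metis wlin_alternating)
qed

subsection \<open>Contraction and the Clifford operators on the free algebra\<close>

text \<open>Interior product of a word by the functional \<open>b v\<close>. Indices and signs are
  those of the sum in \<open>is_standard_action\<close>; most proofs use the recursion
  \<open>contr_word_Cons\<close> instead.\<close>

definition contr_word :: "('v \<Rightarrow> 'v \<Rightarrow> real) \<Rightarrow> 'v \<Rightarrow> 'v list \<Rightarrow> 'v fword \<Rightarrow>\<^sub>0 real" where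
  "contr_word b v w =
     (\<Sum>j<length w. scal ((-1) ^ j * b v (w ! j)) * word (take j w @ drop (Suc j) w))"

definition contr :: "('v \<Rightarrow> 'v \<Rightarrow> real) \<Rightarrow> 'v \<Rightarrow> ('v fword \<Rightarrow>\<^sub>0 real) \<Rightarrow> ('v fword \<Rightarrow>\<^sub>0 real)" where
  "contr b v = wlin (contr_word b v)"

definition cliff_op :: "('v \<Rightarrow> 'v \<Rightarrow> real) \<Rightarrow> 'v \<Rightarrow> ('v fword \<Rightarrow>\<^sub>0 real) \<Rightarrow> ('v fword \<Rightarrow>\<^sub>0 real)" where
  "cliff_op b v a = free_gen v * a - contr b v a"

text \<open>The homomorphism from the free algebra to linear operators that sends the letter v to
  \<open>cliff_op b v\<close>. Since \<open>foldr\<close> lets the last letter act earliest,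
  juxtaposition of words becomes composition in the same order.\<close>

definition cliff_act ::
  "('v \<Rightarrow> 'v \<Rightarrow> real) \<Rightarrow> ('v fword \<Rightarrow>\<^sub>0 real) \<Rightarrow> ('v fword \<Rightarrow>\<^sub>0 real) \<Rightarrow> ('v fword \<Rightarrow>\<^sub>0 real)" where
  "cliff_act b a x = wlin (\<lambda>u. foldr (cliff_op b) u x) a"

lemma contr_word_Nil [simp]: "contr_word b v [] = 0"
  by (simp add: contr_word_def)

text \<open>The graded Leibniz rule for a single letter: the summand \<open>j = 0\<close> removes
  \<open>x\<close>, and every later one carries an extra factor -1 because its index has shifted by
  one.\<close>

lemma contr_word_Cons:
  "contr_word b v (x # w) = scal (b v x) * word w - free_gen x * contr_word b v w"
proof -
  have "contr_word b v (x # w) = scal (b v x) * word w +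
     (\<Sum>j<length w. scal ((-1) ^ Suc j * b v (w ! j)) * word (x # take j w @ drop (Suc j) w))"
    by (simp add: contr_word_def sum.lessThan_Suc_shift del: sum.lessThan_Suc)
  also have "(\<Sum>j<length w. scal ((-1) ^ Suc j * b v (w ! j)) * word (x # take j w @ drop (Suc j) w))
      = (\<Sum>j<length w. - (free_gen x * (scal ((-1) ^ j * b v (w ! j)) * word (take j w @ drop (Suc j) w))))"
    by (intro sum.cong refl) (simp add: scal_gen_commute word_Cons[symmetric] scal_minus)
  finally show ?thesis
    by (simp add: contr_word_def sum_negf sum_distrib_left)
qed

lemma contr_add: "contr b v (a + a') = contr b v a + contr b v a'"
  and contr_diff: "contr b v (a - a') = contr b v a - contr b v a'"
  and contr_scal: "contr b v (scal c * a) = scal c * contr b v a"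
  and contr_zero [simp]: "contr b v 0 = 0"
  and contr_on_word: "contr b v (word u) = contr_word b v u"
  by (simp_all add: contr_def wlin_add wlin_diff wlin_minus wlin_scal)

lemma contr_one [simp]: "contr b v 1 = 0"
  using contr_on_word[of b v "[]"] by simp

lemma contr_gen_mult: "contr b v (free_gen x * a) = scal (b v x) * a - free_gen x * contr b v a"
proof -
  have "contr b v (free_gen x * a) = wlin (\<lambda>u. scal (b v x) * word u + (- free_gen x) * contr_word b v u) a"
    by (rule wlin_linear_eqI)
      (simp_all add: contr_add contr_scal distrib_left scal_gen_commute contr_on_word contr_word_Cons
        flip: word_Cons)
  also have "\<dots> = scal (b v x) * a - free_gen x * contr b v a"
    by (simp only: wlin_fun_add wlin_mult_left wlin_word contr_def) simp
  finally show ?thesis .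
qed

text \<open>By the Leibniz rule the mixed terms cancel and the leading letter comes out in front,
  leaving the claim for the shorter word.\<close>

lemma contr_anticommute: "contr b v (contr b w a) + contr b w (contr b v a) = 0"
proof (induction a rule: poly_mapping_single_induct)
  case (single u c)
  have "contr b v (contr b w (word l)) + contr b w (contr b v (word l)) = 0" for l
  proof (induction l)
    case (Cons x l)
    have "contr b v (contr b w (word (x # l))) + contr b w (contr b v (word (x # l))) =
       free_gen x * (contr b v (contr b w (word l)) + contr b w (contr b v (word l)))"
      by (simp add: word_Cons contr_gen_mult contr_diff contr_scal distrib_left)
    with Cons show ?case by simp
  qed (simp add: contr_on_word)
  from this[of "letters u"] have "scal c * (contr b v (contr b w (word (letters u)))
      + contr b w (contr b v (word (letters u)))) = 0" by simp
  then show ?case by (cases u) (simp add: distrib_left scal_word flip: contr_scal)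
qed (simp_all add: contr_add algebra_simps)

text \<open>The recursion \<open>contr_word_Cons\<close> leaves the leading letter as a left factor
  inside \<open>free_alt\<close>, so the claim is proved with an arbitrary word \<open>p'\<close> in
  front. When the exchanged letters lead, the terms with \<open>b\<close> cancel and (xy + yx) times
  a contraction remains, which \<open>free_alt_swap\<close> annihilates.\<close>

lemma alternating_contr: "alternating (\<lambda>w. free_alt (contr_word b v w))"
proof -
  have *: "free_alt (word p' * (contr_word b v (p @ x # y # q) + contr_word b v (p @ y # x # q))) = 0"
    for p p' x y q
  proof (induction p arbitrary: p')
    case Nil
    have "contr_word b v (x # y # q) + contr_word b v (y # x # q) =
        (word [x, y] + word [y, x]) * contr_word b v q"
      by (simp add: contr_word_Cons word_Cons algebra_simps scal_gen_commute)
    then show ?case using free_alt_swap[of p' x y] by simp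
  next
    case (Cons z p)
    have "word p' * (contr_word b v (z # p @ x # y # q) + contr_word b v (z # p @ y # x # q)) =
       scal (b v z) * (word (p' @ p @ x # y # q) + word (p' @ p @ y # x # q))
       - word (p' @ [z]) * (contr_word b v (p @ x # y # q) + contr_word b v (p @ y # x # q))"
      by (simp add: contr_word_Cons distrib_left right_diff_distrib scal_gen_commute
        word_mult word_gen_mult)
    moreover have "free_alt (word (p' @ p @ x # y # q) + word (p' @ p @ y # x # q)) = 0"
      using alternatingD[OF alternating_altw, of "p' @ p" x y q] by (simp add: free_alt_add free_alt_word)
    ultimately show ?case
      using Cons[of "p' @ [z]"] by (simp add: free_alt_diff free_alt_scal)
  qed
  show ?thesis
    unfolding alternating_def
    using *[of "[]"] by (auto simp: free_alt_add eq_neg_iff_add_eq_0)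
qed

lemma free_alt_contr_free_alt: "free_alt (contr b v (free_alt a)) = free_alt (contr b v a)"
proof -
  have "wlin (\<lambda>w. free_alt (contr_word b v w)) x = free_alt (contr b v x)" for x
    by (rule wlin_linear_eqI[symmetric])
      (simp_all add: free_alt_add contr_add contr_scal free_alt_scal contr_on_word)
  then show ?thesis by (metis wlin_alternating[OF alternating_contr])
qed

lemma cliff_op_add: "cliff_op b v (a + a') = cliff_op b v a + cliff_op b v a'"
  and cliff_op_scal: "cliff_op b v (scal c * a) = scal c * cliff_op b v a"
  by (simp_all add: cliff_op_def contr_add contr_diff contr_scal algebra_simps scal_gen_commute)

lemma free_alt_cliff_op: "free_alt (cliff_op b v (free_alt a)) = free_alt (cliff_op b v a)"
  by (simp add: cliff_op_def free_alt_diff free_alt_mult_free_alt free_alt_contr_free_alt)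

text \<open>The terms with one contraction cancel in pairs, two contractions anticommute, and vw +
  wv is killed by \<open>free_alt\<close>. What remains are the scalars from contracting each vector
  with the other; \<open>b\<close> being arbitrary at this stage, both orders appear.\<close>

lemma cliff_op_anticommute:
  "free_alt (cliff_op b v (cliff_op b w a) + cliff_op b w (cliff_op b v a)) =
     - (scal (b v w + b w v) * free_alt a)"
proof -
  have "cliff_op b v (cliff_op b w a) + cliff_op b w (cliff_op b v a) =
      (word [v, w] + word [w, v]) * a - scal (b v w + b w v) * a
        + (contr b v (contr b w a) + contr b w (contr b v a))"
    by (simp add: cliff_op_def contr_diff contr_gen_mult word_Cons scal_add algebra_simps)
  then show ?thesis
    using free_alt_swap[of "[]" v w a] by (simp add: contr_anticommute free_alt_diff free_alt_scal)
qed

lemma cliff_act_word [simp]: "cliff_act b (Poly_Mapping.single (FWord u) c) x = scal c * foldr (cliff_op b) u x"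
  by (simp add: cliff_act_def)

lemma cliff_act_add_left: "cliff_act b (a + a') x = cliff_act b a x + cliff_act b a' x"
  and cliff_act_diff_left: "cliff_act b (a - a') x = cliff_act b a x - cliff_act b a' x"
  and cliff_act_scal_left: "cliff_act b (scal c * a) x = scal c * cliff_act b a x"
  and cliff_act_zero_left [simp]: "cliff_act b 0 x = 0"
  by (simp_all add: cliff_act_def wlin_add wlin_scal wlin_diff)

lemma foldr_cliff_op_add:
    "foldr (cliff_op b) u (x + y) = foldr (cliff_op b) u x + foldr (cliff_op b) u y"
  and foldr_cliff_op_scal: "foldr (cliff_op b) u (scal c * x) = scal c * foldr (cliff_op b) u x"
  by (induction u) (simp_all add: cliff_op_add cliff_op_scal)

lemma cliff_act_add: "cliff_act b a (x + y) = cliff_act b a x + cliff_act b a y"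
  by (simp add: cliff_act_def foldr_cliff_op_add wlin_fun_add)

lemma cliff_act_scal: "cliff_act b a (scal c * x) = scal c * cliff_act b a x"
  by (simp add: cliff_act_def foldr_cliff_op_scal wlin_fun_scal)

lemma cliff_act_zero [simp]: "cliff_act b a 0 = 0"
  using cliff_act_add[of b a 0 0] by simp

lemma cliff_act_diff: "cliff_act b a (x - y) = cliff_act b a x - cliff_act b a y"
  by (metis add_diff_cancel_right' cliff_act_add diff_add_cancel)

lemma cliff_act_one [simp]: "cliff_act b 1 x = x"
  using cliff_act_word[of b "[]" 1 x] by simp

lemma cliff_act_gen: "cliff_act b (free_gen v) x = cliff_op b v x"
  by (simp add: free_gen_def)

lemma cliff_act_mult: "cliff_act b (a * a') x = cliff_act b a (cliff_act b a' x)"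
proof (induction a rule: poly_mapping_single_induct)
  case (single u c)
  show ?case
  proof (induction a' rule: poly_mapping_single_induct)
    case (single u' c')
    then show ?case
      by (cases u; cases u') (simp add: mult_single foldr_cliff_op_scal mult.assoc[symmetric])
  qed (simp_all add: distrib_left cliff_act_add cliff_act_add_left)
qed (simp_all add: distrib_right cliff_act_add_left)

subsection \<open>Naturality\<close>

lemma free_map_wlin: "free_map h = wlin (\<lambda>u. word (map h u))"
  by (rule ext) (simp add: free_map_def wlin_def scal_word)

lemma free_map_add: "free_map h (a + a') = free_map h a + free_map h a'"
  and free_map_diff: "free_map h (a - a') = free_map h a - free_map h a'"
  and free_map_scal: "free_map h (scal c * a) = scal c * free_map h a"
  and free_map_zero [simp]: "free_map h 0 = 0"
  and free_map_word: "free_map h (word u) = word (map h u)"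
  and free_map_gen: "free_map h (free_gen v) = free_gen (h v)"
  by (simp_all add: free_map_wlin wlin_add wlin_scal wlin_diff free_gen_def)

lemma free_map_sum: "free_map h (\<Sum>i\<in>S. a i) = (\<Sum>i\<in>S. free_map h (a i))"
  by (simp add: free_map_wlin wlin_sum)

lemma free_map_mult: "free_map h (a * a') = free_map h a * free_map h a'"
proof (induction a rule: poly_mapping_single_induct)
  case (single u c)
  show ?case
  proof (induction a' rule: poly_mapping_single_induct)
    case (single u' c')
    then show ?case
      by (cases u; cases u') (simp add: mult_single free_map_wlin)
  qed (simp_all add: distrib_left free_map_add)
qed (simp_all add: distrib_right free_map_add)

text \<open>Antisymmetrization permutes positions, whereas \<open>h\<close> changes letters; on
  every word the two commute.\<close>

lemma free_map_free_alt: "free_map h (free_alt a) = free_alt (free_map h a)"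
proof -
  have 1: "free_map h (altw u) = altw (map h u)" for u
    by (simp add: altw_def free_map_sum free_map_scal free_map_word permute_list_map)
  have "free_map h (free_alt a) = wlin (\<lambda>u. altw (map h u)) a"
    by (rule wlin_linear_eqI)
      (simp_all add: free_map_add free_alt_add free_map_scal free_alt_scal free_alt_word 1)
  moreover have "free_alt (free_map h a) = wlin (\<lambda>u. altw (map h u)) a"
    by (rule wlin_linear_eqI)
      (simp_all add: free_map_add free_alt_add free_map_scal free_alt_scal free_alt_word free_map_word)
  ultimately show ?thesis by simp
qed

subsection \<open>Quotients of real algebras\<close>

text \<open>Scalars act through multiplication by \<open>c \<odot> \<one>\<close>, so ideals are
  closed under scaling and quotients inherit it. The free algebra and the tensor algebra are both
  instances; \<open>alg_ideal\<close> thus covers the tensor quotient and the Clifford quotient at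
  once.\<close>

locale real_alg = ring R for R :: "(real, 'a) module" (structure) +
  assumes smult_closed: "a \<in> carrier R \<Longrightarrow> c \<odot> a \<in> carrier R"
    and smult_conv_mult: "a \<in> carrier R \<Longrightarrow> c \<odot> a = (c \<odot> \<one>) \<otimes> a"

text \<open>\<open>alg_quot\<close> is a \<open>module\<close> record with the ring fields of
  \<open>R Quot I\<close>; the record types differ, so the ring axioms are carried over field by
  field.\<close>

lemma ring_record_cong:
  fixes R :: "('a, 'b) ring_scheme" and S :: "('a, 'c) ring_scheme"
  assumes "ring R" and "carrier S = carrier R" "mult S = mult R" "one S = one R"
    "ring.zero S = ring.zero R" "add S = add R"
  shows "ring S"
proof -
  interpret ring R by fact
  show ?thesis
  proof (intro ringI abelian_groupI monoidI)
    fix x assume "x \<in> carrier S"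
    then show "\<exists>y\<in>carrier S. y \<oplus>\<^bsub>S\<^esub> x = \<zero>\<^bsub>S\<^esub>"
      unfolding assms(2-6) using l_neg[of x] a_inv_closed[of x] by blast
  qed (simp_all add: assms(2-6) a_ac m_assoc l_distr r_distr)
qed

lemma alg_quot_simps:
  "carrier (alg_quot R I) = carrier (R Quot I)" "mult (alg_quot R I) = mult (R Quot I)"
  "one (alg_quot R I) = one (R Quot I)" "ring.zero (alg_quot R I) = ring.zero (R Quot I)"
  "add (alg_quot R I) = add (R Quot I)"
  by (simp_all add: alg_quot_def)

locale alg_ideal = real_alg R + ideal I R for R :: "(real, 'a) module" (structure) and I
begin

abbreviation qc :: "'a \<Rightarrow> 'a set" where "qc a \<equiv> I +> a"

lemma qc_hom: "qc \<in> ring_hom R (alg_quot R I)"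
  using rcos_ring_hom by (simp add: ring_hom_def alg_quot_simps)

lemma quot_carrier: "carrier (alg_quot R I) = qc ` carrier R"
  by (auto simp: alg_quot_simps FactRing_def A_RCOSETS_def' a_r_coset_def' image_iff)

lemma quot_ring: "ring (alg_quot R I)"
  by (rule ring_record_cong[OF quotient_is_ring]) (simp_all add: alg_quot_simps)

lemma qc_eq_iff: "a \<in> carrier R \<Longrightarrow> a' \<in> carrier R \<Longrightarrow> qc a = qc a' \<longleftrightarrow> a \<ominus> a' \<in> I"
  using quotient_eq_iff_same_a_r_cos[OF ideal_axioms] by metis

lemma qc_add: "a \<in> carrier R \<Longrightarrow> a' \<in> carrier R \<Longrightarrow> qc (a \<oplus> a') = qc a \<oplus>\<^bsub>alg_quot R I\<^esub> qc a'"
  and qc_mult: "a \<in> carrier R \<Longrightarrow> a' \<in> carrier R \<Longrightarrow> qc (a \<otimes> a') = qc a \<otimes>\<^bsub>alg_quot R I\<^esub> qc a'"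
  and qc_one: "qc \<one> = \<one>\<^bsub>alg_quot R I\<^esub>"
  and qc_closed: "a \<in> carrier R \<Longrightarrow> qc a \<in> carrier (alg_quot R I)"
  using qc_hom by (auto simp: ring_hom_def)

lemma qc_hom_ring: "ring_hom_ring R (alg_quot R I) qc"
  using qc_hom quot_ring ring_axioms by (intro ring_hom_ring.intro ring_hom_ring_axioms.intro)

lemma qc_zero: "qc \<zero> = \<zero>\<^bsub>alg_quot R I\<^esub>"
proof -
  interpret h: ring_hom_ring R "alg_quot R I" qc by (rule qc_hom_ring)
  show ?thesis by simp
qed

lemma qc_minus: "a \<in> carrier R \<Longrightarrow> a' \<in> carrier R \<Longrightarrow> qc (a \<ominus> a') = qc a \<ominus>\<^bsub>alg_quot R I\<^esub> qc a'"
proof -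
  interpret h: ring_hom_ring R "alg_quot R I" qc by (rule qc_hom_ring)
  show "a \<in> carrier R \<Longrightarrow> a' \<in> carrier R \<Longrightarrow> ?thesis" by (simp add: a_minus_def)
qed

lemma mem_qc: "a \<in> carrier R \<Longrightarrow> a' \<in> qc a \<Longrightarrow> a' \<in> carrier R \<and> qc a' = qc a"
  by (metis a_elemrcos_carrier a_repr_independence is_additive_subgroup additive_subgroup.a_subgroup
      a_subgroup)

lemma self_mem_qc: "a \<in> carrier R \<Longrightarrow> a \<in> qc a"
  by (rule a_rcos_self)

text \<open>Maps on cosets are defined as \<open>the_elem\<close> of an image; constancy on the
  coset makes the image a singleton. The computation rules for \<open>Alt\<close>,
  \<open>tensor_hom\<close>, \<open>tensor_form\<close>, \<open>clifford_hom\<close> and scalar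
  multiplication all rest on this.\<close>

lemma the_elem_qc:
  assumes "a \<in> carrier R" and "\<And>a'. a' \<in> carrier R \<Longrightarrow> qc a' = qc a \<Longrightarrow> \<phi> a' = \<phi> a"
  shows "the_elem (\<phi> ` qc a) = \<phi> a"
proof -
  have "\<phi> ` qc a = {\<phi> a}"
    using assms mem_qc[OF assms(1)] self_mem_qc[OF assms(1)] by blast
  then show ?thesis by simp
qed

lemma qc_smult_cong:
  assumes "a \<in> carrier R" "a' \<in> carrier R" "qc a = qc a'"
  shows "qc (c \<odot> a) = qc (c \<odot> a')"
  unfolding smult_conv_mult[OF assms(1), of c] smult_conv_mult[OF assms(2), of c]
  using assms by (simp add: qc_mult smult_closed)

lemma qc_smult: "a \<in> carrier R \<Longrightarrow> qc (c \<odot> a) = c \<odot>\<^bsub>alg_quot R I\<^esub> qc a"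
proof -
  assume a: "a \<in> carrier R"
  have "the_elem ((\<lambda>a. qc (c \<odot> a)) ` qc a) = qc (c \<odot> a)"
    by (rule the_elem_qc[OF a]) (rule qc_smult_cong[OF _ a])
  then show ?thesis by (simp add: alg_quot_def)
qed

lemma quot_real_alg: "real_alg (alg_quot R I)"
proof -
  interpret Q: ring "alg_quot R I" by (rule quot_ring)
  show ?thesis
  proof
    fix A c assume "A \<in> carrier (alg_quot R I)"
    then obtain a where a: "a \<in> carrier R" "A = qc a" by (auto simp: quot_carrier)
    show "c \<odot>\<^bsub>alg_quot R I\<^esub> A \<in> carrier (alg_quot R I)"
      using a by (simp add: qc_smult[symmetric] qc_closed smult_closed)
    show "c \<odot>\<^bsub>alg_quot R I\<^esub> A = c \<odot>\<^bsub>alg_quot R I\<^esub> \<one>\<^bsub>alg_quot R I\<^esub> \<otimes>\<^bsub>alg_quot R I\<^esub> A"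
      using smult_conv_mult[of a c] a
      by (simp add: qc_smult[symmetric] qc_one[symmetric] qc_mult[symmetric] smult_closed)
  qed
qed

text \<open>The Clifford ideal is generated in the tensor algebra, while the ideals compared with it
  are built from words. Surjectivity of \<open>qc\<close> makes their images ideals, so minimality
  of the generated ideal applies.\<close>

lemma image_ideal:
  assumes "ideal J R"
  shows "ideal (qc ` J) (alg_quot R I)"
proof -
  interpret J: ideal J R by fact
  have JR: "a \<in> J \<Longrightarrow> a \<in> carrier R" for a by (rule J.Icarr)
  interpret h: ring_hom_ring R "alg_quot R I" qc by (rule qc_hom_ring)
  show ?thesis
  proof (rule idealI[OF quot_ring])
    show "subgroup (qc ` J) (add_monoid (alg_quot R I))"
    proof (rule h.S.add.subgroupI)
      show "qc ` J \<subseteq> carrier (alg_quot R I)" using JR by (auto intro: qc_closed)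
      show "qc ` J \<noteq> {}" using additive_subgroup.zero_closed[OF J.is_additive_subgroup] by blast
      fix A assume "A \<in> qc ` J"
      then obtain a where a: "a \<in> J" "A = qc a" by auto
      then have "\<ominus>\<^bsub>alg_quot R I\<^esub> A = qc (\<ominus> a)" using JR by simp
      then show "\<ominus>\<^bsub>alg_quot R I\<^esub> A \<in> qc ` J"
        using a additive_subgroup.a_inv_closed[OF J.is_additive_subgroup] by blast
      fix B assume "B \<in> qc ` J"
      then obtain b where b: "b \<in> J" "B = qc b" by auto
      have "A \<oplus>\<^bsub>alg_quot R I\<^esub> B = qc (a \<oplus> b)" using a b JR by simp
      then show "A \<oplus>\<^bsub>alg_quot R I\<^esub> B \<in> qc ` J"
        using additive_subgroup.a_closed[OF J.is_additive_subgroup a(1) b(1)] by (metis imageI)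
    qed
    fix A B assume "A \<in> qc ` J" "B \<in> carrier (alg_quot R I)"
    then obtain a b where ab: "a \<in> J" "A = qc a" "b \<in> carrier R" "B = qc b"
      by (auto simp: quot_carrier)
    have "B \<otimes>\<^bsub>alg_quot R I\<^esub> A = qc (b \<otimes> a)" "A \<otimes>\<^bsub>alg_quot R I\<^esub> B = qc (a \<otimes> b)"
      using ab JR by simp_all
    then show "B \<otimes>\<^bsub>alg_quot R I\<^esub> A \<in> qc ` J" "A \<otimes>\<^bsub>alg_quot R I\<^esub> B \<in> qc ` J"
      using J.I_l_closed[OF ab(1,3)] J.I_r_closed[OF ab(1,3)] by (metis imageI)+
  qed
qed

end

subsection \<open>The free algebra and the tensor ideal\<close>

lemma free_alg_simps [simp]:
  "a \<oplus>\<^bsub>free_alg E\<^esub> a' = a + a'" "a \<otimes>\<^bsub>free_alg E\<^esub> a' = a * a'"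
  "\<zero>\<^bsub>free_alg E\<^esub> = 0" "\<one>\<^bsub>free_alg E\<^esub> = 1" "c \<odot>\<^bsub>free_alg E\<^esub> a = scal c * a"
  by (simp_all add: free_alg_def)

abbreviation fcar :: "(real, 'v) module \<Rightarrow> ('v fword \<Rightarrow>\<^sub>0 real) set" where
  "fcar E \<equiv> carrier (free_alg E)"

lemma mem_fcar: "a \<in> fcar E \<longleftrightarrow> (\<forall>u. FWord u \<in> Poly_Mapping.keys a \<longrightarrow> set u \<subseteq> carrier E)"
proof
  assume r: "\<forall>u. FWord u \<in> Poly_Mapping.keys a \<longrightarrow> set u \<subseteq> carrier E"
  have "set (letters k) \<subseteq> carrier E" if "k \<in> Poly_Mapping.keys a" for k
    using r[rule_format, of "letters k"] that by simp
  then show "a \<in> fcar E" by (simp add: free_alg_def)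
qed (force simp: free_alg_def)

lemma fcar_zero [simp]: "0 \<in> fcar E"
  by (simp add: mem_fcar)

lemma fcar_add [simp]: "a \<in> fcar E \<Longrightarrow> a' \<in> fcar E \<Longrightarrow> a + a' \<in> fcar E"
  using keys_add[of a a'] unfolding mem_fcar by blast

lemma fcar_single [simp]: "set u \<subseteq> carrier E \<Longrightarrow> Poly_Mapping.single (FWord u) c \<in> fcar E"
  by (simp add: mem_fcar)

lemma fcar_gen [simp]: "v \<in> carrier E \<Longrightarrow> free_gen v \<in> fcar E"
  by (simp add: free_gen_def)

lemma fcar_one [simp]: "1 \<in> fcar E"
  by (metis fcar_single empty_set empty_subsetI scal_one)

lemma fcar_sum: "(\<And>i. i \<in> S \<Longrightarrow> a i \<in> fcar E) \<Longrightarrow> (\<Sum>i\<in>S. a i) \<in> fcar E"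
  by (induction S rule: infinite_finite_induct) simp_all

lemma fcar_mult [simp]:
  assumes "a \<in> fcar E" "a' \<in> fcar E"
  shows "a * a' \<in> fcar E"
  unfolding mem_fcar
proof (intro allI impI)
  fix u assume "FWord u \<in> Poly_Mapping.keys (a * a')"
  then obtain k l where "FWord u = k + l" "k \<in> Poly_Mapping.keys a" "l \<in> Poly_Mapping.keys a'"
    using keys_mult[of a a'] by blast
  with assms show "set u \<subseteq> carrier E"
    by (cases k; cases l) (auto simp: mem_fcar)
qed

lemma fcar_minus [simp]: "a \<in> fcar E \<Longrightarrow> - a \<in> fcar E"
  by (simp add: mem_fcar in_keys_iff)

lemma fcar_diff [simp]: "a \<in> fcar E \<Longrightarrow> a' \<in> fcar E \<Longrightarrow> a - a' \<in> fcar E"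
  using fcar_add[of a E "- a'"] by simp

lemma fcar_wlin:
  assumes "a \<in> fcar E" and "\<And>u. set u \<subseteq> carrier E \<Longrightarrow> \<phi> u \<in> fcar E'"
  shows "wlin \<phi> a \<in> fcar E'"
  unfolding wlin_def
proof (rule fcar_sum)
  fix u assume u: "u \<in> Poly_Mapping.keys a"
  then have "FWord (letters u) \<in> Poly_Mapping.keys a" by simp
  with assms(1) have "set (letters u) \<subseteq> carrier E" unfolding mem_fcar by blast
  then show "scal (Poly_Mapping.lookup a u) * \<phi> (letters u) \<in> fcar E'"
    using assms(2) by simp
qed

lemma fcar_induct [consumes 1, case_names zero word add]:
  assumes a: "a \<in> fcar E" and "P 0"
    and "\<And>u c. set u \<subseteq> carrier E \<Longrightarrow> P (scal c * word u)"
    and "\<And>x y. x \<in> fcar E \<Longrightarrow> y \<in> fcar E \<Longrightarrow> P x \<Longrightarrow> P y \<Longrightarrow> P (x + y)"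
  shows "P a"
proof -
  have "P a \<and> a \<in> fcar E"
  proof (induction a rule: poly_mapping_single_induct)
    case (single u c)
    obtain l where "u = FWord l" by (cases u)
    with single a have "u = FWord l" "set l \<subseteq> carrier E" by (auto simp: mem_fcar)
    then show ?case using assms(3)[of l c] by (simp add: scal_word)
  qed (auto intro: assms)
  then show ?thesis ..
qed

lemma free_alg_ring: "ring (free_alg E)"
proof (intro ringI abelian_groupI monoidI)
  fix x assume "x \<in> fcar E"
  then show "\<exists>y\<in>fcar E. y \<oplus>\<^bsub>free_alg E\<^esub> x = \<zero>\<^bsub>free_alg E\<^esub>"
    by (intro bexI[of _ "- x"]) simp_all
qed (simp_all add: algebra_simps)

interpretation free: real_alg "free_alg E" for E :: "(real, 'v) module"
  by (intro real_alg.intro free_alg_ring real_alg_axioms.intro) simp_all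

lemma free_a_inv: "a \<in> fcar E \<Longrightarrow> \<ominus>\<^bsub>free_alg E\<^esub> a = - a"
  by (rule free.minus_equality) simp_all

lemma free_minus [simp]: "a \<in> fcar E \<Longrightarrow> a' \<in> fcar E \<Longrightarrow> a \<ominus>\<^bsub>free_alg E\<^esub> a' = a - a'"
  by (simp add: a_minus_def free_a_inv)

lemma free_idealI:
  assumes "J \<subseteq> fcar E" "0 \<in> J" "\<And>a b. a \<in> J \<Longrightarrow> b \<in> J \<Longrightarrow> a + b \<in> J" "\<And>a. a \<in> J \<Longrightarrow> - a \<in> J"
    "\<And>a x. a \<in> J \<Longrightarrow> x \<in> fcar E \<Longrightarrow> x * a \<in> J" "\<And>a x. a \<in> J \<Longrightarrow> x \<in> fcar E \<Longrightarrow> a * x \<in> J"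
  shows "ideal J (free_alg E)"
proof (rule idealI[OF free_alg_ring])
  show "subgroup J (add_monoid (free_alg E))"
  proof (rule free.add.subgroupI)
    show "J \<subseteq> fcar E" "J \<noteq> {}" using assms by auto
    fix a assume a: "a \<in> J"
    then have "\<ominus>\<^bsub>free_alg E\<^esub> a = - a" using assms(1) by (intro free_a_inv) auto
    then show "\<ominus>\<^bsub>free_alg E\<^esub> a \<in> J" using assms(4) a by simp
    fix b assume "b \<in> J"
    then show "a \<oplus>\<^bsub>free_alg E\<^esub> b \<in> J" using assms(3) a by simp
  qed
qed (use assms in simp_all)

lemma free_ideal_closed:
  assumes "ideal J (free_alg E)"
  shows free_ideal_sub: "a \<in> J \<Longrightarrow> a \<in> fcar E"
    and free_ideal_zero: "0 \<in> J"
    and free_ideal_add: "a \<in> J \<Longrightarrow> b \<in> J \<Longrightarrow> a + b \<in> J"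
    and free_ideal_minus: "a \<in> J \<Longrightarrow> - a \<in> J"
    and free_ideal_diff: "a \<in> J \<Longrightarrow> b \<in> J \<Longrightarrow> a - b \<in> J"
    and free_ideal_mult_left: "a \<in> J \<Longrightarrow> x \<in> fcar E \<Longrightarrow> x * a \<in> J"
    and free_ideal_mult_right: "a \<in> J \<Longrightarrow> x \<in> fcar E \<Longrightarrow> a * x \<in> J"
proof -
  interpret ideal J "free_alg E" by fact
  show sub: "a \<in> J \<Longrightarrow> a \<in> fcar E" for a by (rule Icarr)
  show "0 \<in> J" using zero_closed by simp
  show add: "a \<in> J \<Longrightarrow> b \<in> J \<Longrightarrow> a + b \<in> J" for a b using a_closed[of a b] by simp
  show minus: "a \<in> J \<Longrightarrow> - a \<in> J" for a using a_inv_closed[of a] free_a_inv[OF sub] by simp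
  show "a \<in> J \<Longrightarrow> b \<in> J \<Longrightarrow> a - b \<in> J" using add[of a "- b"] minus by simp
  show "a \<in> J \<Longrightarrow> x \<in> fcar E \<Longrightarrow> x * a \<in> J" using I_l_closed[of a x] by simp
  show "a \<in> J \<Longrightarrow> x \<in> fcar E \<Longrightarrow> a * x \<in> J" using I_r_closed[of a x] by simp
qed


text \<open>The position to which the letter \<open>x\<close> is moved depends on the permutation
  alone. Hence permuting preserves relations that concern one letter and hold in every
  context.\<close>

lemma permute_list_split:
  assumes "\<sigma> permutes {..<length p + Suc (length q)}"
  shows "\<exists>p' q'. set p' \<union> set q' \<subseteq> set p \<union> set q \<and> (\<forall>x. permute_list \<sigma> (p @ x # q) = p' @ x # q')"
proof -
  let ?n = "length p + Suc (length q)" and ?w = "\<lambda>x. p @ x # q"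
  \<comment> \<open>\<open>permute_list \<sigma> w ! i\<close> is \<open>w ! \<sigma> i\<close>, so
    the letter at index \<open>length p\<close> turns up at the preimage of that index.\<close>
  define k where "k = inv_into UNIV \<sigma> (length p)"
  have k: "k < ?n" "\<sigma> k = length p"
    using permutes_in_image[OF permutes_inv[OF assms]] permutes_inverses[OF assms] by (auto simp: k_def)
  have ne: "\<sigma> i \<noteq> length p" if "i \<noteq> k" for i
    using permutes_inj[OF assms] k(2) that by (metis injD)
  have in_n: "\<sigma> i < ?n" if "i < ?n" for i using permutes_in_image[OF assms] that by auto
  define f where "f i = (if \<sigma> i < length p then p ! \<sigma> i else q ! (\<sigma> i - Suc (length p)))" for i
  have f: "?w x ! \<sigma> i = f i" "f i \<in> set p \<union> set q" if "i < ?n" "i \<noteq> k" for i x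
    using ne[OF that(2)] in_n[OF that(1)] by (auto simp: f_def nth_append nth_Cons')
  have "[0..<?n] = [0..<k] @ k # [Suc k..<?n]"
    using k(1) upt_add_eq_append[of 0 k "?n - k"] by (simp add: upt_conv_Cons del: upt_Suc)
  then have "permute_list \<sigma> (?w x) = map (\<lambda>i. ?w x ! \<sigma> i) [0..<k] @ ?w x ! \<sigma> k # map (\<lambda>i. ?w x ! \<sigma> i) [Suc k..<?n]" for x
    by (simp add: permute_list_def del: upt_Suc)
  then have "permute_list \<sigma> (?w x) = map f [0..<k] @ x # map f [Suc k..<?n]" for x
    using k f by (simp del: upt_Suc cong: map_cong)
  moreover have "set (map f [0..<k]) \<union> set (map f [Suc k..<?n]) \<subseteq> set p \<union> set q"
  proof
    fix x assume "x \<in> set (map f [0..<k]) \<union> set (map f [Suc k..<?n])"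
    then obtain i where "x = f i" "i < ?n" "i \<noteq> k" using k(1) by (auto simp del: upt_Suc)
    then show "x \<in> set p \<union> set q" using f(2)[of i] by simp
  qed
  ultimately show ?thesis by blast
qed

section \<open>Relators of the tensor ideal and maps that respect them\<close>

definition add_rel :: "(real, 'v) module \<Rightarrow> 'v \<Rightarrow> 'v \<Rightarrow> 'v fword \<Rightarrow>\<^sub>0 real" where
  "add_rel E v w = free_gen (v \<oplus>\<^bsub>E\<^esub> w) - free_gen v - free_gen w"

definition smult_rel :: "(real, 'v) module \<Rightarrow> real \<Rightarrow> 'v \<Rightarrow> 'v fword \<Rightarrow>\<^sub>0 real" where
  "smult_rel E c v = free_gen (c \<odot>\<^bsub>E\<^esub> v) - scal c * free_gen v"

lemma tensor_ideal_rels: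
  "tensor_ideal E = Idl\<^bsub>free_alg E\<^esub>
     ({add_rel E v w |v w. v \<in> carrier E \<and> w \<in> carrier E} \<union> {smult_rel E c v |c v. v \<in> carrier E})"
  by (simp add: tensor_ideal_def add_rel_def smult_rel_def)

text \<open>Real subspaces, with scalars acting through \<open>scal\<close>. The instances in use
  are ideals, \<open>alt_kernel\<close> and \<open>{0}\<close>.\<close>

definition scal_subgroup :: "('v fword \<Rightarrow>\<^sub>0 real) set \<Rightarrow> bool" where
  "scal_subgroup S \<longleftrightarrow> 0 \<in> S \<and> (\<forall>a\<in>S. \<forall>b\<in>S. a + b \<in> S) \<and> (\<forall>a\<in>S. \<forall>c. scal c * a \<in> S)"

lemma scal_subgroup_minus: "scal_subgroup S \<Longrightarrow> a \<in> S \<Longrightarrow> - a \<in> S"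
  unfolding scal_subgroup_def by (metis mult_minus1 scal_minus scal_one)

lemma scal_subgroup_diff: "scal_subgroup S \<Longrightarrow> a \<in> S \<Longrightarrow> b \<in> S \<Longrightarrow> a - b \<in> S"
  using scal_subgroup_minus[of S b] unfolding scal_subgroup_def by (metis add_uminus_conv_diff)

lemma scal_subgroup_sum: "scal_subgroup S \<Longrightarrow> (\<And>i. i \<in> A \<Longrightarrow> a i \<in> S) \<Longrightarrow> (\<Sum>i\<in>A. a i) \<in> S"
  by (induction A rule: infinite_finite_induct) (auto simp: scal_subgroup_def)

lemma free_ideal_scal_subgroup: "ideal J (free_alg E) \<Longrightarrow> scal_subgroup J"
  by (auto simp: scal_subgroup_def free_ideal_zero free_ideal_add free_ideal_mult_left)

locale real_vec_space =
  fixes E :: "(real, 'v) module" (structure)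
  assumes real_vs: "real_vs E"
begin

sublocale E: Module.module "ring_of_type_algebra :: real ring" E
  by (rule real_vs)

lemma smult_in [simp]: "v \<in> carrier E \<Longrightarrow> c \<odot> v \<in> carrier E"
  using E.smult_closed by (simp add: ring_of_type_algebra_def)

lemma rels_in_fcar:
  "v \<in> carrier E \<Longrightarrow> w \<in> carrier E \<Longrightarrow> add_rel E v w \<in> fcar E"
  "v \<in> carrier E \<Longrightarrow> smult_rel E c v \<in> fcar E"
  by (simp_all add: add_rel_def smult_rel_def)

lemma tensor_ideal: "ideal (tensor_ideal E) (free_alg E)"
  unfolding tensor_ideal_rels by (rule free.genideal_ideal) (auto intro: rels_in_fcar)

lemma add_rel_in: "v \<in> carrier E \<Longrightarrow> w \<in> carrier E \<Longrightarrow> add_rel E v w \<in> tensor_ideal E"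
  and smult_rel_in: "v \<in> carrier E \<Longrightarrow> smult_rel E c v \<in> tensor_ideal E"
proof -
  have "{add_rel E v w |v w. v \<in> carrier E \<and> w \<in> carrier E} \<union> {smult_rel E c v |c v. v \<in> carrier E}
      \<subseteq> tensor_ideal E"
    unfolding tensor_ideal_rels by (rule free.genideal_self) (auto intro: rels_in_fcar)
  then show "v \<in> carrier E \<Longrightarrow> w \<in> carrier E \<Longrightarrow> add_rel E v w \<in> tensor_ideal E"
    "v \<in> carrier E \<Longrightarrow> smult_rel E c v \<in> tensor_ideal E" by blast+
qed

lemma tensor_ideal_subset:
  assumes "ideal J (free_alg E)"
    and "\<And>v w. v \<in> carrier E \<Longrightarrow> w \<in> carrier E \<Longrightarrow> add_rel E v w \<in> J"
    and "\<And>c v. v \<in> carrier E \<Longrightarrow> smult_rel E c v \<in> J"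
  shows "tensor_ideal E \<subseteq> J"
  unfolding tensor_ideal_rels by (rule free.genideal_minimal[OF assms(1)]) (use assms(2-) in auto)

text \<open>The elements \<open>a\<close> whose products x a y are all sent into \<open>S\<close>
  form a two-sided ideal, although \<open>\<psi>\<close> is not multiplicative; linearity in each
  letter modulo \<open>S\<close> puts the relators into it. This is the universal property of tensor
  powers, modulo \<open>S\<close>.\<close>

lemma wlin_tensor_ideal:
  assumes S: "scal_subgroup S"
    and add: "\<And>p q v w. set p \<subseteq> carrier E \<Longrightarrow> set q \<subseteq> carrier E \<Longrightarrow> v \<in> carrier E \<Longrightarrow> w \<in> carrier E \<Longrightarrow>
      \<psi> (p @ (v \<oplus> w) # q) - \<psi> (p @ v # q) - \<psi> (p @ w # q) \<in> S"
    and smult: "\<And>p q c v. set p \<subseteq> carrier E \<Longrightarrow> set q \<subseteq> carrier E \<Longrightarrow> v \<in> carrier E \<Longrightarrow>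
      \<psi> (p @ (c \<odot> v) # q) - scal c * \<psi> (p @ v # q) \<in> S"
    and a: "a \<in> tensor_ideal E"
  shows "wlin \<psi> a \<in> S"
proof -
  define J where "J = {a \<in> fcar E. \<forall>x\<in>fcar E. \<forall>y\<in>fcar E. wlin \<psi> (x * a * y) \<in> S}"
  have Sadd: "a \<in> S \<Longrightarrow> b \<in> S \<Longrightarrow> a + b \<in> S" and S0: "0 \<in> S" and Sscal: "a \<in> S \<Longrightarrow> scal c * a \<in> S" for a b c
    using S by (auto simp: scal_subgroup_def)
  have J: "ideal J (free_alg E)"
  proof (rule free_idealI)
    show "J \<subseteq> fcar E" by (auto simp: J_def)
    show "0 \<in> J" using S0 by (simp add: J_def)
    show "\<And>a b. a \<in> J \<Longrightarrow> b \<in> J \<Longrightarrow> a + b \<in> J"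
      using Sadd by (auto simp: J_def distrib_left distrib_right wlin_add)
    show "\<And>a. a \<in> J \<Longrightarrow> - a \<in> J"
      using scal_subgroup_minus[OF S] by (auto simp: J_def wlin_minus)
    show "\<And>a x. a \<in> J \<Longrightarrow> x \<in> fcar E \<Longrightarrow> x * a \<in> J"
      by (auto simp: J_def mult.assoc[symmetric])
    show "\<And>a x. a \<in> J \<Longrightarrow> x \<in> fcar E \<Longrightarrow> a * x \<in> J"
      by (auto simp: J_def mult.assoc)
  qed
  have JI: "r \<in> J" if r: "r \<in> fcar E"
    "\<And>p q. set p \<subseteq> carrier E \<Longrightarrow> set q \<subseteq> carrier E \<Longrightarrow> wlin \<psi> (word p * r * word q) \<in> S" for r
  proof -
    have "wlin \<psi> (x * r * y) \<in> S" if "x \<in> fcar E" "y \<in> fcar E" for x y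
      using that(1)
    proof (induction x rule: fcar_induct)
      case (word p c)
      show ?case using that(2)
      proof (induction y rule: fcar_induct)
        case (word q d)
        have "wlin \<psi> (scal c * word p * r * (scal d * word q)) = scal (c * d) * wlin \<psi> (word p * r * word q)"
          by (metis (no_types, opaque_lifting) wlin_scal scal_mult mult.assoc scal_left_commute)
        then show ?case using Sscal r(2) word \<open>set p \<subseteq> carrier E\<close> by simp
      qed (auto simp: S0 distrib_left wlin_add intro: Sadd)
    qed (auto simp: S0 distrib_right wlin_add intro: Sadd)
    then show ?thesis using r(1) by (simp add: J_def)
  qed
  have "tensor_ideal E \<subseteq> J"
  proof (rule tensor_ideal_subset[OF J])
    fix v w assume vw: "v \<in> carrier E" "w \<in> carrier E"
    show "add_rel E v w \<in> J"
    proof (rule JI)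
      fix p q assume pq: "set p \<subseteq> carrier E" "set q \<subseteq> carrier E"
      have "wlin \<psi> (word p * add_rel E v w * word q) =
          \<psi> (p @ (v \<oplus> w) # q) - \<psi> (p @ v # q) - \<psi> (p @ w # q)"
        by (simp add: add_rel_def free_gen_def right_diff_distrib left_diff_distrib mult_single wlin_diff)
      then show "wlin \<psi> (word p * add_rel E v w * word q) \<in> S" using add pq vw by simp
    qed (rule rels_in_fcar(1)[OF vw])
  next
    fix c v assume v: "v \<in> carrier E"
    show "smult_rel E c v \<in> J"
    proof (rule JI)
      fix p q assume pq: "set p \<subseteq> carrier E" "set q \<subseteq> carrier E"
      have "wlin \<psi> (word p * smult_rel E c v * word q) = \<psi> (p @ (c \<odot> v) # q) - scal c * \<psi> (p @ v # q)"
        by (simp add: smult_rel_def free_gen_def right_diff_distrib left_diff_distrib mult_single wlin_diff)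
      then show "wlin \<psi> (word p * smult_rel E c v * word q) \<in> S" using smult pq v by simp
    qed (rule rels_in_fcar(2)[OF v])
  qed
  with a have "a \<in> J" by blast
  \<comment> \<open>Membership in \<open>J\<close> allows arbitrary outer factors; both are taken to
    be 1.\<close>
  then have "wlin \<psi> (1 * a * 1) \<in> S"
    unfolding J_def using fcar_one by blast
  then show ?thesis by simp
qed

lemma word_add_rel: "set p \<subseteq> carrier E \<Longrightarrow> set q \<subseteq> carrier E \<Longrightarrow> v \<in> carrier E \<Longrightarrow> w \<in> carrier E \<Longrightarrow>
    word (p @ (v \<oplus> w) # q) - word (p @ v # q) - word (p @ w # q) \<in> tensor_ideal E"
proof -
  assume *: "set p \<subseteq> carrier E" "set q \<subseteq> carrier E" "v \<in> carrier E" "w \<in> carrier E"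
  have "word (p @ (v \<oplus> w) # q) - word (p @ v # q) - word (p @ w # q) = word p * (add_rel E v w * word q)"
    by (simp add: add_rel_def free_gen_def right_diff_distrib left_diff_distrib mult_single)
  then show ?thesis
    using * by (simp add: free_ideal_mult_left[OF tensor_ideal] free_ideal_mult_right[OF tensor_ideal] add_rel_in)
qed

lemma word_smult_rel: "set p \<subseteq> carrier E \<Longrightarrow> set q \<subseteq> carrier E \<Longrightarrow> v \<in> carrier E \<Longrightarrow>
    word (p @ (c \<odot> v) # q) - scal c * word (p @ v # q) \<in> tensor_ideal E"
proof -
  assume *: "set p \<subseteq> carrier E" "set q \<subseteq> carrier E" "v \<in> carrier E"
  have "word (p @ (c \<odot> v) # q) - scal c * word (p @ v # q) = word p * (smult_rel E c v * word q)"
    by (simp add: smult_rel_def free_gen_def right_diff_distrib left_diff_distrib mult_single)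
  then show ?thesis
    using * by (simp add: free_ideal_mult_left[OF tensor_ideal] free_ideal_mult_right[OF tensor_ideal] smult_rel_in)
qed

text \<open>In every permuted word a varying letter still occupies a place fixed by the permutation,
  by \<open>permute_list_split\<close>, so each summand of \<open>altw\<close> is linear in that
  letter modulo the ideal. This makes \<open>Alt\<close> well defined on tensors.\<close>

lemma free_alt_tensor_ideal: "a \<in> tensor_ideal E \<Longrightarrow> free_alt a \<in> tensor_ideal E"
  unfolding free_alt_wlin
proof (rule wlin_tensor_ideal[OF free_ideal_scal_subgroup[OF tensor_ideal]])
  note S = free_ideal_scal_subgroup[OF tensor_ideal]
  fix p q v w assume *: "set p \<subseteq> carrier E" "set q \<subseteq> carrier E" "v \<in> carrier E"
  let ?n = "length p + Suc (length q)"
  have perm: "\<exists>p' q'. set p' \<subseteq> carrier E \<and> set q' \<subseteq> carrier E \<and> (\<forall>x. permute_list \<sigma> (p @ x # q) = p' @ x # q')"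
    if "\<sigma> permutes {..<?n}" for \<sigma>
    using permute_list_split[OF that] * by (metis Un_subset_iff subset_trans)
  { fix c
    have "altw (p @ (c \<odot> v) # q) - scal c * altw (p @ v # q) =
      (\<Sum>\<sigma> | \<sigma> permutes {..<?n}. scal (of_int (sign \<sigma>) / fact ?n) *
        (word (permute_list \<sigma> (p @ (c \<odot> v) # q)) - scal c * word (permute_list \<sigma> (p @ v # q))))"
      by (simp only: altw_def length_append list.size add_0_right add_Suc_right right_diff_distrib
          sum_subtractf sum_distrib_left scal_left_commute[of "scal _" c])
    also have "\<dots> \<in> tensor_ideal E"
    proof (rule scal_subgroup_sum[OF S])
      fix \<sigma> assume "\<sigma> \<in> {\<sigma>. \<sigma> permutes {..<?n}}"
      then obtain p' q' where "set p' \<subseteq> carrier E" "set q' \<subseteq> carrier E" "\<And>x. permute_list \<sigma> (p @ x # q) = p' @ x # q'"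
        using perm by blast
      then show "scal (of_int (sign \<sigma>) / fact ?n) *
        (word (permute_list \<sigma> (p @ (c \<odot> v) # q)) - scal c * word (permute_list \<sigma> (p @ v # q))) \<in> tensor_ideal E"
        using word_smult_rel * S by (simp add: scal_subgroup_def)
    qed
    finally show "altw (p @ (c \<odot> v) # q) - scal c * altw (p @ v # q) \<in> tensor_ideal E" . }
  assume w: "w \<in> carrier E"
  have "altw (p @ (v \<oplus> w) # q) - altw (p @ v # q) - altw (p @ w # q) =
    (\<Sum>\<sigma> | \<sigma> permutes {..<?n}. scal (of_int (sign \<sigma>) / fact ?n) *
      (word (permute_list \<sigma> (p @ (v \<oplus> w) # q)) - word (permute_list \<sigma> (p @ v # q)) - word (permute_list \<sigma> (p @ w # q))))"
    by (simp only: altw_def length_append list.size add_0_right add_Suc_right right_diff_distrib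
        sum_subtractf sum_distrib_left)
  also have "\<dots> \<in> tensor_ideal E"
  proof (rule scal_subgroup_sum[OF S])
    fix \<sigma> assume "\<sigma> \<in> {\<sigma>. \<sigma> permutes {..<?n}}"
    then obtain p' q' where "set p' \<subseteq> carrier E" "set q' \<subseteq> carrier E" "\<And>x. permute_list \<sigma> (p @ x # q) = p' @ x # q'"
      using perm by blast
    then show "scal (of_int (sign \<sigma>) / fact ?n) *
      (word (permute_list \<sigma> (p @ (v \<oplus> w) # q)) - word (permute_list \<sigma> (p @ v # q)) - word (permute_list \<sigma> (p @ w # q)))
        \<in> tensor_ideal E"
      using word_add_rel * w S by (simp add: scal_subgroup_def)
  qed
  finally show "altw (p @ (v \<oplus> w) # q) - altw (p @ v # q) - altw (p @ w # q) \<in> tensor_ideal E" .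
qed

lemma fcar_free_alt [simp]: "a \<in> fcar E \<Longrightarrow> free_alt a \<in> fcar E"
  unfolding free_alt_wlin
proof (rule fcar_wlin)
  fix u assume u: "set u \<subseteq> carrier E"
  show "altw u \<in> fcar E"
    unfolding altw_def by (intro fcar_sum fcar_mult fcar_single) (use u in simp_all)
qed

end

subsection \<open>The tensor algebra\<close>

context real_vec_space
begin

abbreviation tc :: "('v fword \<Rightarrow>\<^sub>0 real) \<Rightarrow> 'v tens" where
  "tc \<equiv> tensor_class E"

interpretation T: alg_ideal "free_alg E" "tensor_ideal E"
  using free.real_alg_axioms tensor_ideal by (rule alg_ideal.intro)

lemma qc_tc: "tensor_ideal E +>\<^bsub>free_alg E\<^esub> a = tc a"
  by (simp add: tensor_class_def)

lemma tensor_real_alg: "real_alg (tensor_alg E)"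
  unfolding tensor_alg_def by (rule T.quot_real_alg)

sublocale tens: real_alg "tensor_alg E"
  by (rule tensor_real_alg)

lemma tensor_carrier: "carrier (tensor_alg E) = tc ` fcar E"
  unfolding tensor_alg_def T.quot_carrier qc_tc ..

lemma tc_closed [simp]: "a \<in> fcar E \<Longrightarrow> tc a \<in> carrier (tensor_alg E)"
  by (simp add: tensor_carrier)

lemma tc_eq_iff: "a \<in> fcar E \<Longrightarrow> a' \<in> fcar E \<Longrightarrow> tc a = tc a' \<longleftrightarrow> a - a' \<in> tensor_ideal E"
  using T.qc_eq_iff[of a a'] by (simp add: qc_tc)

lemma tc_add: "a \<in> fcar E \<Longrightarrow> a' \<in> fcar E \<Longrightarrow> tc a \<oplus>\<^bsub>tensor_alg E\<^esub> tc a' = tc (a + a')"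
  using T.qc_add[of a a'] by (simp add: qc_tc tensor_alg_def)

lemma tc_mult: "a \<in> fcar E \<Longrightarrow> a' \<in> fcar E \<Longrightarrow> tc a \<otimes>\<^bsub>tensor_alg E\<^esub> tc a' = tc (a * a')"
  using T.qc_mult[of a a'] by (simp add: qc_tc tensor_alg_def)

lemma tc_one: "\<one>\<^bsub>tensor_alg E\<^esub> = tc 1"
  using T.qc_one by (simp add: qc_tc tensor_alg_def)

lemma tc_zero: "\<zero>\<^bsub>tensor_alg E\<^esub> = tc 0"
  using T.qc_zero by (simp add: qc_tc tensor_alg_def)

lemma tc_minus: "a \<in> fcar E \<Longrightarrow> a' \<in> fcar E \<Longrightarrow> tc a \<ominus>\<^bsub>tensor_alg E\<^esub> tc a' = tc (a - a')"
  using T.qc_minus[of a a'] by (simp add: qc_tc tensor_alg_def)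

lemma tc_smult: "a \<in> fcar E \<Longrightarrow> c \<odot>\<^bsub>tensor_alg E\<^esub> tc a = tc (scal c * a)"
  using T.qc_smult[of a c] by (simp add: qc_tc tensor_alg_def)

lemma the_elem_tc:
  assumes "a \<in> fcar E" and "\<And>a'. a' \<in> fcar E \<Longrightarrow> a' - a \<in> tensor_ideal E \<Longrightarrow> \<phi> a' = \<phi> a"
  shows "the_elem (\<phi> ` tc a) = \<phi> a"
  using T.the_elem_qc[OF assms(1), of \<phi>] assms unfolding qc_tc by (simp add: tc_eq_iff)

lemma tc_finsum:
  assumes "finite S" and "\<And>i. i \<in> S \<Longrightarrow> a i \<in> fcar E"
  shows "(\<Oplus>\<^bsub>tensor_alg E\<^esub>i\<in>S. tc (a i)) = tc (\<Sum>i\<in>S. a i)"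
  using assms
proof (induction S)
  case (insert i S)
  then show ?case
    by (subst tens.finsum_insert) (auto simp: tc_add fcar_sum)
qed (simp add: tc_zero)

section \<open>The exterior algebra as the image of antisymmetrization\<close>

lemma tensors_UNIV: "tensors E UNIV = tc ` fcar E"
  by (simp add: tensors_def)

lemma Alt_tc: "a \<in> fcar E \<Longrightarrow> Alt E (tc a) = tc (free_alt a)"
  unfolding Alt_def
  by (rule the_elem_tc) (auto simp: tc_eq_iff free_alt_diff[symmetric] free_alt_tensor_ideal)

text \<open>An exterior element is recorded by any \<open>a\<close> whose antisymmetrization
  represents it; \<open>a\<close> itself need not be antisymmetric. Multiplication by a vector and
  contraction can then be applied to \<open>a\<close> directly.\<close>

abbreviation ec :: "('v fword \<Rightarrow>\<^sub>0 real) \<Rightarrow> 'v tens" where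
  "ec a \<equiv> tc (free_alt a)"

lemma ec_eq_iff: "a \<in> fcar E \<Longrightarrow> a' \<in> fcar E \<Longrightarrow> ec a = ec a' \<longleftrightarrow> free_alt (a - a') \<in> tensor_ideal E"
  by (simp add: tc_eq_iff free_alt_diff)

lemma wedge_ec: "set vs \<subseteq> carrier E \<Longrightarrow> wedge E vs = ec (word vs)"
  by (simp add: wedge_def pure_tensor_def Alt_tc)

text \<open>The direct sum is graded by tensor degree, while \<open>ec\<close> ignores the grading:
  in one direction representatives of the components are added up, in the other \<open>x\<close> is
  split by word length into the pieces \<open>part n\<close>.\<close>

lemma ext_carrier_ec: "ext_carrier E = ec ` fcar E"
proof
  show "ext_carrier E \<subseteq> ec ` fcar E"
  proof
    fix e assume "e \<in> ext_carrier E"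
    then obtain N A where A: "e = (\<Oplus>\<^bsub>tensor_alg E\<^esub>n\<in>{..N}. A n)" "\<forall>n\<le>N. A n \<in> ext_power E n"
      unfolding ext_carrier_def by blast
    have "\<forall>n\<in>{..N}. \<exists>a. a \<in> fcar E \<and> A n = ec a"
    proof
      fix n assume "n \<in> {..N}"
      with A(2) have "A n \<in> ext_power E n" by simp
      then show "\<exists>a. a \<in> fcar E \<and> A n = ec a"
        by (auto simp: ext_power_def tensors_def Alt_tc)
    qed
    then obtain a where a: "\<forall>n\<in>{..N}. a n \<in> fcar E \<and> A n = ec (a n)" by metis
    have "e = (\<Oplus>\<^bsub>tensor_alg E\<^esub>n\<in>{..N}. ec (a n))"
      unfolding A(1) by (rule tens.finsum_cong') (use a in auto)
    also have "\<dots> = tc (\<Sum>n\<in>{..N}. free_alt (a n))"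
      by (rule tc_finsum) (use a in auto)
    also have "(\<Sum>n\<in>{..N}. free_alt (a n)) = free_alt (\<Sum>n\<in>{..N}. a n)"
      by (simp add: free_alt_wlin wlin_sum)
    finally show "e \<in> ec ` fcar E" using a by (auto intro!: fcar_sum)
  qed
  show "ec ` fcar E \<subseteq> ext_carrier E"
  proof
    fix e assume "e \<in> ec ` fcar E"
    then obtain x where x: "x \<in> fcar E" "e = ec x" by blast
    \<comment> \<open>The inserted \<open>0\<close> keeps \<open>Max\<close> meaningful when
      \<open>x = 0\<close> and there are no words.\<close>
    define N where "N = Max (insert 0 ((\<lambda>u. length (letters u)) ` Poly_Mapping.keys x))"
    define part where "part n = (\<Sum>u | u \<in> Poly_Mapping.keys x \<and> length (letters u) = n.
      Poly_Mapping.single u (Poly_Mapping.lookup x u))" for n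
    have N: "length (letters u) \<le> N" if "u \<in> Poly_Mapping.keys x" for u
      unfolding N_def using that by (intro Max_ge) auto
    have single: "Poly_Mapping.single u c \<in> fcar E" if "u \<in> Poly_Mapping.keys x" for u c
      using x(1) that by (cases u) (auto simp: mem_fcar)
    have part_in: "part n \<in> fcar E" for n
      unfolding part_def by (rule fcar_sum) (simp add: single)
    have part_keys: "length (letters u) = n" if "u \<in> Poly_Mapping.keys (part n)" for u n
    proof -
      have "Poly_Mapping.keys (part n) \<subseteq> {u. length (letters u) = n}"
        unfolding part_def by (rule order_trans[OF keys_sum]) auto
      with that show ?thesis by blast
    qed
    have "x = (\<Sum>n\<in>{..N}. part n)"
    proof -
      have "(\<Sum>n\<in>{..N}. part n) =
          (\<Sum>u\<in>Poly_Mapping.keys x. Poly_Mapping.single u (Poly_Mapping.lookup x u))"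
        unfolding part_def by (rule sum.group) (use N in auto)
      then show ?thesis by (simp add: poly_mapping_sum_singles)
    qed
    then have "free_alt x = (\<Sum>n\<in>{..N}. free_alt (part n))"
      by (simp add: free_alt_wlin flip: wlin_sum)
    then have "e = (\<Oplus>\<^bsub>tensor_alg E\<^esub>n\<in>{..N}. ec (part n))"
      unfolding x(2) by (subst tc_finsum) (simp_all add: part_in)
    moreover have "ec (part n) \<in> ext_power E n" for n
      unfolding ext_power_def tensors_def using part_in[of n] part_keys[of _ n]
      by (intro image_eqI[of _ _ "tc (part n)"]) (auto simp: Alt_tc)
    ultimately show "e \<in> ext_carrier E" unfolding ext_carrier_def by blast
  qed
qed

lemma ec_add: "a \<in> fcar E \<Longrightarrow> a' \<in> fcar E \<Longrightarrow> ec a \<oplus>\<^bsub>tensor_alg E\<^esub> ec a' = ec (a + a')"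
  and ec_minus: "a \<in> fcar E \<Longrightarrow> a' \<in> fcar E \<Longrightarrow> ec a \<ominus>\<^bsub>tensor_alg E\<^esub> ec a' = ec (a - a')"
  and ec_smult: "a \<in> fcar E \<Longrightarrow> c \<odot>\<^bsub>tensor_alg E\<^esub> ec a = ec (scal c * a)"
  by (simp_all add: tc_add tc_minus tc_smult free_alt_add free_alt_diff free_alt_scal)

end

lemma ext_space_simps [simp]:
  "carrier (ext_space E) = ext_carrier E" "add (ext_space E) = add (tensor_alg E)"
  "smult (ext_space E) = smult (tensor_alg E)" "ring.zero (ext_space E) = ring.zero (tensor_alg E)"
  by (simp_all add: ext_space_def)

lemma free_map_scalar [simp]: "free_map h (scal c) = scal c"
  using free_map_scal[of h c 1] free_map_word[of h "[]"] by simp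

lemma free_map_tensor_ideal:
  assumes "real_vec_space E" "real_vec_space E'" "lin_map E E' h" "a \<in> tensor_ideal E"
  shows "free_map h a \<in> tensor_ideal E'"
proof -
  interpret E: real_vec_space E by fact
  interpret E': real_vec_space E' by fact
  have h: "\<And>v. v \<in> carrier E \<Longrightarrow> h v \<in> carrier E'"
    "\<And>v w. v \<in> carrier E \<Longrightarrow> w \<in> carrier E \<Longrightarrow> h (v \<oplus>\<^bsub>E\<^esub> w) = h v \<oplus>\<^bsub>E'\<^esub> h w"
    "\<And>c v. v \<in> carrier E \<Longrightarrow> h (c \<odot>\<^bsub>E\<^esub> v) = c \<odot>\<^bsub>E'\<^esub> h v"
    using assms(3) by (auto simp: lin_map_def)
  have hs: "set p \<subseteq> carrier E \<Longrightarrow> set (map h p) \<subseteq> carrier E'" for p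
    using h(1) by auto
  show ?thesis
    unfolding free_map_wlin
    by (rule E.wlin_tensor_ideal[OF free_ideal_scal_subgroup[OF E'.tensor_ideal] _ _ assms(4)])
      (use hs in \<open>simp_all add: h E'.word_add_rel E'.word_smult_rel\<close>)
qed

lemma fcar_free_map:
  assumes "lin_map E E' h" "a \<in> fcar E"
  shows "free_map h a \<in> fcar E'"
  unfolding free_map_wlin
  by (rule fcar_wlin[OF assms(2)], rule fcar_single) (use assms(1) in \<open>auto simp: lin_map_def\<close>)

lemma tensor_hom_tc:
  assumes "real_vec_space E" "real_vec_space E'" "lin_map E E' h" "a \<in> fcar E"
  shows "tensor_hom E' h (tensor_class E a) = tensor_class E' (free_map h a)"
proof -
  interpret E: real_vec_space E by fact
  interpret E': real_vec_space E' by fact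
  show ?thesis
    unfolding tensor_hom_def
    by (rule E.the_elem_tc[OF assms(4)])
      (use assms in \<open>auto simp: E'.tc_eq_iff fcar_free_map free_map_diff[symmetric] free_map_tensor_ideal\<close>)
qed

subsection \<open>The standard Clifford action\<close>

text \<open>All laws are restricted to the carrier, since metrics and dual metrics are uncontrolled
  elsewhere. The form may be degenerate.\<close>

locale quadratic_space = real_vec_space +
  fixes b :: "'a \<Rightarrow> 'a \<Rightarrow> real"
  assumes b_sym: "v \<in> carrier E \<Longrightarrow> w \<in> carrier E \<Longrightarrow> b v w = b w v"
    and b_add: "u \<in> carrier E \<Longrightarrow> v \<in> carrier E \<Longrightarrow> w \<in> carrier E \<Longrightarrow> b u (v \<oplus> w) = b u v + b u w"
    and b_smult: "v \<in> carrier E \<Longrightarrow> w \<in> carrier E \<Longrightarrow> b v (c \<odot> w) = c * b v w"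
begin

lemma contr_word_in: "set u \<subseteq> carrier E \<Longrightarrow> contr_word b v u \<in> fcar E"
  by (induction u) (simp_all add: contr_word_Cons)

lemma contr_in: "a \<in> fcar E \<Longrightarrow> contr b v a \<in> fcar E"
  unfolding contr_def by (rule fcar_wlin[where E = E]) (auto intro: contr_word_in)

text \<open>Induction on the prefix \<open>p\<close>. At the varying letter, linearity of
  \<open>b\<close> cancels the scalar terms and leaves a relator times a contraction; a letter in
  front contributes a scalar multiple of a relation between words and a left multiple of the
  induction hypothesis. So contraction descends to tensors.\<close>

lemma contr_tensor_ideal:
  assumes z: "z \<in> carrier E" and "a \<in> tensor_ideal E"
  shows "contr b z a \<in> tensor_ideal E"
  unfolding contr_def
proof (rule wlin_tensor_ideal[OF free_ideal_scal_subgroup[OF tensor_ideal] _ _ assms(2)])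
  note I = free_ideal_scal_subgroup[OF tensor_ideal]
  fix p q v w assume p: "set p \<subseteq> carrier E" and q: "set q \<subseteq> carrier E" and v: "v \<in> carrier E"
    and w: "w \<in> carrier E"
  show "contr_word b z (p @ (v \<oplus> w) # q) - contr_word b z (p @ v # q) - contr_word b z (p @ w # q) \<in> tensor_ideal E"
    using p
  proof (induction p)
    case Nil
    have "contr_word b z ((v \<oplus> w) # q) - contr_word b z (v # q) - contr_word b z (w # q) =
        - (add_rel E v w * contr_word b z q)"
      using z v w by (simp add: contr_word_Cons b_add add_rel_def scal_add algebra_simps)
    then show ?case
      using free_ideal_mult_right[OF tensor_ideal add_rel_in[OF v w] contr_word_in[OF q]]
      by (simp add: free_ideal_minus[OF tensor_ideal])
  next
    case (Cons x p)
    let ?D = "contr_word b z (p @ (v \<oplus> w) # q) - contr_word b z (p @ v # q) - contr_word b z (p @ w # q)"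
    let ?W = "word (p @ (v \<oplus> w) # q) - word (p @ v # q) - word (p @ w # q)"
    have "contr_word b z (x # p @ (v \<oplus> w) # q) - contr_word b z (x # p @ v # q) - contr_word b z (x # p @ w # q)
       = scal (b z x) * ?W - free_gen x * ?D"
      by (simp add: contr_word_Cons algebra_simps)
    moreover have "scal (b z x) * ?W \<in> tensor_ideal E"
      using I word_add_rel[OF _ q v w] Cons.prems by (simp add: scal_subgroup_def)
    moreover have "free_gen x * ?D \<in> tensor_ideal E"
      using Cons by (intro free_ideal_mult_left[OF tensor_ideal]) simp_all
    ultimately show ?case by (simp add: scal_subgroup_diff[OF I])
  qed
next
  note I = free_ideal_scal_subgroup[OF tensor_ideal]
  fix p q c v assume p: "set p \<subseteq> carrier E" and q: "set q \<subseteq> carrier E" and v: "v \<in> carrier E"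
  show "contr_word b z (p @ (c \<odot> v) # q) - scal c * contr_word b z (p @ v # q) \<in> tensor_ideal E"
    using p
  proof (induction p)
    case Nil
    have "contr_word b z ((c \<odot> v) # q) - scal c * contr_word b z (v # q) =
        - (smult_rel E c v * contr_word b z q)"
      using z v by (simp add: contr_word_Cons b_smult smult_rel_def scal_mult[symmetric] algebra_simps)
    then show ?case
      using free_ideal_mult_right[OF tensor_ideal smult_rel_in[OF v] contr_word_in[OF q]]
      by (simp add: free_ideal_minus[OF tensor_ideal])
  next
    case (Cons x p)
    let ?D = "contr_word b z (p @ (c \<odot> v) # q) - scal c * contr_word b z (p @ v # q)"
    let ?W = "word (p @ (c \<odot> v) # q) - scal c * word (p @ v # q)"
    have "contr_word b z (x # p @ (c \<odot> v) # q) - scal c * contr_word b z (x # p @ v # q)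
       = scal (b z x) * ?W - free_gen x * ?D"
      by (simp only: append_Cons contr_word_Cons right_diff_distrib scal_left_commute[of _ c]) simp
    moreover have "scal (b z x) * ?W \<in> tensor_ideal E"
      using I word_smult_rel[OF _ q v] Cons.prems by (simp add: scal_subgroup_def)
    moreover have "free_gen x * ?D \<in> tensor_ideal E"
      using Cons by (intro free_ideal_mult_left[OF tensor_ideal]) simp_all
    ultimately show ?case by (simp add: scal_subgroup_diff[OF I])
  qed
qed

section \<open>The free algebra acting on the exterior algebra\<close>

lemma cliff_op_in [simp]: "v \<in> carrier E \<Longrightarrow> a \<in> fcar E \<Longrightarrow> cliff_op b v a \<in> fcar E"
  by (simp add: cliff_op_def contr_in)

lemma foldr_cliff_op_in: "set u \<subseteq> carrier E \<Longrightarrow> x \<in> fcar E \<Longrightarrow> foldr (cliff_op b) u x \<in> fcar E"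
  by (induction u) simp_all

lemma cliff_act_in [simp]: "a \<in> fcar E \<Longrightarrow> x \<in> fcar E \<Longrightarrow> cliff_act b a x \<in> fcar E"
  unfolding cliff_act_def by (rule fcar_wlin[where E = E]) (auto intro: foldr_cliff_op_in)

text \<open>The kernel of \<open>ec\<close>: representatives of zero in the exterior algebra. A
  linear operator on the free algebra descends to the exterior algebra when it preserves this
  subspace.\<close>

definition alt_kernel :: "('a fword \<Rightarrow>\<^sub>0 real) set" where
  "alt_kernel = {x \<in> fcar E. free_alt x \<in> tensor_ideal E}"

lemma alt_kernel_subgroup: "scal_subgroup alt_kernel"
  using free_ideal_scal_subgroup[OF tensor_ideal]
  by (auto simp: scal_subgroup_def alt_kernel_def free_alt_add free_alt_scal)

text \<open>Membership controls \<open>free_alt x\<close>, not \<open>x\<close>. The operator is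
  therefore applied to \<open>free_alt x\<close>, which lies in the tensor ideal and stays there; a
  further antisymmetrization lets \<open>free_alt_cliff_op\<close> replace \<open>free_alt x\<close>
  by \<open>x\<close>.\<close>

lemma cliff_op_alt_kernel:
  assumes v: "v \<in> carrier E" and x: "x \<in> alt_kernel"
  shows "cliff_op b v x \<in> alt_kernel"
proof -
  have "cliff_op b v (free_alt x) \<in> tensor_ideal E"
    using x v unfolding alt_kernel_def cliff_op_def
    by (auto intro!: free_ideal_diff[OF tensor_ideal] free_ideal_mult_left[OF tensor_ideal] contr_tensor_ideal)
  then have "free_alt (cliff_op b v (free_alt x)) \<in> tensor_ideal E"
    by (rule free_alt_tensor_ideal)
  then show ?thesis
    using x v by (simp add: free_alt_cliff_op alt_kernel_def)
qed

lemma cliff_act_alt_kernel: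
  assumes "a \<in> fcar E" and x: "x \<in> alt_kernel"
  shows "cliff_act b a x \<in> alt_kernel"
  using assms(1)
proof (induction a rule: fcar_induct)
  case (word u c)
  have "foldr (cliff_op b) u x \<in> alt_kernel"
    using word x by (induction u) (simp_all add: cliff_op_alt_kernel)
  then show ?case
    using alt_kernel_subgroup by (simp add: cliff_act_scal_left scal_subgroup_def)
qed (use alt_kernel_subgroup in \<open>auto simp: cliff_act_add_left scal_subgroup_def\<close>)

text \<open>The kernel of the representation of the free algebra on the exterior algebra. The
  Clifford algebra acts because this kernel contains the tensor relators and the Clifford
  relators.\<close>

definition annihilator :: "('a fword \<Rightarrow>\<^sub>0 real) set" where
  "annihilator = {a \<in> fcar E. \<forall>x\<in>fcar E. cliff_act b a x \<in> alt_kernel}"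

text \<open>Closure under left factors is the stability of \<open>alt_kernel\<close> under the
  action; closure under right factors holds because products act as composites and the test runs
  over all \<open>x\<close>.\<close>

lemma annihilator_ideal: "ideal annihilator (free_alg E)"
proof (rule free_idealI)
  show "annihilator \<subseteq> fcar E" by (auto simp: annihilator_def)
  show "0 \<in> annihilator" using alt_kernel_subgroup by (auto simp: annihilator_def scal_subgroup_def)
  show "\<And>a a'. a \<in> annihilator \<Longrightarrow> a' \<in> annihilator \<Longrightarrow> a + a' \<in> annihilator"
    using alt_kernel_subgroup by (auto simp: annihilator_def scal_subgroup_def cliff_act_add_left)
  show "\<And>a. a \<in> annihilator \<Longrightarrow> - a \<in> annihilator"
    using scal_subgroup_minus[OF alt_kernel_subgroup] cliff_act_diff_left[of b 0]
    by (auto simp: annihilator_def)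
  show "\<And>a x. a \<in> annihilator \<Longrightarrow> x \<in> fcar E \<Longrightarrow> x * a \<in> annihilator"
    by (auto simp: annihilator_def cliff_act_mult intro: cliff_act_alt_kernel)
  show "\<And>a x. a \<in> annihilator \<Longrightarrow> x \<in> fcar E \<Longrightarrow> a * x \<in> annihilator"
    by (auto simp: annihilator_def cliff_act_mult)
qed

lemma tensor_ideal_alt_kernel: "tensor_ideal E \<subseteq> alt_kernel"
  using free_ideal_sub[OF tensor_ideal] by (auto simp: alt_kernel_def free_alt_tensor_ideal)

lemma b_add_left: "u \<in> carrier E \<Longrightarrow> v \<in> carrier E \<Longrightarrow> w \<in> carrier E \<Longrightarrow> b (v \<oplus> w) u = b v u + b w u"
  by (simp add: b_sym[of _ u] b_add)

lemma b_smult_left: "v \<in> carrier E \<Longrightarrow> w \<in> carrier E \<Longrightarrow> b (c \<odot> w) v = c * b w v"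
  by (simp add: b_sym[of _ v] b_smult)

lemma contr_add_vector:
  assumes "v \<in> carrier E" "w \<in> carrier E" "x \<in> fcar E"
  shows "contr b (v \<oplus> w) x = contr b v x + contr b w x"
  using assms(3)
proof (induction x rule: fcar_induct)
  case (word u c)
  then have "contr_word b (v \<oplus> w) u = contr_word b v u + contr_word b w u"
    by (induction u) (use assms in \<open>simp_all add: contr_word_Cons b_add_left scal_add algebra_simps\<close>)
  then show ?case by (simp only: contr_scal contr_on_word distrib_left)
qed (simp_all add: contr_add)

lemma contr_smult_vector:
  assumes "v \<in> carrier E" "x \<in> fcar E"
  shows "contr b (c \<odot> v) x = scal c * contr b v x"
  using assms(2)
proof (induction x rule: fcar_induct)
  case (word u d)
  then have "contr_word b (c \<odot> v) u = scal c * contr_word b v u"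
    by (induction u) (use assms in \<open>simp_all add: contr_word_Cons b_smult_left scal_mult[symmetric]
        right_diff_distrib scal_gen_commute mult.assoc\<close>)
  then show ?case by (simp only: contr_scal contr_on_word scal_left_commute[of "scal d"])
qed (simp_all add: contr_add distrib_left)

text \<open>Contraction is linear in the contracting vector, so for a relator the contraction parts
  cancel and it acts by plain left multiplication, with values in the tensor ideal.\<close>

lemma tensor_ideal_annihilator: "tensor_ideal E \<subseteq> annihilator"
proof (rule tensor_ideal_subset[OF annihilator_ideal])
  fix v w assume vw: "v \<in> carrier E" "w \<in> carrier E"
  have "cliff_act b (add_rel E v w) x = add_rel E v w * x" if "x \<in> fcar E" for x
    using vw that by (simp add: add_rel_def cliff_act_diff_left cliff_act_gen cliff_op_def contr_add_vector left_diff_distrib)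
  then show "add_rel E v w \<in> annihilator"
    using vw tensor_ideal_alt_kernel add_rel_in[OF vw] free_ideal_mult_right[OF tensor_ideal]
    by (auto simp: annihilator_def rels_in_fcar)
next
  fix c v assume v: "v \<in> carrier E"
  have "cliff_act b (smult_rel E c v) x = smult_rel E c v * x" if "x \<in> fcar E" for x
    using v that by (simp add: smult_rel_def cliff_act_diff_left cliff_act_scal_left cliff_act_gen cliff_op_def
        contr_smult_vector left_diff_distrib right_diff_distrib mult.assoc)
  then show "smult_rel E c v \<in> annihilator"
    using v tensor_ideal_alt_kernel smult_rel_in[OF v] free_ideal_mult_right[OF tensor_ideal]
    by (auto simp: annihilator_def rels_in_fcar)
qed

definition cliff_rel :: "'a \<Rightarrow> 'a \<Rightarrow> 'a fword \<Rightarrow>\<^sub>0 real" where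
  "cliff_rel v w = word [v, w] + word [w, v] + scal (2 * b v w)"

text \<open>By symmetry the scalar \<open>- (b v w + b w v)\<close> of
  \<open>cliff_op_anticommute\<close> is the negative of \<open>2 * b v w\<close>; here the
  coefficient 2 of the relator matches the sign of the contraction.\<close>

lemma cliff_rel_annihilator:
  assumes "v \<in> carrier E" "w \<in> carrier E"
  shows "cliff_rel v w \<in> annihilator"
proof -
  have "free_alt (cliff_act b (cliff_rel v w) x) = 0" for x
  proof -
    have "cliff_act b (cliff_rel v w) x =
      cliff_op b v (cliff_op b w x) + cliff_op b w (cliff_op b v x) + scal (2 * b v w) * x"
      using assms by (simp add: cliff_rel_def cliff_act_add_left)
    then show ?thesis
      using cliff_op_anticommute[of b v w x] b_sym[OF assms]
      by (simp add: free_alt_add free_alt_scal)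
  qed
  then show ?thesis
    using assms by (auto simp: annihilator_def alt_kernel_def cliff_rel_def free_ideal_zero[OF tensor_ideal] cliff_act_in)
qed

lemma clifford_ideal_rels:
  "clifford_ideal E b = Idl\<^bsub>tensor_alg E\<^esub> {tc (cliff_rel v w) |v w. v \<in> carrier E \<and> w \<in> carrier E}"
proof -
  have "pure_tensor E [v, w] \<oplus>\<^bsub>tensor_alg E\<^esub> pure_tensor E [w, v]
        \<oplus>\<^bsub>tensor_alg E\<^esub> (2 * b v w) \<odot>\<^bsub>tensor_alg E\<^esub> \<one>\<^bsub>tensor_alg E\<^esub> = tc (cliff_rel v w)"
    if "v \<in> carrier E" "w \<in> carrier E" for v w
    using that by (simp add: pure_tensor_def cliff_rel_def tc_add tc_one tc_smult)
  then have "{pure_tensor E [v, w] \<oplus>\<^bsub>tensor_alg E\<^esub> pure_tensor E [w, v]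
        \<oplus>\<^bsub>tensor_alg E\<^esub> (2 * b v w) \<odot>\<^bsub>tensor_alg E\<^esub> \<one>\<^bsub>tensor_alg E\<^esub>
      |v w. v \<in> carrier E \<and> w \<in> carrier E} = {tc (cliff_rel v w) |v w. v \<in> carrier E \<and> w \<in> carrier E}"
    by blast
  then show ?thesis by (simp add: clifford_ideal_def)
qed

lemma cliff_rel_in [simp]: "v \<in> carrier E \<Longrightarrow> w \<in> carrier E \<Longrightarrow> cliff_rel v w \<in> fcar E"
  by (simp add: cliff_rel_def)

section \<open>Representatives of Clifford elements in the free algebra\<close>

lemma clifford_ideal: "ideal (clifford_ideal E b) (tensor_alg E)"
  unfolding clifford_ideal_rels by (rule tens.genideal_ideal) auto

interpretation Cl: alg_ideal "tensor_alg E" "clifford_ideal E b"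
  using tensor_real_alg clifford_ideal by (rule alg_ideal.intro)

lemma clifford_ideal_subset:
  assumes "ideal J (tensor_alg E)" "\<And>v w. v \<in> carrier E \<Longrightarrow> w \<in> carrier E \<Longrightarrow> tc (cliff_rel v w) \<in> J"
  shows "clifford_ideal E b \<subseteq> J"
  unfolding clifford_ideal_rels by (rule tens.genideal_minimal[OF assms(1)]) (use assms(2) in auto)

lemma clifford_rel_mem: "v \<in> carrier E \<Longrightarrow> w \<in> carrier E \<Longrightarrow> tc (cliff_rel v w) \<in> clifford_ideal E b"
proof -
  have "{tc (cliff_rel v w) |v w. v \<in> carrier E \<and> w \<in> carrier E} \<subseteq> clifford_ideal E b"
    unfolding clifford_ideal_rels by (rule tens.genideal_self) auto
  then show "v \<in> carrier E \<Longrightarrow> w \<in> carrier E \<Longrightarrow> ?thesis" by blast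
qed

abbreviation cl :: "('a fword \<Rightarrow>\<^sub>0 real) \<Rightarrow> 'a cliff" where
  "cl a \<equiv> clifford_class E b (tc a)"

lemma qc_cl: "clifford_ideal E b +>\<^bsub>tensor_alg E\<^esub> A = clifford_class E b A"
  by (simp add: clifford_class_def)

lemma clifford_carrier: "carrier (clifford_alg E b) = cl ` fcar E"
  unfolding clifford_alg_def Cl.quot_carrier qc_cl tensor_carrier by (simp add: image_image)

lemma cl_closed [simp]: "a \<in> fcar E \<Longrightarrow> cl a \<in> carrier (clifford_alg E b)"
  by (simp add: clifford_carrier)

lemma cl_eq_iff: "a \<in> fcar E \<Longrightarrow> a' \<in> fcar E \<Longrightarrow> cl a = cl a' \<longleftrightarrow> tc (a - a') \<in> clifford_ideal E b"
  using Cl.qc_eq_iff[of "tc a" "tc a'"] by (simp add: qc_cl tc_minus)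

lemma cl_add: "a \<in> fcar E \<Longrightarrow> a' \<in> fcar E \<Longrightarrow> cl a \<oplus>\<^bsub>clifford_alg E b\<^esub> cl a' = cl (a + a')"
  using Cl.qc_add[of "tc a" "tc a'"] by (simp add: qc_cl clifford_alg_def tc_add)

lemma cl_mult: "a \<in> fcar E \<Longrightarrow> a' \<in> fcar E \<Longrightarrow> cl a \<otimes>\<^bsub>clifford_alg E b\<^esub> cl a' = cl (a * a')"
  using Cl.qc_mult[of "tc a" "tc a'"] by (simp add: qc_cl clifford_alg_def tc_mult)

lemma cl_one: "\<one>\<^bsub>clifford_alg E b\<^esub> = cl 1"
  using Cl.qc_one by (simp add: qc_cl clifford_alg_def tc_one)

lemma cl_smult: "a \<in> fcar E \<Longrightarrow> c \<odot>\<^bsub>clifford_alg E b\<^esub> cl a = cl (scal c * a)"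
  using Cl.qc_smult[of "tc a" c] by (simp add: qc_cl clifford_alg_def tc_smult)

lemma the_elem_clifford:
  assumes "A \<in> carrier (tensor_alg E)"
    and "\<And>A'. A' \<in> carrier (tensor_alg E) \<Longrightarrow> A' \<ominus>\<^bsub>tensor_alg E\<^esub> A \<in> clifford_ideal E b \<Longrightarrow> \<phi> A' = \<phi> A"
  shows "the_elem (\<phi> ` clifford_class E b A) = \<phi> A"
  using Cl.the_elem_qc[OF assms(1), of \<phi>] assms unfolding qc_cl[symmetric] by (simp add: Cl.qc_eq_iff)

text \<open>The image of \<open>annihilator\<close> in the tensor algebra is an ideal with all
  Clifford relators, hence contains the Clifford ideal. Going back from classes to \<open>a\<close>
  costs an element of the tensor ideal, which annihilates as well.\<close>

lemma clifford_ideal_annihilator: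
  assumes "a \<in> fcar E" "tc a \<in> clifford_ideal E b"
  shows "a \<in> annihilator"
proof -
  interpret T: alg_ideal "free_alg E" "tensor_ideal E"
    using free.real_alg_axioms tensor_ideal by (rule alg_ideal.intro)
  have "ideal (tc ` annihilator) (tensor_alg E)"
    using T.image_ideal[OF annihilator_ideal] by (simp add: qc_tc tensor_alg_def)
  then have "clifford_ideal E b \<subseteq> tc ` annihilator"
    by (rule clifford_ideal_subset) (simp add: cliff_rel_annihilator)
  with assms(2) obtain a' where a': "a' \<in> annihilator" "tc a = tc a'" by blast
  then have "a - a' \<in> annihilator"
    using tensor_ideal_annihilator assms(1) tc_eq_iff[of a a'] free_ideal_sub[OF annihilator_ideal] by blast
  with a' show ?thesis
    using free_ideal_add[OF annihilator_ideal, of "a - a'" a'] by simp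
qed

text \<open>The difference of the two results is (a - a') x + a' (x - x'). The left summand is in
  \<open>alt_kernel\<close> because a - a' annihilates, the right one because the action preserves
  \<open>alt_kernel\<close>.\<close>

lemma ec_cliff_act_cong:
  assumes "a \<in> fcar E" "a' \<in> fcar E" "cl a = cl a'" "x \<in> fcar E" "x' \<in> fcar E" "ec x = ec x'"
  shows "ec (cliff_act b a x) = ec (cliff_act b a' x')"
proof -
  have "a - a' \<in> annihilator"
    using assms by (intro clifford_ideal_annihilator) (simp_all add: cl_eq_iff[symmetric])
  then have "cliff_act b (a - a') x \<in> alt_kernel" using assms(4) by (simp add: annihilator_def)
  moreover have "x - x' \<in> alt_kernel"
    using assms ec_eq_iff[of x x'] by (simp add: alt_kernel_def)
  then have "cliff_act b a' (x - x') \<in> alt_kernel" using assms(2) by (rule cliff_act_alt_kernel[rotated])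
  ultimately have "cliff_act b (a - a') x + cliff_act b a' (x - x') \<in> alt_kernel"
    using alt_kernel_subgroup by (simp add: scal_subgroup_def)
  then have "cliff_act b a x - cliff_act b a' x' \<in> alt_kernel"
    by (simp add: cliff_act_diff_left cliff_act_diff)
  then show ?thesis
    using assms by (simp add: ec_eq_iff alt_kernel_def)
qed

text \<open>Representatives are chosen by \<open>SOME\<close>. The two restrictions are forced,
  since \<open>is_standard_action\<close> and \<open>End_ring\<close> demand
  \<open>undefined\<close> outside the carriers.\<close>

definition quot_action :: "'a cliff \<Rightarrow> 'a tens \<Rightarrow> 'a tens" where
  "quot_action = (\<lambda>C\<in>carrier (clifford_alg E b). \<lambda>e\<in>ext_carrier E.
     ec (cliff_act b (SOME a. a \<in> fcar E \<and> cl a = C) (SOME x. x \<in> fcar E \<and> ec x = e)))"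

lemma quot_action_eq:
  assumes "a \<in> fcar E" "x \<in> fcar E"
  shows "quot_action (cl a) (ec x) = ec (cliff_act b a x)"
proof -
  let ?a = "SOME a'. a' \<in> fcar E \<and> cl a' = cl a" and ?x = "SOME x'. x' \<in> fcar E \<and> ec x' = ec x"
  have "?a \<in> fcar E \<and> cl ?a = cl a" by (rule someI[of _ a]) (simp add: assms)
  moreover have "?x \<in> fcar E \<and> ec ?x = ec x" by (rule someI[of _ x]) (simp add: assms)
  ultimately have "ec (cliff_act b ?a ?x) = ec (cliff_act b a x)"
    using assms by (intro ec_cliff_act_cong) auto
  then show ?thesis
    using assms by (simp add: quot_action_def ext_carrier_ec)
qed

lemma ec_in_ext [simp]: "x \<in> fcar E \<Longrightarrow> ec x \<in> ext_carrier E"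
  by (simp add: ext_carrier_ec)

lemma quot_action_End:
  assumes "C \<in> carrier (clifford_alg E b)"
  shows "quot_action C \<in> carrier (End_ring (ext_space E))"
proof -
  obtain a where a: "a \<in> fcar E" "C = cl a" using assms by (auto simp: clifford_carrier)
  have "quot_action C \<in> ext_carrier E \<rightarrow>\<^sub>E ext_carrier E"
  proof (rule PiE_I)
    fix e assume "e \<in> ext_carrier E"
    then obtain x where "x \<in> fcar E" "e = ec x" by (auto simp: ext_carrier_ec)
    then show "quot_action C e \<in> ext_carrier E" using a by (simp add: quot_action_eq)
  next
    fix e assume "e \<notin> ext_carrier E"
    then show "quot_action C e = undefined" using assms by (simp add: quot_action_def)
  qed
  moreover have "lin_map (ext_space E) (ext_space E) (quot_action C)"
    unfolding lin_map_def
  proof (intro conjI ballI allI)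
    show "quot_action C \<in> carrier (ext_space E) \<rightarrow> carrier (ext_space E)"
      using calculation by auto
    fix e assume "e \<in> carrier (ext_space E)"
    then obtain x where x: "x \<in> fcar E" "e = ec x" by (auto simp: ext_carrier_ec)
    { fix e' assume "e' \<in> carrier (ext_space E)"
      then obtain x' where x': "x' \<in> fcar E" "e' = ec x'" by (auto simp: ext_carrier_ec)
      show "quot_action C (e \<oplus>\<^bsub>ext_space E\<^esub> e') = quot_action C e \<oplus>\<^bsub>ext_space E\<^esub> quot_action C e'"
        using a x x' by (simp add: ec_add quot_action_eq cliff_act_add) }
    show "quot_action C (c \<odot>\<^bsub>ext_space E\<^esub> e) = c \<odot>\<^bsub>ext_space E\<^esub> quot_action C e" for c
      using a x by (simp add: ec_smult quot_action_eq cliff_act_scal)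
  qed
  ultimately show ?thesis by (simp add: End_ring_def)
qed

text \<open>Each wedge is \<open>ec\<close> of a word and the signs in the sum are those of
  \<open>contr_word\<close>, so the value prescribed on generators is the class of d_v applied to
  the word.\<close>

lemma ec_generator_formula:
  assumes "v \<in> carrier E" "set vs \<subseteq> carrier E"
  shows "wedge E (v # vs) \<ominus>\<^bsub>tensor_alg E\<^esub>
          (\<Oplus>\<^bsub>tensor_alg E\<^esub>j\<in>{..<length vs}.
             ((-1) ^ j * b v (vs ! j)) \<odot>\<^bsub>tensor_alg E\<^esub> wedge E (take j vs @ drop (Suc j) vs))
       = ec (cliff_op b v (word vs))"
proof -
  have sub: "set (take j vs @ drop (Suc j) vs) \<subseteq> carrier E" for j
    using assms(2) set_take_subset[of j vs] set_drop_subset[of "Suc j" vs] by auto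
  let ?t = "\<lambda>j. scal ((-1) ^ j * b v (vs ! j)) * word (take j vs @ drop (Suc j) vs)"
  have t: "?t j \<in> fcar E" for j
    by (intro fcar_mult fcar_single sub) simp
  have "(\<Oplus>\<^bsub>tensor_alg E\<^esub>j\<in>{..<length vs}.
      ((-1) ^ j * b v (vs ! j)) \<odot>\<^bsub>tensor_alg E\<^esub> wedge E (take j vs @ drop (Suc j) vs))
    = (\<Oplus>\<^bsub>tensor_alg E\<^esub>j\<in>{..<length vs}. ec (?t j))"
  proof (rule tens.finsum_cong'[OF refl])
    show "(\<lambda>j. ec (?t j)) \<in> {..<length vs} \<rightarrow> carrier (tensor_alg E)"
      using t by (intro Pi_I tc_closed fcar_free_alt)
    fix j
    show "((-1) ^ j * b v (vs ! j)) \<odot>\<^bsub>tensor_alg E\<^esub> wedge E (take j vs @ drop (Suc j) vs) = ec (?t j)"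
      unfolding wedge_ec[OF sub] by (rule ec_smult[OF fcar_single[OF sub]])
  qed
  also have "\<dots> = tc (\<Sum>j<length vs. free_alt (?t j))"
    by (rule tc_finsum) (use t in auto)
  also have "(\<Sum>j<length vs. free_alt (?t j)) = free_alt (contr_word b v vs)"
    unfolding contr_word_def by (simp only: free_alt_wlin wlin_sum)
  finally show ?thesis
    using assms by (simp add: wedge_ec ec_minus contr_word_in cliff_op_def contr_on_word word_Cons)
qed

lemma quot_action_standard: "is_standard_action E b quot_action"
  unfolding is_standard_action_def
proof (intro conjI ballI allI)
  show "quot_action \<in> extensional (carrier (clifford_alg E b))"
    by (simp add: quot_action_def)
  have ext: "S = T" if "S \<in> carrier (End_ring (ext_space E))" "T \<in> carrier (End_ring (ext_space E))"
    "\<And>x. x \<in> fcar E \<Longrightarrow> S (ec x) = T (ec x)" for S T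
  proof (rule extensionalityI[of _ "ext_carrier E"])
    show "S \<in> extensional (ext_carrier E)" "T \<in> extensional (ext_carrier E)"
      using that(1,2) by (auto simp: End_ring_def PiE_def)
  qed (use that(3) in \<open>auto simp: ext_carrier_ec\<close>)
  show "quot_action \<in> ring_hom (clifford_alg E b) (End_ring (ext_space E))"
  proof (rule ring_hom_memI)
    fix C assume C: "C \<in> carrier (clifford_alg E b)"
    then show "quot_action C \<in> carrier (End_ring (ext_space E))" by (rule quot_action_End)
    obtain a where a: "a \<in> fcar E" "C = cl a" using C by (auto simp: clifford_carrier)
    fix D assume D: "D \<in> carrier (clifford_alg E b)"
    then obtain a' where a': "a' \<in> fcar E" "D = cl a'" by (auto simp: clifford_carrier)
    have QC: "quot_action C \<in> ext_carrier E \<rightarrow>\<^sub>E ext_carrier E" "quot_action D \<in> ext_carrier E \<rightarrow>\<^sub>E ext_carrier E"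
      using quot_action_End C D by (auto simp: End_ring_def)
    have sum: "quot_action C \<oplus>\<^bsub>End_ring (ext_space E)\<^esub> quot_action D = (\<lambda>x\<in>ext_carrier E. quot_action C x \<oplus>\<^bsub>tensor_alg E\<^esub> quot_action D x)"
      by (simp add: End_ring_def)
    have prod: "quot_action C \<otimes>\<^bsub>End_ring (ext_space E)\<^esub> quot_action D = compose (ext_carrier E) (quot_action C) (quot_action D)"
      by (simp add: End_ring_def)
    show "quot_action (C \<otimes>\<^bsub>clifford_alg E b\<^esub> D) = quot_action C \<otimes>\<^bsub>End_ring (ext_space E)\<^esub> quot_action D"
      unfolding prod
    proof (rule extensionalityI[of _ "ext_carrier E"])
      show "quot_action (C \<otimes>\<^bsub>clifford_alg E b\<^esub> D) \<in> extensional (ext_carrier E)"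
        using quot_action_End[of "C \<otimes>\<^bsub>clifford_alg E b\<^esub> D"] a a' by (auto simp: cl_mult End_ring_def PiE_def)
      fix e assume "e \<in> ext_carrier E"
      then obtain x where "x \<in> fcar E" "e = ec x" by (auto simp: ext_carrier_ec)
      then show "quot_action (C \<otimes>\<^bsub>clifford_alg E b\<^esub> D) e = compose (ext_carrier E) (quot_action C) (quot_action D) e"
        using a a' by (simp add: cl_mult quot_action_eq compose_def cliff_act_mult)
    qed (simp add: compose_def)
    show "quot_action (C \<oplus>\<^bsub>clifford_alg E b\<^esub> D) = quot_action C \<oplus>\<^bsub>End_ring (ext_space E)\<^esub> quot_action D"
      unfolding sum
    proof (rule extensionalityI[of _ "ext_carrier E"])
      show "quot_action (C \<oplus>\<^bsub>clifford_alg E b\<^esub> D) \<in> extensional (ext_carrier E)"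
        using quot_action_End[of "C \<oplus>\<^bsub>clifford_alg E b\<^esub> D"] a a' by (auto simp: cl_add End_ring_def PiE_def)
      fix e assume "e \<in> ext_carrier E"
      then obtain x where "x \<in> fcar E" "e = ec x" by (auto simp: ext_carrier_ec)
      then show "quot_action (C \<oplus>\<^bsub>clifford_alg E b\<^esub> D) e = (\<lambda>x\<in>ext_carrier E. quot_action C x \<oplus>\<^bsub>tensor_alg E\<^esub> quot_action D x) e"
        using a a' by (simp add: cl_add quot_action_eq cliff_act_add_left ec_add)
    qed simp
  next
    have one: "\<one>\<^bsub>End_ring (ext_space E)\<^esub> = (\<lambda>x\<in>ext_carrier E. x)" by (simp add: End_ring_def)
    show "quot_action \<one>\<^bsub>clifford_alg E b\<^esub> = \<one>\<^bsub>End_ring (ext_space E)\<^esub>"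
      unfolding one
    proof (rule extensionalityI[of _ "ext_carrier E"])
      show "quot_action \<one>\<^bsub>clifford_alg E b\<^esub> \<in> extensional (ext_carrier E)"
        using quot_action_End[of "\<one>\<^bsub>clifford_alg E b\<^esub>"] by (auto simp: cl_one End_ring_def PiE_def)
    qed (auto simp: ext_carrier_ec cl_one quot_action_eq)
  qed
next
  fix r C e assume "C \<in> carrier (clifford_alg E b)" "e \<in> ext_carrier E"
  then obtain a x where "a \<in> fcar E" "C = cl a" "x \<in> fcar E" "e = ec x"
    by (auto simp: clifford_carrier ext_carrier_ec)
  then show "quot_action (r \<odot>\<^bsub>clifford_alg E b\<^esub> C) e = r \<odot>\<^bsub>ext_space E\<^esub> quot_action C e"
    by (simp add: cl_smult quot_action_eq cliff_act_scal_left ec_smult)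
next
  fix v vs assume "v \<in> carrier E" "vs \<in> lists (carrier E)"
  then have *: "v \<in> carrier E" "set vs \<subseteq> carrier E" by auto
  show "quot_action (clifford_class E b (pure_tensor E [v])) (wedge E vs) =
          wedge E (v # vs) \<ominus>\<^bsub>tensor_alg E\<^esub>
          (\<Oplus>\<^bsub>tensor_alg E\<^esub>j\<in>{..<length vs}.
             ((-1) ^ j * b v (vs ! j)) \<odot>\<^bsub>tensor_alg E\<^esub> wedge E (take j vs @ drop (Suc j) vs))"
    unfolding ec_generator_formula[OF *]
    using * by (simp add: pure_tensor_def wedge_ec quot_action_eq)
qed

text \<open>Wedges span the exterior algebra and products of vectors span the Clifford algebra. The
  values on generators propagate by linearity to every exterior element, and by multiplicativity and
  linearity to every Clifford element.\<close>

lemma standard_action_unique: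
  assumes c: "is_standard_action E b c" and "a \<in> fcar E" "x \<in> fcar E"
  shows "c (cl a) (ec x) = ec (cliff_act b a x)"
proof -
  have hom: "c \<in> ring_hom (clifford_alg E b) (End_ring (ext_space E))"
    using c unfolding is_standard_action_def by blast
  have End: "c (cl a) \<in> carrier (End_ring (ext_space E))" if "a \<in> fcar E" for a
    using hom that by (auto simp: ring_hom_def)
  then have lin: "lin_map (ext_space E) (ext_space E) (c (cl a))" if "a \<in> fcar E" for a
    using that by (auto simp: End_ring_def)
  have cadd: "c (cl a) (ec (x + y)) = c (cl a) (ec x) \<oplus>\<^bsub>tensor_alg E\<^esub> c (cl a) (ec y)"
    and cscal: "c (cl a) (ec (scal r * x)) = r \<odot>\<^bsub>tensor_alg E\<^esub> c (cl a) (ec x)"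
    if "a \<in> fcar E" "x \<in> fcar E" "y \<in> fcar E" for a x y r
    using lin[OF that(1)] that by (simp_all add: lin_map_def ec_add[symmetric] ec_smult[symmetric])
  have gen: "c (cl (free_gen v)) (ec x) = ec (cliff_op b v x)" if v: "v \<in> carrier E" and "x \<in> fcar E" for v x
    using that(2)
  proof (induction x rule: fcar_induct)
    case zero
    show ?case
      using cscal[of "free_gen v" 0 0 0] v tc_smult[of "free_alt (cliff_op b v 0)" 0]
      using lin[of "free_gen v"] ec_in_ext[of 0] cliff_op_scal[of b v 0 0]
      by (auto simp: lin_map_def tc_smult Pi_def ext_carrier_ec)
  next
    case (word u d)
    have "c (clifford_class E b (pure_tensor E [v])) (wedge E u) = ec (cliff_op b v (word u))"
      using c[unfolded is_standard_action_def, THEN conjunct2, THEN conjunct2, THEN conjunct2, rule_format, OF v, of u]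
        ec_generator_formula[OF v word] word by auto
    then have "c (cl (free_gen v)) (ec (word u)) = ec (cliff_op b v (word u))"
      using word by (simp add: pure_tensor_def wedge_ec free_gen_def)
    then show ?case
      using v word cscal[of "free_gen v" "word u" 0 d]
      by (simp only: fcar_gen fcar_single fcar_zero ec_smult cliff_op_in cliff_op_scal)
  next
    case (add x y)
    then show ?case using v cadd[of "free_gen v" x y] by (simp add: cliff_op_add ec_add)
  qed
  have prod: "c (cl (a * a')) (ec x) = c (cl a) (c (cl a') (ec x))" if "a \<in> fcar E" "a' \<in> fcar E" "x \<in> fcar E" for a a' x
  proof -
    have "c (cl (a * a')) = compose (ext_carrier E) (c (cl a)) (c (cl a'))"
      using ring_hom_mult[OF hom, of "cl a" "cl a'"] that by (simp add: cl_mult End_ring_def)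
    then show ?thesis using that by (simp add: compose_def)
  qed
  have sum: "c (cl (a + a')) (ec x) = c (cl a) (ec x) \<oplus>\<^bsub>tensor_alg E\<^esub> c (cl a') (ec x)"
    if "a \<in> fcar E" "a' \<in> fcar E" "x \<in> fcar E" for a a' x
    using ring_hom_add[OF hom, of "cl a" "cl a'"] that by (simp add: cl_add End_ring_def)
  have smult: "c (cl (scal r * a)) (ec x) = r \<odot>\<^bsub>tensor_alg E\<^esub> c (cl a) (ec x)"
    if "a \<in> fcar E" "x \<in> fcar E" for a x r
    using c[unfolded is_standard_action_def, THEN conjunct2, THEN conjunct2, THEN conjunct1, rule_format,
        OF cl_closed[OF that(1)] ec_in_ext[OF that(2)], of r] that
    by (simp add: cl_smult)
  have one: "c (cl 1) (ec x) = ec x" if "x \<in> fcar E" for x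
    using ring_hom_one[OF hom] that by (simp add: cl_one End_ring_def)
  have wordc: "c (cl (word u)) (ec x) = ec (cliff_act b (word u) x)" if "set u \<subseteq> carrier E" "x \<in> fcar E" for u x
    using that(1)
  proof (induction u)
    case Nil
    then show ?case using one that by simp
  next
    case (Cons v u)
    then show ?case
      using that by (simp add: word_Cons prod cliff_act_mult gen cliff_act_gen foldr_cliff_op_in)
  qed
  from assms(2) show ?thesis
  proof (induction a rule: fcar_induct)
    case zero
    \<comment> \<open>\<open>ring_hom\<close> records products, sums and the unit only; that zero
      acts as zero is read off from the scalar law at \<open>0 * 1\<close>.\<close>
    have "c (cl (scal 0 * 1)) (ec x) = 0 \<odot>\<^bsub>tensor_alg E\<^esub> c (cl 1) (ec x)"
      using assms(3) by (intro smult) simp_all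
    then show ?case using assms(3) by (simp add: one tc_smult)
  next
    case (word u d)
    then show ?case
      using assms(3) by (simp only: smult wordc fcar_single cliff_act_scal_left ec_smult cliff_act_in)
  next
    case (add a a')
    then show ?case using assms(3) by (simp add: sum cliff_act_add_left ec_add)
  qed
qed

text \<open>Candidates are extensional in both arguments, so agreement on all \<open>cl a\<close>
  and \<open>ec x\<close> is equality; \<open>THE\<close> has the single candidate
  \<open>quot_action\<close>.\<close>

lemma standard_action_eq:
  assumes "a \<in> fcar E" "x \<in> fcar E"
  shows "standard_action E b (cl a) (ec x) = ec (cliff_act b a x)"
proof -
  have "c = quot_action" if c: "is_standard_action E b c" for c
  proof (rule extensionalityI[of _ "carrier (clifford_alg E b)"])
    show "c \<in> extensional (carrier (clifford_alg E b))" using c by (simp add: is_standard_action_def)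
    show "quot_action \<in> extensional (carrier (clifford_alg E b))" by (simp add: quot_action_def)
    fix C assume C: "C \<in> carrier (clifford_alg E b)"
    show "c C = quot_action C"
    proof (rule extensionalityI[of _ "ext_carrier E"])
      have "c C \<in> carrier (End_ring (ext_space E))"
        using c C by (auto simp: is_standard_action_def ring_hom_def)
      then show "c C \<in> extensional (ext_carrier E)" by (simp add: End_ring_def PiE_def)
      show "quot_action C \<in> extensional (ext_carrier E)"
        using quot_action_End[OF C] by (simp add: End_ring_def PiE_def)
      fix e assume "e \<in> ext_carrier E"
      then show "c C e = quot_action C e"
        using C standard_action_unique[OF c] by (auto simp: clifford_carrier ext_carrier_ec quot_action_eq)
    qed
  qed
  then have "\<exists>!c. is_standard_action E b c"
    by (intro ex1I[of _ quot_action]) (auto intro: quot_action_standard)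
  then have "is_standard_action E b (standard_action E b)"
    unfolding standard_action_def by (rule theI')
  then show ?thesis using assms by (rule standard_action_unique)
qed

end

text \<open>The elements whose images under \<open>h\<close> fall into the Clifford ideal of
  \<open>E'\<close> form an ideal \<open>J\<close>, which contains the relators because an isometry
  maps relators to relators. The image of \<open>J\<close> in the tensor algebra then contains the
  Clifford ideal of \<open>E\<close>, so the induced map is well defined.\<close>

lemma clifford_hom_cl:
  assumes "quadratic_space E b" "quadratic_space E' b'" "lin_map E E' h" "a \<in> fcar E"
    and isometry: "\<And>v w. v \<in> carrier E \<Longrightarrow> w \<in> carrier E \<Longrightarrow> b' (h v) (h w) = b v w"
  shows "clifford_hom E' b' h (clifford_class E b (tensor_class E a)) =
    clifford_class E' b' (tensor_class E' (free_map h a))"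
proof -
  interpret E: quadratic_space E b by fact
  interpret E': quadratic_space E' b' by fact
  note R = E.real_vec_space_axioms E'.real_vec_space_axioms assms(3)
  note th = tensor_hom_tc[OF R]
  note fm = fcar_free_map[OF assms(3)]
  have h: "h v \<in> carrier E'" if "v \<in> carrier E" for v using assms(3) that by (auto simp: lin_map_def)
  interpret E'C: ideal "clifford_ideal E' b'" "tensor_alg E'" by (rule E'.clifford_ideal)
  define J where "J = {a \<in> fcar E. E'.tc (free_map h a) \<in> clifford_ideal E' b'}"
  interpret T: alg_ideal "free_alg E" "tensor_ideal E"
    using free.real_alg_axioms E.tensor_ideal by (rule alg_ideal.intro)
  have "ideal J (free_alg E)"
  proof (rule free_idealI)
    show "J \<subseteq> fcar E" by (auto simp: J_def)
    show "0 \<in> J" using E'C.zero_closed by (simp add: J_def E'.tc_zero)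
    show add: "a + a' \<in> J" if "a \<in> J" "a' \<in> J" for a a'
      using that additive_subgroup.a_closed[OF E'C.is_additive_subgroup, of "E'.tc (free_map h a)" "E'.tc (free_map h a')"]
      by (simp add: J_def free_map_add E'.tc_add fm)
    show l: "x * a \<in> J" if "a \<in> J" "x \<in> fcar E" for a x
      using that E'C.I_l_closed[of "E'.tc (free_map h a)" "E'.tc (free_map h x)"]
      by (simp add: J_def free_map_mult E'.tc_mult fm)
    show "- a \<in> J" if "a \<in> J" for a
      using l[OF that, of "- 1"] by simp
    show "a * x \<in> J" if "a \<in> J" "x \<in> fcar E" for a x
      using that E'C.I_r_closed[of "E'.tc (free_map h a)" "E'.tc (free_map h x)"]
      by (simp add: J_def free_map_mult E'.tc_mult fm)
  qed
  then have "ideal (E.tc ` J) (tensor_alg E)"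
    using T.image_ideal[of J] by (simp add: E.qc_tc tensor_alg_def)
  moreover have "E.cliff_rel v w \<in> J" if "v \<in> carrier E" "w \<in> carrier E" for v w
  proof -
    have "free_map h (E.cliff_rel v w) = E'.cliff_rel (h v) (h w)"
      using that isometry by (simp add: E.cliff_rel_def E'.cliff_rel_def free_map_add free_map_word)
    then show ?thesis using E'.clifford_rel_mem h that by (simp add: J_def)
  qed
  ultimately have sub: "clifford_ideal E b \<subseteq> E.tc ` J"
    by (intro E.clifford_ideal_subset) auto
  have key: "E'.tc (free_map h a) \<in> clifford_ideal E' b'" if "a \<in> fcar E" "E.tc a \<in> clifford_ideal E b" for a
  proof -
    from sub that(2) obtain a' where a': "a' \<in> J" "E.tc a = E.tc a'" by blast
    \<comment> \<open>\<open>a\<close> and \<open>a'\<close> have the same tensor class, and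
      \<open>tensor_hom\<close> is already known to be well defined on such classes.\<close>
    then have "E'.tc (free_map h a) = E'.tc (free_map h a')"
      using th[of a] th[of a'] that(1) by (simp add: J_def)
    with a' show ?thesis by (simp add: J_def)
  qed
  have "clifford_hom E' b' h (E.cl a) = clifford_class E' b' (tensor_hom E' h (E.tc a))"
    unfolding clifford_hom_def
  proof (rule E.the_elem_clifford)
    show "E.tc a \<in> carrier (tensor_alg E)" using assms(4) by simp
    fix A' assume A': "A' \<in> carrier (tensor_alg E)" "A' \<ominus>\<^bsub>tensor_alg E\<^esub> E.tc a \<in> clifford_ideal E b"
    then obtain a' where a': "a' \<in> fcar E" "A' = E.tc a'" by (auto simp: E.tensor_carrier)
    have "E'.tc (free_map h (a' - a)) \<in> clifford_ideal E' b'"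
      using A'(2) a' assms(4) by (intro key) (simp_all add: E.tc_minus)
    then show "clifford_class E' b' (tensor_hom E' h A') = clifford_class E' b' (tensor_hom E' h (E.tc a))"
      using a' assms(4) by (simp add: th fm E'.cl_eq_iff free_map_diff)
  qed
  then show ?thesis using assms(4) by (simp add: th)
qed

text \<open>The recursion for contractions involves the form only through the numbers
  \<open>b v x\<close>, which \<open>h\<close> preserves. So \<open>h\<close> intertwines
  contractions, hence the operators d_v, hence their composites.\<close>

lemma free_map_cliff_act:
  assumes "\<And>v w. v \<in> carrier E \<Longrightarrow> w \<in> carrier E \<Longrightarrow> b' (h v) (h w) = b v w"
    and "quadratic_space E b" and "a \<in> fcar E" "x \<in> fcar E"
  shows "free_map h (cliff_act b a x) = cliff_act b' (free_map h a) (free_map h x)"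
proof -
  interpret E: quadratic_space E b by fact
  have contr: "free_map h (contr b v x) = contr b' (h v) (free_map h x)" if v: "v \<in> carrier E" and "x \<in> fcar E" for v x
    using that(2)
  proof (induction x rule: fcar_induct)
    case (word u c)
    then have "free_map h (contr_word b v u) = contr_word b' (h v) (map h u)"
      by (induction u)
        (use assms(1) v in \<open>simp_all add: contr_word_Cons free_map_diff free_map_scal free_map_word free_map_mult free_map_gen\<close>)
    then show ?case
      by (simp only: contr_scal contr_on_word free_map_scal free_map_word)
  qed (simp_all add: contr_add free_map_add)
  have op: "free_map h (cliff_op b v x) = cliff_op b' (h v) (free_map h x)" if "v \<in> carrier E" "x \<in> fcar E" for v x
    using that by (simp add: cliff_op_def free_map_diff free_map_mult free_map_gen contr)
  show ?thesis
    using assms(3)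
  proof (induction a rule: fcar_induct)
    case (word u c)
    then have "free_map h (foldr (cliff_op b) u x) = foldr (cliff_op b') (map h u) (free_map h x)"
      by (induction u) (use assms(4) in \<open>simp_all add: op E.foldr_cliff_op_in\<close>)
    then show ?case
      by (simp add: cliff_act_scal_left free_map_scal free_map_word)
  qed (simp_all add: cliff_act_add_left free_map_add)
qed

text \<open>On representatives both sides become the class of
  \<open>free_map h (cliff_act b a x)\<close>. The membership statement is included because
  \<open>exterior_map\<close> is restricted to exterior elements.\<close>

theorem standard_action_natural:
  assumes "quadratic_space E b" "quadratic_space E' b'" "lin_map E E' h"
    and isometry: "\<And>v w. v \<in> carrier E \<Longrightarrow> w \<in> carrier E \<Longrightarrow> b' (h v) (h w) = b v w"
    and C: "C \<in> carrier (clifford_alg E b)" and e: "e \<in> ext_carrier E"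
  shows "standard_action E b C e \<in> ext_carrier E"
    and "tensor_hom E' h (standard_action E b C e) =
      standard_action E' b' (clifford_hom E' b' h C) (tensor_hom E' h e)"
proof -
  interpret E: quadratic_space E b by fact
  interpret E': quadratic_space E' b' by fact
  obtain a x where a: "a \<in> fcar E" "C = E.cl a" and x: "x \<in> fcar E" "e = E.ec x"
    using C e by (auto simp: E.clifford_carrier E.ext_carrier_ec)
  note th = tensor_hom_tc[OF E.real_vec_space_axioms E'.real_vec_space_axioms assms(3)]
  show "standard_action E b C e \<in> ext_carrier E"
    using a x by (simp add: E.standard_action_eq)
  show "tensor_hom E' h (standard_action E b C e) =
      standard_action E' b' (clifford_hom E' b' h C) (tensor_hom E' h e)"
    using a x fcar_free_map[OF assms(3)]
    by (simp add: E.standard_action_eq th free_map_free_alt clifford_hom_cl[OF assms(1-3) _ isometry]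
        E'.standard_action_eq free_map_cliff_act[where E = E and b = b and b' = b' and h = h, OF isometry assms(1)])
qed

subsection \<open>Transport of structure\<close>

text \<open>The operations of \<open>E'\<close> are expressed by those of \<open>E\<close>, so that
  the vector space laws of \<open>E'\<close> can be derived: a glued fibre inherits them from the
  original fibre.\<close>

definition vs_iso :: "('v \<Rightarrow> 'w) \<Rightarrow> (real, 'v) module \<Rightarrow> (real, 'w) module \<Rightarrow> bool" where
  "vs_iso j E E' \<longleftrightarrow> bij_betw j (carrier E) (carrier E') \<and> \<zero>\<^bsub>E'\<^esub> = j \<zero>\<^bsub>E\<^esub> \<and>
     (\<forall>v\<in>carrier E. \<forall>w\<in>carrier E. j v \<oplus>\<^bsub>E'\<^esub> j w = j (v \<oplus>\<^bsub>E\<^esub> w)) \<and>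
     (\<forall>c. \<forall>v\<in>carrier E. c \<odot>\<^bsub>E'\<^esub> j v = j (c \<odot>\<^bsub>E\<^esub> v))"

lemma ring_of_type_algebra_simps [simp]:
  "carrier ring_of_type_algebra = UNIV" "\<one>\<^bsub>ring_of_type_algebra\<^esub> = 1"
  "a \<oplus>\<^bsub>ring_of_type_algebra\<^esub> b = a + b" "a \<otimes>\<^bsub>ring_of_type_algebra\<^esub> b = a * b"
  by (simp_all add: ring_of_type_algebra_def)

text \<open>Negatives are replaced by the law that 0 times \<open>v\<close> is zero: distributivity
  then makes (-1) times \<open>v\<close> the negative of \<open>v\<close>.\<close>

lemma real_vsI:
  assumes "\<zero>\<^bsub>E\<^esub> \<in> carrier E"
    and "\<And>v w. v \<in> carrier E \<Longrightarrow> w \<in> carrier E \<Longrightarrow> v \<oplus>\<^bsub>E\<^esub> w \<in> carrier E"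
    and "\<And>c v. v \<in> carrier E \<Longrightarrow> c \<odot>\<^bsub>E\<^esub> v \<in> carrier E"
    and "\<And>u v w. u \<in> carrier E \<Longrightarrow> v \<in> carrier E \<Longrightarrow> w \<in> carrier E \<Longrightarrow>
      (u \<oplus>\<^bsub>E\<^esub> v) \<oplus>\<^bsub>E\<^esub> w = u \<oplus>\<^bsub>E\<^esub> (v \<oplus>\<^bsub>E\<^esub> w)"
    and "\<And>v w. v \<in> carrier E \<Longrightarrow> w \<in> carrier E \<Longrightarrow> v \<oplus>\<^bsub>E\<^esub> w = w \<oplus>\<^bsub>E\<^esub> v"
    and "\<And>v. v \<in> carrier E \<Longrightarrow> \<zero>\<^bsub>E\<^esub> \<oplus>\<^bsub>E\<^esub> v = v"
    and "\<And>v. v \<in> carrier E \<Longrightarrow> 0 \<odot>\<^bsub>E\<^esub> v = \<zero>\<^bsub>E\<^esub>"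
    and "\<And>c d v. v \<in> carrier E \<Longrightarrow> (c + d) \<odot>\<^bsub>E\<^esub> v = c \<odot>\<^bsub>E\<^esub> v \<oplus>\<^bsub>E\<^esub> d \<odot>\<^bsub>E\<^esub> v"
    and "\<And>c v w. v \<in> carrier E \<Longrightarrow> w \<in> carrier E \<Longrightarrow> c \<odot>\<^bsub>E\<^esub> (v \<oplus>\<^bsub>E\<^esub> w) = c \<odot>\<^bsub>E\<^esub> v \<oplus>\<^bsub>E\<^esub> c \<odot>\<^bsub>E\<^esub> w"
    and "\<And>c d v. v \<in> carrier E \<Longrightarrow> (c * d) \<odot>\<^bsub>E\<^esub> v = c \<odot>\<^bsub>E\<^esub> (d \<odot>\<^bsub>E\<^esub> v)"
    and "\<And>v. v \<in> carrier E \<Longrightarrow> 1 \<odot>\<^bsub>E\<^esub> v = v"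
  shows "real_vs E"
proof (rule moduleI)
  show "cring (ring_of_type_algebra :: real ring)" by (rule cring_from_type_algebra)
  show "abelian_group E"
  proof (rule abelian_groupI)
    fix v assume v: "v \<in> carrier E"
    have "(- 1) \<odot>\<^bsub>E\<^esub> v \<oplus>\<^bsub>E\<^esub> v = (- 1 + 1) \<odot>\<^bsub>E\<^esub> v"
      using v assms(8)[of v "- 1" 1] assms(11)[of v] by simp
    then show "\<exists>w\<in>carrier E. w \<oplus>\<^bsub>E\<^esub> v = \<zero>\<^bsub>E\<^esub>"
      using v assms(3,7) by (intro bexI[of _ "(- 1) \<odot>\<^bsub>E\<^esub> v"]) simp_all
  qed (use assms in auto)
qed (use assms in simp_all)

lemma real_vsD:
  assumes "real_vs E"
  shows "\<zero>\<^bsub>E\<^esub> \<in> carrier E"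
    and "v \<in> carrier E \<Longrightarrow> w \<in> carrier E \<Longrightarrow> v \<oplus>\<^bsub>E\<^esub> w \<in> carrier E"
    and "v \<in> carrier E \<Longrightarrow> c \<odot>\<^bsub>E\<^esub> v \<in> carrier E"
    and "v \<in> carrier E \<Longrightarrow> 0 \<odot>\<^bsub>E\<^esub> v = \<zero>\<^bsub>E\<^esub>"
proof -
  interpret E: Module.module "ring_of_type_algebra :: real ring" E by fact
  show "\<zero>\<^bsub>E\<^esub> \<in> carrier E" by (rule E.M.zero_closed)
  show "v \<in> carrier E \<Longrightarrow> w \<in> carrier E \<Longrightarrow> v \<oplus>\<^bsub>E\<^esub> w \<in> carrier E" by (rule E.M.a_closed)
  show *: "v \<in> carrier E \<Longrightarrow> c \<odot>\<^bsub>E\<^esub> v \<in> carrier E" for c by (rule E.smult_closed) simp_all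
  assume v: "v \<in> carrier E"
  have "0 \<odot>\<^bsub>E\<^esub> v \<oplus>\<^bsub>E\<^esub> 0 \<odot>\<^bsub>E\<^esub> v = 0 \<odot>\<^bsub>E\<^esub> v"
    using E.smult_l_distr[of 0 0 v] v by simp
  then show "0 \<odot>\<^bsub>E\<^esub> v = \<zero>\<^bsub>E\<^esub>"
    using E.M.r_neg1[OF *[OF v, of 0] *[OF v, of 0]] E.M.l_neg[OF *[OF v, of 0]] by simp
qed

lemma vs_iso_real_vs:
  assumes "vs_iso j E E'" and "real_vs E"
  shows "real_vs E'"
proof -
  interpret E: Module.module "ring_of_type_algebra :: real ring" E by fact
  have car: "carrier E' = j ` carrier E" using assms(1) by (auto simp: vs_iso_def bij_betw_def)
  have ops: "\<zero>\<^bsub>E'\<^esub> = j \<zero>\<^bsub>E\<^esub>"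
    "\<And>v w. v \<in> carrier E \<Longrightarrow> w \<in> carrier E \<Longrightarrow> j v \<oplus>\<^bsub>E'\<^esub> j w = j (v \<oplus>\<^bsub>E\<^esub> w)"
    "\<And>c v. v \<in> carrier E \<Longrightarrow> c \<odot>\<^bsub>E'\<^esub> j v = j (c \<odot>\<^bsub>E\<^esub> v)"
    using assms(1) by (simp_all add: vs_iso_def)
  note D = real_vsD[OF assms(2)]
  show ?thesis
  proof (rule real_vsI)
    fix c d and v assume "v \<in> carrier E'"
    then obtain v' where v': "v' \<in> carrier E" "v = j v'" by (auto simp: car)
    show "(c + d) \<odot>\<^bsub>E'\<^esub> v = c \<odot>\<^bsub>E'\<^esub> v \<oplus>\<^bsub>E'\<^esub> d \<odot>\<^bsub>E'\<^esub> v"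
      using v' D E.smult_l_distr[of c d v'] by (simp add: ops)
    show "(c * d) \<odot>\<^bsub>E'\<^esub> v = c \<odot>\<^bsub>E'\<^esub> (d \<odot>\<^bsub>E'\<^esub> v)"
      using v' D E.smult_assoc1[of c d v'] by (simp add: ops)
    show "1 \<odot>\<^bsub>E'\<^esub> v = v"
      using v' E.smult_one[of v'] by (simp add: ops)
  next
    fix c v w assume "v \<in> carrier E'" "w \<in> carrier E'"
    then obtain v' w' where "v' \<in> carrier E" "v = j v'" "w' \<in> carrier E" "w = j w'" by (auto simp: car)
    then show "c \<odot>\<^bsub>E'\<^esub> (v \<oplus>\<^bsub>E'\<^esub> w) = c \<odot>\<^bsub>E'\<^esub> v \<oplus>\<^bsub>E'\<^esub> c \<odot>\<^bsub>E'\<^esub> w"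
      using D E.smult_r_distr[of c v' w'] by (simp add: ops)
  qed (use D in \<open>auto simp: car ops E.M.a_ac\<close>)
qed

lemma vs_iso_in: "vs_iso j E E' \<Longrightarrow> v \<in> carrier E \<Longrightarrow> j v \<in> carrier E'"
  by (auto simp: vs_iso_def bij_betw_def)

lemma vs_iso_quadratic_space:
  assumes "vs_iso j E E'" and "quadratic_space E b"
    and "\<And>v w. v \<in> carrier E \<Longrightarrow> w \<in> carrier E \<Longrightarrow> b' (j v) (j w) = b v w"
  shows "quadratic_space E' b'"
proof -
  interpret E: quadratic_space E b by fact
  have car: "carrier E' = j ` carrier E" using assms(1) by (auto simp: vs_iso_def bij_betw_def)
  have ops: "\<And>v w. v \<in> carrier E \<Longrightarrow> w \<in> carrier E \<Longrightarrow> j v \<oplus>\<^bsub>E'\<^esub> j w = j (v \<oplus>\<^bsub>E\<^esub> w)"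
    "\<And>c v. v \<in> carrier E \<Longrightarrow> c \<odot>\<^bsub>E'\<^esub> j v = j (c \<odot>\<^bsub>E\<^esub> v)"
    using assms(1) by (simp_all add: vs_iso_def)
  show ?thesis
  proof (intro quadratic_space.intro real_vec_space.intro quadratic_space_axioms.intro)
    show "real_vs E'" using assms(1) E.real_vs by (rule vs_iso_real_vs)
  qed (auto simp: car ops assms(3) E.b_add E.b_smult E.b_sym)
qed

subsection \<open>Glued spaces\<close>

text \<open>A normal form that moves points of \<open>Y\<close> to the second space. Comparing
  normal forms replaces the closure \<open>equivclp\<close> by an equation.\<close>

definition glue_canon :: "'a set \<Rightarrow> ('a \<Rightarrow> 'b) \<Rightarrow> 'a + 'b \<Rightarrow> 'a + 'b" where
  "glue_canon Y h s = (case s of Inl z \<Rightarrow> if z \<in> Y then Inr (h z) else Inl z | Inr w \<Rightarrow> Inr w)"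

lemma glue_canon_simps [simp]:
  "glue_canon Y h (Inr w) = Inr w" "glue_canon Y h (Inl z) = (if z \<in> Y then Inr (h z) else Inl z)"
  by (simp_all add: glue_canon_def)

text \<open>A generating step does not change the normal form, and every point is linked to its
  normal form by at most one such step.\<close>

lemma equivclp_glue:
  "equivclp (\<lambda>s t. \<exists>z\<in>Y. s = Inl z \<and> t = Inr (h z)) s t \<longleftrightarrow> glue_canon Y h s = glue_canon Y h t"
  (is "equivclp ?R s t \<longleftrightarrow> _")
proof
  assume "equivclp ?R s t"
  then show "glue_canon Y h s = glue_canon Y h t"
    by (induction rule: equivclp_induct) auto
next
  have canon: "equivclp ?R s (glue_canon Y h s)" for s
  proof (cases s)
    case (Inl z)
    then show ?thesis by (cases "z \<in> Y") (simp_all add: r_into_equivclp)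
  qed simp
  assume "glue_canon Y h s = glue_canon Y h t"
  with canon[of s] have "equivclp ?R s (glue_canon Y h t)" by simp
  then show "equivclp ?R s t"
    using equivclp_sym[OF canon[of t]] by (rule equivclp_trans)
qed

lemma glue_class_canon:
  "glue_class D1 D2 Y h s = {t \<in> points D1 <+> points D2. glue_canon Y h s = glue_canon Y h t}"
  by (simp add: glue_class_def equivclp_glue)

lemma glue_class_eq_iff:
  assumes "s \<in> points D1 <+> points D2" "t \<in> points D1 <+> points D2"
  shows "glue_class D1 D2 Y h s = glue_class D1 D2 Y h t \<longleftrightarrow> glue_canon Y h s = glue_canon Y h t"
proof
  assume "glue_class D1 D2 Y h s = glue_class D1 D2 Y h t"
  moreover have "s \<in> glue_class D1 D2 Y h s" using assms(1) by (simp add: glue_class_canon)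
  ultimately show "glue_canon Y h s = glue_canon Y h t" by (simp add: glue_class_canon)
qed (simp add: glue_class_canon)

lemma glue_class_simps:
  "z \<in> points D1 \<Longrightarrow> z' \<in> points D1 \<Longrightarrow>
    glue_class D1 D2 Y h (Inl z) = glue_class D1 D2 Y h (Inl z') \<longleftrightarrow> z = z' \<or> z \<in> Y \<and> z' \<in> Y \<and> h z = h z'"
  "w \<in> points D2 \<Longrightarrow> w' \<in> points D2 \<Longrightarrow>
    glue_class D1 D2 Y h (Inr w) = glue_class D1 D2 Y h (Inr w') \<longleftrightarrow> w = w'"
  "z \<in> points D1 \<Longrightarrow> w \<in> points D2 \<Longrightarrow>
    glue_class D1 D2 Y h (Inl z) = glue_class D1 D2 Y h (Inr w) \<longleftrightarrow> z \<in> Y \<and> h z = w"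
  by (subst glue_class_eq_iff; auto)+

lemma fibre_simps [simp]:
  "carrier (fibre V x) = {v \<in> points (total V). proj V v = x}" "add (fibre V x) = fplus V"
  "smult (fibre V x) = fscale V" "ring.zero (fibre V x) = fzero V x"
  by (simp_all add: fibre_def)

abbreviation vecs :: "('v, 'x) vbundle \<Rightarrow> 'x \<Rightarrow> 'v set" where
  "vecs V x \<equiv> carrier (fibre V x)"

text \<open>The pointwise algebraic content of a gluing. It is instantiated for \<open>G\<close> and
  again for \<open>dual_gluing G\<close>, so the same facts describe the fibres of both glued
  pseudo-bundles.\<close>

locale fibre_gluing =
  fixes G :: "('v, 'x, 'w, 'y) gluing"
  assumes src_proj: "v \<in> points (total (src G)) \<Longrightarrow> proj (src G) v \<in> points (base (src G))"
    and tgt_proj: "w \<in> points (total (tgt G)) \<Longrightarrow> proj (tgt G) w \<in> points (base (tgt G))"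
    and locus_sub: "locus G \<subseteq> points (base (src G))"
    and bmap_in: "x \<in> locus G \<Longrightarrow> bmap G x \<in> points (base (tgt G))"
    and src_vs: "x \<in> points (base (src G)) \<Longrightarrow> real_vs (fibre (src G) x)"
    and tgt_vs: "y \<in> points (base (tgt G)) \<Longrightarrow> real_vs (fibre (tgt G) y)"
    and tmap_lin: "x \<in> locus G \<Longrightarrow> lin_map (fibre (src G) x) (fibre (tgt G) (bmap G x)) (tmap G)"
begin

abbreviation "src_pts \<equiv> points (total (src G))"
abbreviation "tgt_pts \<equiv> points (total (tgt G))"
abbreviation "src_base \<equiv> points (base (src G))"
abbreviation "tgt_base \<equiv> points (base (tgt G))"

lemma tmap_in: "v \<in> src_pts \<Longrightarrow> proj (src G) v \<in> locus G \<Longrightarrow> tmap G v \<in> tgt_pts"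
  and proj_tmap: "v \<in> src_pts \<Longrightarrow> proj (src G) v \<in> locus G \<Longrightarrow>
    proj (tgt G) (tmap G v) = bmap G (proj (src G) v)"
  using tmap_lin[of "proj (src G) v"] by (auto simp: lin_map_def del: equalityI)

lemma j1_eq_j1_iff: "v \<in> src_pts \<Longrightarrow> v' \<in> src_pts \<Longrightarrow>
    j1 G v = j1 G v' \<longleftrightarrow> v = v' \<or> proj (src G) v \<in> locus G \<and> proj (src G) v' \<in> locus G \<and> tmap G v = tmap G v'"
  by (simp add: j1_def glue_class_simps preim_def)

lemma j2_eq_j2_iff: "w \<in> tgt_pts \<Longrightarrow> w' \<in> tgt_pts \<Longrightarrow> j2 G w = j2 G w' \<longleftrightarrow> w = w'"
  by (simp add: j2_def glue_class_simps)

lemma j1_eq_j2_iff: "v \<in> src_pts \<Longrightarrow> w \<in> tgt_pts \<Longrightarrow>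
    j1 G v = j2 G w \<longleftrightarrow> proj (src G) v \<in> locus G \<and> tmap G v = w"
  by (simp add: j1_def j2_def glue_class_simps preim_def)

lemma i1_eq_i1_iff: "x \<in> src_base \<Longrightarrow> x' \<in> src_base \<Longrightarrow>
    i1 G x = i1 G x' \<longleftrightarrow> x = x' \<or> x \<in> locus G \<and> x' \<in> locus G \<and> bmap G x = bmap G x'"
  by (simp add: i1_def glue_class_simps)

lemma i2_eq_i2_iff: "y \<in> tgt_base \<Longrightarrow> y' \<in> tgt_base \<Longrightarrow> i2 G y = i2 G y' \<longleftrightarrow> y = y'"
  by (simp add: i2_def glue_class_simps)

lemma i1_eq_i2_iff: "x \<in> src_base \<Longrightarrow> y \<in> tgt_base \<Longrightarrow>
    i1 G x = i2 G y \<longleftrightarrow> x \<in> locus G \<and> bmap G x = y"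
  by (simp add: i1_def i2_def glue_class_simps)

lemma i1_locus: "x \<in> locus G \<Longrightarrow> i1 G x = i2 G (bmap G x)"
  using i1_eq_i2_iff[of x "bmap G x"] locus_sub bmap_in by blast

lemma total_glued_points: "points (total (glued G)) = j1 G ` src_pts \<union> j2 G ` tgt_pts"
  by (auto simp: glued_def glue_space_def quotient_space_def sum_space_def j1_def j2_def image_iff Bex_def)

lemma base_glued_points: "points (base (glued G)) = i1 G ` src_base \<union> i2 G ` tgt_base"
  by (auto simp: glued_def glue_space_def quotient_space_def sum_space_def i1_def i2_def image_iff Bex_def)

lemma base_glued_cases:
  assumes "P \<in> points (base (glued G))"
  obtains (off) x where "x \<in> src_base" "x \<notin> locus G" "P = i1 G x"
    | (on) y where "y \<in> tgt_base" "P = i2 G y"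
  using assms locus_sub bmap_in i1_eq_i2_iff unfolding base_glued_points by blast

text \<open>The description in \<open>glued\<close> may be met by several representatives of one
  class; the two auxiliary facts show that they give the same base class, because
  \<open>tmap G\<close> covers \<open>bmap G\<close>. Scaling and zero follow the same
  pattern.\<close>

lemma proj_glued_j1: "v \<in> src_pts \<Longrightarrow> proj (glued G) (j1 G v) = i1 G (proj (src G) v)"
  and proj_glued_j2: "w \<in> tgt_pts \<Longrightarrow> proj (glued G) (j2 G w) = i2 G (proj (tgt G) w)"
proof -
  have 1: "i1 G (proj (src G) v) = i2 G (proj (tgt G) w)"
    if "v \<in> src_pts" "w \<in> tgt_pts" "j1 G v = j2 G w" for v w
    using that proj_tmap[of v] by (auto simp: j1_eq_j2_iff i1_locus del: equalityI)
  have 2: "i1 G (proj (src G) v) = i1 G (proj (src G) v')"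
    if "v \<in> src_pts" "v' \<in> src_pts" "j1 G v = j1 G v'" for v v'
    using that proj_tmap[of v] proj_tmap[of v'] by (auto simp: j1_eq_j1_iff i1_locus del: equalityI)
  show "v \<in> src_pts \<Longrightarrow> proj (glued G) (j1 G v) = i1 G (proj (src G) v)"
    unfolding glued_def vbundle.simps
    by (rule the_equality) (auto dest: 1 2 del: equalityI)
  show "w \<in> tgt_pts \<Longrightarrow> proj (glued G) (j2 G w) = i2 G (proj (tgt G) w)"
    unfolding glued_def vbundle.simps
    by (rule the_equality) (auto dest: 1 simp: j2_eq_j2_iff del: equalityI)
qed

lemma tmap_fplus: "v \<in> vecs (src G) x \<Longrightarrow> v' \<in> vecs (src G) x \<Longrightarrow> x \<in> locus G \<Longrightarrow>
    tmap G (fplus (src G) v v') = fplus (tgt G) (tmap G v) (tmap G v')"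
  and tmap_fscale: "v \<in> vecs (src G) x \<Longrightarrow> x \<in> locus G \<Longrightarrow>
    tmap G (fscale (src G) c v) = fscale (tgt G) c (tmap G v)"
  using tmap_lin[of x] by (auto simp: lin_map_def del: equalityI)

text \<open>\<open>lin_map\<close> does not mention zero; the zero vector is written as 0 times
  itself.\<close>

lemma tmap_fzero: "x \<in> locus G \<Longrightarrow> tmap G (fzero (src G) x) = fzero (tgt G) (bmap G x)"
proof -
  assume x: "x \<in> locus G"
  note s = real_vsD[OF src_vs, of x] and t = real_vsD[OF tgt_vs, of "bmap G x"]
  have z: "fzero (src G) x \<in> vecs (src G) x" using s(1) x locus_sub by (auto del: equalityI)
  have "tmap G (fscale (src G) 0 (fzero (src G) x)) = fscale (tgt G) 0 (tmap G (fzero (src G) x))"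
    using tmap_fscale[OF z x] .
  then show ?thesis
    using s(4)[of "fzero (src G) x"] t(4)[of "tmap G (fzero (src G) x)"] z x locus_sub bmap_in tmap_in proj_tmap
    by (auto del: equalityI)
qed

lemma src_fibre_closed:
  "v \<in> src_pts \<Longrightarrow> v' \<in> src_pts \<Longrightarrow> proj (src G) v = x \<Longrightarrow> proj (src G) v' = x \<Longrightarrow>
    fplus (src G) v v' \<in> src_pts \<and> proj (src G) (fplus (src G) v v') = x"
  "v \<in> src_pts \<Longrightarrow>
    fscale (src G) c v \<in> src_pts \<and> proj (src G) (fscale (src G) c v) = proj (src G) v"
  "x \<in> src_base \<Longrightarrow> fzero (src G) x \<in> src_pts \<and> proj (src G) (fzero (src G) x) = x"
  using real_vsD[OF src_vs, of x] real_vsD[OF src_vs[OF src_proj], of v] src_proj[of v] by (auto del: equalityI)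

lemma tgt_fibre_closed:
  "v \<in> tgt_pts \<Longrightarrow> v' \<in> tgt_pts \<Longrightarrow> proj (tgt G) v = x' \<Longrightarrow> proj (tgt G) v' = x' \<Longrightarrow>
    fplus (tgt G) v v' \<in> tgt_pts \<and> proj (tgt G) (fplus (tgt G) v v') = x'"
  "v \<in> tgt_pts \<Longrightarrow>
    fscale (tgt G) c v \<in> tgt_pts \<and> proj (tgt G) (fscale (tgt G) c v) = proj (tgt G) v"
  "x' \<in> tgt_base \<Longrightarrow> fzero (tgt G) x' \<in> tgt_pts \<and> proj (tgt G) (fzero (tgt G) x') = x'"
  using real_vsD[OF tgt_vs, of x'] real_vsD[OF tgt_vs[OF tgt_proj], of v] tgt_proj[of v] by (auto del: equalityI)

lemma fscale_glued_j1: "v \<in> src_pts \<Longrightarrow> fscale (glued G) c (j1 G v) = j1 G (fscale (src G) c v)"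
  and fscale_glued_j2: "w \<in> tgt_pts \<Longrightarrow> fscale (glued G) c (j2 G w) = j2 G (fscale (tgt G) c w)"
proof -
  have 1: "j1 G (fscale (src G) c v) = j2 G (fscale (tgt G) c w)"
    if "v \<in> src_pts" "w \<in> tgt_pts" "j1 G v = j2 G w" for v w
    using that src_fibre_closed(2)[of v c] tgt_fibre_closed(2)[of w c] tmap_fscale[of v "proj (src G) v" c]
    by (auto simp: j1_eq_j2_iff del: equalityI)
  have 2: "j1 G (fscale (src G) c v) = j1 G (fscale (src G) c v')"
    if "v \<in> src_pts" "v' \<in> src_pts" "j1 G v = j1 G v'" for v v'
    using that src_fibre_closed(2)[of v c] src_fibre_closed(2)[of v' c]
      tmap_fscale[of v "proj (src G) v" c] tmap_fscale[of v' "proj (src G) v'" c]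
    by (auto simp: j1_eq_j1_iff del: equalityI)
  show "v \<in> src_pts \<Longrightarrow> fscale (glued G) c (j1 G v) = j1 G (fscale (src G) c v)"
    unfolding glued_def vbundle.simps by (rule the_equality) (auto dest: 1 2)
  show "w \<in> tgt_pts \<Longrightarrow> fscale (glued G) c (j2 G w) = j2 G (fscale (tgt G) c w)"
    unfolding glued_def vbundle.simps by (rule the_equality) (auto dest: 1 simp: j2_eq_j2_iff)
qed

lemma fzero_glued_i1: "x \<in> src_base \<Longrightarrow> fzero (glued G) (i1 G x) = j1 G (fzero (src G) x)"
  and fzero_glued_i2: "y \<in> tgt_base \<Longrightarrow> fzero (glued G) (i2 G y) = j2 G (fzero (tgt G) y)"
proof -
  have 1: "j1 G (fzero (src G) x) = j2 G (fzero (tgt G) y)"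
    if "x \<in> src_base" "y \<in> tgt_base" "i1 G x = i2 G y" for x y
    using that src_fibre_closed(3)[of x] tgt_fibre_closed(3)[of y] tmap_fzero[of x]
    by (auto simp: j1_eq_j2_iff i1_eq_i2_iff del: equalityI)
  have 2: "j1 G (fzero (src G) x) = j1 G (fzero (src G) x')"
    if "x \<in> src_base" "x' \<in> src_base" "i1 G x = i1 G x'" for x x'
    using that src_fibre_closed(3)[of x] src_fibre_closed(3)[of x'] tmap_fzero[of x] tmap_fzero[of x']
    by (auto simp: j1_eq_j1_iff i1_eq_i1_iff del: equalityI)
  show "x \<in> src_base \<Longrightarrow> fzero (glued G) (i1 G x) = j1 G (fzero (src G) x)"
    unfolding glued_def vbundle.simps by (rule the_equality) (auto dest: 1 2)
  show "y \<in> tgt_base \<Longrightarrow> fzero (glued G) (i2 G y) = j2 G (fzero (tgt G) y)"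
    unfolding glued_def vbundle.simps by (rule the_equality) (auto dest: 1 simp: i2_eq_i2_iff)
qed

text \<open>A glued vector over the image of the locus may also come from several source vectors, as
  \<open>tmap G\<close> may fail to be injective. Any two of them in one source fibre map to
  \<open>w\<close> and \<open>w'\<close>, and linearity makes their sum agree with the sum of
  these.\<close>

lemma fplus_glued_j2:
  assumes w: "w \<in> tgt_pts" "w' \<in> tgt_pts" "proj (tgt G) w = proj (tgt G) w'"
  shows "fplus (glued G) (j2 G w) (j2 G w') = j2 G (fplus (tgt G) w w')"
proof -
  have 1: "j1 G (fplus (src G) v v') = j2 G (fplus (tgt G) w w')"
    if "v \<in> vecs (src G) x" "v' \<in> vecs (src G) x" "j2 G w = j1 G v" "j2 G w' = j1 G v'" for v v' x
  proof -
    have "x \<in> locus G" "tmap G v = w" "tmap G v' = w'"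
      using that w j1_eq_j2_iff by (metis (mono_tags, lifting) fibre_simps(1) mem_Collect_eq)+
    then show ?thesis
      using that w src_fibre_closed(1)[of v v' x] tgt_fibre_closed(1)[of w w'] tmap_fplus[of v x v']
      by (auto simp: j1_eq_j2_iff del: equalityI)
  qed
  show ?thesis
    unfolding glued_def vbundle.simps
  proof (rule the_equality)
    show "(\<exists>x. \<exists>v\<in>vecs (src G) x. \<exists>v'\<in>vecs (src G) x.
          j2 G w = j1 G v \<and> j2 G w' = j1 G v' \<and> j2 G (fplus (tgt G) w w') = j1 G (fplus (src G) v v')) \<or>
       (\<exists>x. \<exists>v\<in>vecs (tgt G) x. \<exists>v'\<in>vecs (tgt G) x.
          j2 G w = j2 G v \<and> j2 G w' = j2 G v' \<and> j2 G (fplus (tgt G) w w') = j2 G (fplus (tgt G) v v'))"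
      using w by (intro disjI2 exI[of _ "proj (tgt G) w"] bexI[of _ w] bexI[of _ w']) simp_all
  qed (elim disjE exE bexE conjE, metis 1, use w in \<open>auto simp: j2_eq_j2_iff del: equalityI\<close>)
qed

text \<open>Off the locus \<open>j1 G\<close> identifies nothing and meets no class of the target,
  so the description has a single candidate.\<close>

lemma fplus_glued_j1:
  assumes v: "v \<in> src_pts" "v' \<in> src_pts" "proj (src G) v = proj (src G) v'"
    and off: "proj (src G) v \<notin> locus G"
  shows "fplus (glued G) (j1 G v) (j1 G v') = j1 G (fplus (src G) v v')"
  unfolding glued_def vbundle.simps
proof (rule the_equality)
  show "(\<exists>x. \<exists>u\<in>vecs (src G) x. \<exists>u'\<in>vecs (src G) x.
        j1 G v = j1 G u \<and> j1 G v' = j1 G u' \<and> j1 G (fplus (src G) v v') = j1 G (fplus (src G) u u')) \<or>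
     (\<exists>x. \<exists>u\<in>vecs (tgt G) x. \<exists>u'\<in>vecs (tgt G) x.
        j1 G v = j2 G u \<and> j1 G v' = j2 G u' \<and> j1 G (fplus (src G) v v') = j2 G (fplus (tgt G) u u'))"
    using v by (intro disjI1 exI[of _ "proj (src G) v"] bexI[of _ v] bexI[of _ v']) simp_all
qed (use v off in \<open>auto simp: j1_eq_j1_iff j1_eq_j2_iff del: equalityI\<close>)

text \<open>Source vectors over the locus add nothing to the fibre: each is glued to its image under
  \<open>tmap G\<close>. So the fibre is a copy of the target fibre even when \<open>y\<close> lies
  in the image of the locus.\<close>

lemma vs_iso_j2: "y \<in> tgt_base \<Longrightarrow> vs_iso (j2 G) (fibre (tgt G) y) (fibre (glued G) (i2 G y))"
  unfolding vs_iso_def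
proof (intro conjI ballI allI)
  assume y: "y \<in> tgt_base"
  show "bij_betw (j2 G) (vecs (tgt G) y) (vecs (glued G) (i2 G y))"
    unfolding bij_betw_def
  proof
    show "inj_on (j2 G) (vecs (tgt G) y)" by (auto simp: inj_on_def j2_eq_j2_iff del: equalityI)
    show "j2 G ` vecs (tgt G) y = vecs (glued G) (i2 G y)"
    proof
      show "j2 G ` vecs (tgt G) y \<subseteq> vecs (glued G) (i2 G y)"
        by (auto simp: total_glued_points proj_glued_j2)
      show "vecs (glued G) (i2 G y) \<subseteq> j2 G ` vecs (tgt G) y"
      proof
        fix A assume "A \<in> vecs (glued G) (i2 G y)"
        then consider v where "v \<in> src_pts" "A = j1 G v" "i1 G (proj (src G) v) = i2 G y"
          | w where "w \<in> tgt_pts" "A = j2 G w" "i2 G (proj (tgt G) w) = i2 G y"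
          by (auto simp: total_glued_points proj_glued_j1 proj_glued_j2)
        then show "A \<in> j2 G ` vecs (tgt G) y"
        proof cases
          case 1
          then have "proj (src G) v \<in> locus G" "bmap G (proj (src G) v) = y"
            using y by (simp_all add: i1_eq_i2_iff src_proj)
          with 1 have "A = j2 G (tmap G v)" "tmap G v \<in> vecs (tgt G) y"
            by (simp_all add: j1_eq_j2_iff tmap_in proj_tmap)
          then show ?thesis by blast
        qed (use y in \<open>auto simp: i2_eq_i2_iff tgt_proj del: equalityI\<close>)
      qed
    qed
  qed
qed (auto simp: fzero_glued_i2 fplus_glued_j2 fscale_glued_j2 del: equalityI)

lemma vs_iso_j1:
  "x \<in> src_base \<Longrightarrow> x \<notin> locus G \<Longrightarrow> vs_iso (j1 G) (fibre (src G) x) (fibre (glued G) (i1 G x))"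
  unfolding vs_iso_def
proof (intro conjI ballI allI)
  assume x: "x \<in> src_base" "x \<notin> locus G"
  show "bij_betw (j1 G) (vecs (src G) x) (vecs (glued G) (i1 G x))"
    unfolding bij_betw_def
  proof
    show "inj_on (j1 G) (vecs (src G) x)" using x by (auto simp: inj_on_def j1_eq_j1_iff del: equalityI)
    show "j1 G ` vecs (src G) x = vecs (glued G) (i1 G x)"
    proof
      show "j1 G ` vecs (src G) x \<subseteq> vecs (glued G) (i1 G x)"
        by (auto simp: total_glued_points proj_glued_j1)
      show "vecs (glued G) (i1 G x) \<subseteq> j1 G ` vecs (src G) x"
      proof
        fix A assume "A \<in> vecs (glued G) (i1 G x)"
        then consider v where "v \<in> src_pts" "A = j1 G v" "i1 G (proj (src G) v) = i1 G x"
          | w where "w \<in> tgt_pts" "A = j2 G w" "i1 G x = i2 G (proj (tgt G) w)"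
          by (auto simp: total_glued_points proj_glued_j1 proj_glued_j2)
        then show "A \<in> j1 G ` vecs (src G) x"
          using x by cases (auto simp: i1_eq_i1_iff i1_eq_i2_iff src_proj tgt_proj del: equalityI)
      qed
    qed
  qed
qed (auto simp: fzero_glued_i1 fplus_glued_j1 fscale_glued_j1 del: equalityI)

lemma i1_inv_i1: "x \<in> src_base \<Longrightarrow> x \<notin> locus G \<Longrightarrow> i1_inv G (i1 G x) = x"
  unfolding i1_inv_def by (rule inv_into_f_f) (auto simp: inj_on_def i1_eq_i1_iff del: equalityI)

lemma i2_inv_i2: "y \<in> tgt_base \<Longrightarrow> i2_inv G (i2 G y) = y"
  unfolding i2_inv_def by (rule inv_into_f_f) (auto simp: inj_on_def i2_eq_i2_iff del: equalityI)

lemma j1_inv_j1: "v \<in> src_pts \<Longrightarrow> proj (src G) v \<notin> locus G \<Longrightarrow> j1_inv G (j1 G v) = v"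
  unfolding j1_inv_def by (rule inv_into_f_f) (auto simp: inj_on_def j1_eq_j1_iff preim_def del: equalityI)

lemma j2_inv_j2: "w \<in> tgt_pts \<Longrightarrow> j2_inv G (j2 G w) = w"
  unfolding j2_inv_def by (rule inv_into_f_f) (auto simp: inj_on_def j2_eq_j2_iff del: equalityI)

lemma glue_metric_i1: "x \<in> src_base \<Longrightarrow> x \<notin> locus G \<Longrightarrow>
    v \<in> vecs (src G) x \<Longrightarrow> v' \<in> vecs (src G) x \<Longrightarrow>
    glue_metric G m1 m2 (i1 G x) (j1 G v) (j1 G v') = m1 x v v'"
  by (auto simp: glue_metric_def i1_inv_i1 j1_inv_j1 del: equalityI)

lemma i2_not_off: "y \<in> tgt_base \<Longrightarrow> i2 G y \<notin> i1 G ` (src_base - locus G)"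
proof
  assume y: "y \<in> tgt_base" and "i2 G y \<in> i1 G ` (src_base - locus G)"
  then obtain x where x: "x \<in> src_base" "x \<notin> locus G" "i1 G x = i2 G y"
    by (auto simp: eq_commute[of _ "i2 G y"] del: equalityI)
  then show False using y by (simp add: i1_eq_i2_iff)
qed

lemma glue_metric_i2: "y \<in> tgt_base \<Longrightarrow>
    w \<in> vecs (tgt G) y \<Longrightarrow> w' \<in> vecs (tgt G) y \<Longrightarrow>
    glue_metric G m1 m2 (i2 G y) (j2 G w) (j2 G w') = m2 y w w'"
  by (simp add: glue_metric_def i2_not_off i2_inv_i2 j2_inv_j2)

end

subsection \<open>Smooth functions\<close>

lemma Ck_on_const: "Ck_on k n U (\<lambda>_. c)"
proof (induction k arbitrary: c)
  case (Suc k)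
  have "\<exists>f'. (\<forall>x\<in>U. ((\<lambda>t. c) has_real_derivative f' x) (at (x i))) \<and> Ck_on k n U f'" for i
    using Suc[of 0] by (intro exI[of _ "\<lambda>_. 0"]) simp
  then show ?case by simp
qed simp

lemma Ck_on_add: "Ck_on k n U f \<Longrightarrow> Ck_on k n U g \<Longrightarrow> Ck_on k n U (\<lambda>x. f x + g x)"
proof (induction k arbitrary: f g)
  case (Suc k)
  have "\<exists>h'. (\<forall>x\<in>U. ((\<lambda>t. f (x(i := t)) + g (x(i := t))) has_real_derivative h' x) (at (x i))) \<and> Ck_on k n U h'"
    if i: "i < n" for i
  proof -
    from Suc.prems(1) i obtain f' where
      f': "\<forall>x\<in>U. ((\<lambda>t. f (x(i := t))) has_real_derivative f' x) (at (x i))" "Ck_on k n U f'"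
      by auto
    from Suc.prems(2) i obtain g' where
      g': "\<forall>x\<in>U. ((\<lambda>t. g (x(i := t))) has_real_derivative g' x) (at (x i))" "Ck_on k n U g'"
      by auto
    show ?thesis
      using f' g' Suc.IH by (intro exI[of _ "\<lambda>x. f' x + g' x"]) (auto intro!: DERIV_add)
  qed
  then show ?case using Suc.prems by (auto intro: continuous_on_add)
qed (simp add: continuous_on_add)

lemma Ck_on_cmult: "Ck_on k n U f \<Longrightarrow> Ck_on k n U (\<lambda>x. c * f x)"
proof (induction k arbitrary: f)
  case (Suc k)
  have "\<exists>h'. (\<forall>x\<in>U. ((\<lambda>t. c * f (x(i := t))) has_real_derivative h' x) (at (x i))) \<and> Ck_on k n U h'"
    if i: "i < n" for i
  proof -
    from Suc.prems i obtain f' where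
      f': "\<forall>x\<in>U. ((\<lambda>t. f (x(i := t))) has_real_derivative f' x) (at (x i))" "Ck_on k n U f'"
      by auto
    show ?thesis
      using f' Suc.IH by (intro exI[of _ "\<lambda>x. c * f' x"]) (auto intro!: DERIV_cmult)
  qed
  then show ?case using Suc.prems by (auto intro: continuous_on_mult_left)
qed (simp add: continuous_on_mult_left)

text \<open>Behind the vector space structure of dual fibres: smooth functionals are closed under
  sums and multiples.\<close>

lemma smooth_fun_add: "smooth_fun n U f \<Longrightarrow> smooth_fun n U g \<Longrightarrow> smooth_fun n U (\<lambda>x. f x + g x)"
  and smooth_fun_cmult: "smooth_fun n U f \<Longrightarrow> smooth_fun n U (\<lambda>x. c * f x)"
  and smooth_fun_const: "smooth_fun n U (\<lambda>_. c)"
  by (simp_all add: smooth_fun_def Ck_on_add Ck_on_cmult Ck_on_const)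

subsection \<open>Spaces of functions\<close>

definition fun_subspace :: "('v \<Rightarrow> real) set \<Rightarrow> bool" where
  "fun_subspace S \<longleftrightarrow> (\<lambda>_. 0) \<in> S \<and> (\<forall>\<phi>\<in>S. \<forall>\<psi>\<in>S. (\<lambda>v. \<phi> v + \<psi> v) \<in> S) \<and> (\<forall>c. \<forall>\<phi>\<in>S. (\<lambda>v. c * \<phi> v) \<in> S)"

text \<open>Describes a dual fibre, whose functionals carry their base point, and equally that
  record with its carrier cut down to the image of \<open>flat\<close>; the two are later compared
  by dimension.\<close>

definition fun_module :: "'x \<Rightarrow> ('v \<Rightarrow> real) set \<Rightarrow> (real, 'x \<times> ('v \<Rightarrow> real)) module \<Rightarrow> bool" where
  "fun_module x S E \<longleftrightarrow> carrier E = {x} \<times> S \<and> \<zero>\<^bsub>E\<^esub> = (x, \<lambda>_. 0) \<and>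
     add E = (\<lambda>\<xi> \<eta>. (fst \<xi>, \<lambda>v. snd \<xi> v + snd \<eta> v)) \<and>
     smult E = (\<lambda>c \<xi>. (fst \<xi>, \<lambda>v. c * snd \<xi> v))"

lemma fun_module_real_vs:
  assumes "fun_module x S E" "fun_subspace S"
  shows "real_vs E"
  by (rule real_vsI)
    (use assms in \<open>auto simp: fun_module_def fun_subspace_def algebra_simps\<close>)

lemma fun_module_finsum:
  assumes "fun_module x S E" "fun_subspace S" "finite A" "\<And>i. i \<in> A \<Longrightarrow> \<phi> i \<in> S"
  shows "(\<Oplus>\<^bsub>E\<^esub>i\<in>A. (x, \<phi> i)) = (x, \<lambda>v. \<Sum>i\<in>A. \<phi> i v)"
proof -
  interpret E: Module.module "ring_of_type_algebra :: real ring" E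
    using assms(1,2) by (rule fun_module_real_vs)
  show ?thesis
    using assms(3,4)
  proof (induction A)
    case (insert i A)
    then show ?case
      using assms(1,2) by (subst E.M.finsum_insert) (auto simp: fun_module_def)
  qed (use assms(1) in \<open>simp add: fun_module_def\<close>)
qed

definition fun_basis :: "('v \<Rightarrow> real) set \<Rightarrow> nat \<Rightarrow> (nat \<Rightarrow> 'v \<Rightarrow> real) \<Rightarrow> bool" where
  "fun_basis S n b \<longleftrightarrow> (\<forall>i<n. b i \<in> S) \<and>
     (\<forall>\<phi>\<in>S. \<exists>!c. c \<in> {..<n} \<rightarrow>\<^sub>E UNIV \<and> \<phi> = (\<lambda>v. \<Sum>i<n. c i * b i v))"

text \<open>Strips the base point from a basis and turns the sum in the module record into a
  pointwise sum, after which linear algebra of real functions applies.\<close>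

lemma has_dim_fun_basis:
  assumes "fun_module x S E" "fun_subspace S" "has_dim E n"
  shows "\<exists>b. fun_basis S n b"
proof -
  obtain b where b: "\<forall>i<n. b i \<in> carrier E"
    "\<forall>\<xi>\<in>carrier E. \<exists>!c. c \<in> {..<n} \<rightarrow>\<^sub>E UNIV \<and> \<xi> = (\<Oplus>\<^bsub>E\<^esub>i\<in>{..<n}. c i \<odot>\<^bsub>E\<^esub> b i)"
    using assms(3) unfolding has_dim_def by blast
  define \<beta> where "\<beta> i = snd (b i)" for i
  have bS: "\<beta> i \<in> S" "b i = (x, \<beta> i)" if "i < n" for i
    using b(1) that assms(1) by (auto simp: fun_module_def \<beta>_def)
  interpret E: Module.module "ring_of_type_algebra :: real ring" E
    using assms(1,2) by (rule fun_module_real_vs)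
  have "(\<Oplus>\<^bsub>E\<^esub>i\<in>{..<n}. c i \<odot>\<^bsub>E\<^esub> b i) = (x, \<lambda>v. \<Sum>i<n. c i * \<beta> i v)" for c
  proof -
    have in_S: "(\<lambda>v. c i * \<beta> i v) \<in> S" if "i < n" for i
      using bS(1)[OF that] assms(2) by (simp add: fun_subspace_def)
    have "(\<Oplus>\<^bsub>E\<^esub>i\<in>{..<n}. c i \<odot>\<^bsub>E\<^esub> b i) = (\<Oplus>\<^bsub>E\<^esub>i\<in>{..<n}. (x, \<lambda>v. c i * \<beta> i v))"
      by (rule E.M.finsum_cong') (use in_S bS assms(1) in \<open>auto simp: fun_module_def\<close>)
    also have "\<dots> = (x, \<lambda>v. \<Sum>i<n. c i * \<beta> i v)"
      by (rule fun_module_finsum[OF assms(1,2)]) (use in_S in auto)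
    finally show ?thesis .
  qed
  with b(2) have "\<forall>\<phi>\<in>S. \<exists>!c. c \<in> {..<n} \<rightarrow>\<^sub>E UNIV \<and> \<phi> = (\<lambda>v. \<Sum>i<n. c i * \<beta> i v)"
    using assms(1) by (simp add: fun_module_def)
  with bS show ?thesis unfolding fun_basis_def by blast
qed

lemma fun_sum_apply: "(\<Sum>i\<in>A. f i) v = (\<Sum>i\<in>A. f i v)"
  for f :: "'i \<Rightarrow> 'v \<Rightarrow> real"
  by (induction A rule: infinite_finite_induct) simp_all

text \<open>If some element of \<open>S\<close> were outside \<open>W\<close>, adding it to a basis
  of \<open>W\<close> would give n + 1 independent functions in the span of n. All real functions on
  the type form the ambient vector space.\<close>

lemma fun_subspace_dim_eq:
  assumes W: "fun_subspace W" and "W \<subseteq> S" and b: "fun_basis S n b" and b': "fun_basis W n b'"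
  shows "W = S"
proof (rule ccontr)
  interpret fs: vector_space "\<lambda>(c :: real) (\<phi> :: 'a \<Rightarrow> real) v. c * \<phi> v"
    by unfold_locales (auto simp: algebra_simps)
  have sum_eq: "(\<lambda>v. \<Sum>i<n. c i * d i v) = (\<Sum>i<n. (\<lambda>v. c i * d i v))" for c and d :: "nat \<Rightarrow> 'a \<Rightarrow> real"
    by (rule ext) (simp add: fun_sum_apply)
  have spanS: "\<phi> \<in> fs.span (b ` {..<n})" if "\<phi> \<in> S" for \<phi>
  proof -
    obtain c where "\<phi> = (\<lambda>v. \<Sum>i<n. c i * b i v)"
      using b \<open>\<phi> \<in> S\<close> unfolding fun_basis_def by blast
    then show ?thesis
      unfolding sum_eq by (simp only:) (intro fs.span_sum fs.span_scale fs.span_base imageI)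
  qed
  have W0: "(\<lambda>_. 0) \<in> W" using W by (simp add: fun_subspace_def)
  \<comment> \<open>Uniqueness in \<open>fun_basis\<close> concerns coefficient families that are
    \<open>undefined\<close> from \<open>n\<close> on, so both families are restricted before they
    are compared.\<close>
  have uniq: "c i = d i" if "(\<lambda>v. \<Sum>i<n. c i * b' i v) = (\<lambda>v. \<Sum>i<n. d i * b' i v)"
    "(\<lambda>v. \<Sum>i<n. c i * b' i v) \<in> W" "i < n" for c d i
  proof -
    let ?c = "restrict c {..<n}" and ?d = "restrict d {..<n}"
    have "(\<lambda>v. \<Sum>i<n. c i * b' i v) = (\<lambda>v. \<Sum>i<n. ?c i * b' i v)"
      "(\<lambda>v. \<Sum>i<n. c i * b' i v) = (\<lambda>v. \<Sum>i<n. ?d i * b' i v)"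
      using that(1) by simp_all
    moreover have "?c \<in> {..<n} \<rightarrow>\<^sub>E UNIV" "?d \<in> {..<n} \<rightarrow>\<^sub>E UNIV" by auto
    ultimately have "?c = ?d" using b' that(2) unfolding fun_basis_def by blast
    then show ?thesis using that(3) by (metis lessThan_iff restrict_apply')
  qed
  \<comment> \<open>Independence is a property of the set of basis functions; that this set has
    \<open>n\<close> elements follows by comparing the coordinates of \<open>b' i\<close> and
    \<open>b' j\<close>.\<close>
  have inj: "inj_on b' {..<n}"
  proof (rule inj_onI)
    fix i j assume ij: "i \<in> {..<n}" "j \<in> {..<n}" "b' i = b' j"
    have u: "(\<lambda>v. \<Sum>k<n. (if k = l then 1 else 0) * b' k v) = b' l" if "l < n" for l
      using that by (intro ext) (simp add: if_distrib[of "\<lambda>x. x * _"] cong: if_cong)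
    have "b' i \<in> W" using b' ij by (simp add: fun_basis_def)
    then have "(if i = i then 1 else 0) = ((if i = j then 1 else 0) :: real)"
      using uniq[of "\<lambda>k. if k = i then 1 else 0" "\<lambda>k. if k = j then 1 else 0" i] u[of i] u[of j] ij
      by simp
    then show "i = j" by (simp split: if_splits)
  qed
  have "fs.independent (b' ` {..<n})"
  proof (rule fs.independent_if_scalars_zero)
    fix u \<phi> assume u: "(\<Sum>\<phi>\<in>b' ` {..<n}. (\<lambda>v. u \<phi> * \<phi> v)) = 0" and "\<phi> \<in> b' ` {..<n}"
    then obtain i where i: "i < n" "\<phi> = b' i" by auto
    have "(\<lambda>v. \<Sum>i<n. u (b' i) * b' i v) = (\<lambda>_. 0)"
      using u by (simp add: sum_eq sum.reindex[OF inj] zero_fun_def)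
    then have "u (b' i) = 0"
      using uniq[of "\<lambda>i. u (b' i)" "\<lambda>_. 0" i] W0 i by simp
    then show "u \<phi> = 0" using i by simp
  qed simp
  moreover have "fs.span (b' ` {..<n}) \<subseteq> W"
    using b' W by (intro fs.span_minimal)
      (auto simp: fun_basis_def fs.subspace_def fun_subspace_def zero_fun_def plus_fun_def)
  moreover assume "W \<noteq> S"
  then obtain \<phi> where \<phi>: "\<phi> \<in> S" "\<phi> \<notin> W" using assms(2) by blast
  ultimately have "fs.independent (insert \<phi> (b' ` {..<n}))"
    by (intro fs.independent_insertI) auto
  moreover have "insert \<phi> (b' ` {..<n}) \<subseteq> fs.span (b ` {..<n})"
    using \<phi> b' assms(2) spanS by (auto simp: fun_basis_def)
  ultimately have "card (insert \<phi> (b' ` {..<n})) \<le> card (b ` {..<n})"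
    using fs.independent_span_bound by blast
  also have "\<dots> \<le> n" using card_image_le[of "{..<n}" b] by simp
  finally have "card (insert \<phi> (b' ` {..<n})) \<le> n" .
  moreover have "\<phi> \<notin> b' ` {..<n}" using \<phi> b' by (auto simp: fun_basis_def)
  ultimately show False using card_image[OF inj] by simp
qed

subsection \<open>Dual pseudo-bundles and dual metrics\<close>

abbreviation dual_fibre :: "('v, 'x) vbundle \<Rightarrow> 'x \<Rightarrow> (real, 'x \<times> ('v \<Rightarrow> real)) module" where
  "dual_fibre V x \<equiv> fibre (dual_bundle V) x"

text \<open>Plots of \<open>real_space\<close> have open domains, so this must be known for the
  plots of a fibre before the zero functional counts as smooth. For a glued pseudo-bundle it is
  immediate from the quotient diffeology.\<close>

definition open_plots :: "('v, 'x) vbundle \<Rightarrow> bool" where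
  "open_plots V \<longleftrightarrow> (\<forall>n U p. plot (total V) n U p \<longrightarrow> open_dom n U)"

lemma pseudo_bundle_open_plots: "pseudo_bundle V \<Longrightarrow> open_plots V"
proof -
  assume "pseudo_bundle V"
  then have "diffeological_space (total V)" unfolding pseudo_bundle_def by (rule conjunct1)
  then have "\<forall>n U p. plot (total V) n U p \<longrightarrow> open_dom n U \<and> p ` U \<subseteq> points (total V)"
    unfolding diffeological_space_def by (rule conjunct1)
  then show ?thesis by (simp add: open_plots_def)
qed

lemma glued_open_plots: "open_plots (glued G)"
  by (simp add: open_plots_def glued_def glue_space_def quotient_space_def)

lemma dual_vectors_subspace:
  assumes "open_plots V"
  shows "fun_subspace (dual_vectors V x)"
  using assms
  by (auto simp: fun_subspace_def dual_vectors_def smooth_map_def real_space_def sub_space_def open_plots_def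
      o_def smooth_fun_const algebra_simps intro!: smooth_fun_add smooth_fun_cmult)

lemma dual_bundle_simps [simp]:
  "points (total (dual_bundle V)) = Sigma (points (base V)) (dual_vectors V)"
  "base (dual_bundle V) = base V" "proj (dual_bundle V) = fst"
  "fplus (dual_bundle V) \<xi> \<eta> = (fst \<xi>, \<lambda>v. snd \<xi> v + snd \<eta> v)"
  "fscale (dual_bundle V) c \<xi> = (fst \<xi>, \<lambda>v. c * snd \<xi> v)"
  "fzero (dual_bundle V) x = (x, \<lambda>_. 0)"
  by (simp_all add: dual_bundle_def)

lemma dual_fibre_fun_module:
  "x \<in> points (base V) \<Longrightarrow> fun_module x (dual_vectors V x) (dual_fibre V x)"
  by (auto simp: fun_module_def fun_eq_iff)

lemma dual_fibre_carrier:
  "x \<in> points (base V) \<Longrightarrow> carrier (dual_fibre V x) = {x} \<times> dual_vectors V x"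
  by auto

lemma dual_fibre_real_vs:
  "open_plots V \<Longrightarrow> x \<in> points (base V) \<Longrightarrow> real_vs (dual_fibre V x)"
  by (rule fun_module_real_vs[OF dual_fibre_fun_module dual_vectors_subspace])

text \<open>What a pseudo-metric provides at a single point: a symmetric bilinear form that
  represents every smooth functional. Being pointwise, it can be moved along isomorphisms of fibres
  to the glued pseudo-bundle.\<close>

definition dualizing_form :: "('v, 'x) vbundle \<Rightarrow> ('x \<Rightarrow> 'v \<Rightarrow> 'v \<Rightarrow> real) \<Rightarrow> 'x \<Rightarrow> bool" where
  "dualizing_form V g x \<longleftrightarrow> real_vs (fibre V x) \<and>
     (\<forall>v\<in>vecs V x. \<forall>w\<in>vecs V x. g x v w = g x w v) \<and>
     (\<forall>u\<in>vecs V x. \<forall>v\<in>vecs V x. \<forall>w\<in>vecs V x.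
        g x u (fplus V v w) = g x u v + g x u w) \<and>
     (\<forall>c. \<forall>v\<in>vecs V x. \<forall>w\<in>vecs V x. g x v (fscale V c w) = c * g x v w) \<and>
     carrier (dual_fibre V x) \<subseteq> flat V g ` vecs V x"

lemma flat_apply:
  "v \<in> vecs V x \<Longrightarrow> flat V g v = (x, \<lambda>w. if w \<in> vecs V x then g x v w else 0)"
  by (auto simp: flat_def)

text \<open>Two preimages of one functional have the same products with every vector, so
  \<open>g x v w\<close> does not change when \<open>v\<close>, or by symmetry \<open>w\<close>, is
  replaced by another preimage.\<close>

lemma dual_metric_flat:
  assumes "dualizing_form V g x" and v: "v \<in> vecs V x" "w \<in> vecs V x"
  shows "dual_metric V g x (flat V g v) (flat V g w) = g x v w"
  unfolding dual_metric_def
proof (rule the_equality)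
  show "\<exists>v'\<in>vecs V x. \<exists>w'\<in>vecs V x.
      flat V g v' = flat V g v \<and> flat V g w' = flat V g w \<and> g x v w = g x v' w'"
    using v by blast
  have sym: "\<And>v w. v \<in> vecs V x \<Longrightarrow> w \<in> vecs V x \<Longrightarrow> g x v w = g x w v"
    using assms(1) unfolding dualizing_form_def by blast
  have flat: "g x u z = g x u' z" if "flat V g u = flat V g u'" "u \<in> vecs V x"
    "u' \<in> vecs V x" "z \<in> vecs V x" for u u' z
  proof -
    have "snd (flat V g u) z = snd (flat V g u') z" by (simp only: that(1))
    then show ?thesis
      unfolding flat_apply[OF that(2)] flat_apply[OF that(3)] using that(4) by (simp only: snd_conv if_True)
  qed
  fix r assume "\<exists>v'\<in>vecs V x. \<exists>w'\<in>vecs V x.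
      flat V g v' = flat V g v \<and> flat V g w' = flat V g w \<and> r = g x v' w'"
  then obtain v' w' where *: "v' \<in> vecs V x" "w' \<in> vecs V x"
    "flat V g v' = flat V g v" "flat V g w' = flat V g w" "r = g x v' w'" by blast
  have "r = g x v w'" using flat[OF *(3,1) v(1) *(2)] *(5) by simp
  also have "\<dots> = g x v w" using sym[OF v(1) *(2)] sym[OF v] flat[OF *(4,2) v(2) v(1)] by simp
  finally show "r = g x v w" .
qed

text \<open>\<open>flat V g\<close> is linear and reaches every element of the dual fibre, so
  bilinearity of \<open>g x\<close> carries over through preimages.\<close>

lemma dual_metric_quadratic_space:
  assumes dz: "dualizing_form V g x" and V: "open_plots V" "x \<in> points (base V)"
  shows "quadratic_space (dual_fibre V x) (dual_metric V g x)"
proof -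
  let ?F = "fibre V x" and ?D = "dual_fibre V x"
  have vs: "real_vs ?F" and sym: "\<And>v w. v \<in> carrier ?F \<Longrightarrow> w \<in> carrier ?F \<Longrightarrow> g x v w = g x w v"
    and add: "\<And>u v w. u \<in> carrier ?F \<Longrightarrow> v \<in> carrier ?F \<Longrightarrow> w \<in> carrier ?F \<Longrightarrow>
      g x u (fplus V v w) = g x u v + g x u w"
    and scale: "\<And>c v w. v \<in> carrier ?F \<Longrightarrow> w \<in> carrier ?F \<Longrightarrow> g x v (fscale V c w) = c * g x v w"
    and surj: "\<And>\<xi>. \<xi> \<in> carrier ?D \<Longrightarrow> \<exists>v\<in>carrier ?F. \<xi> = flat V g v"
    using dz unfolding dualizing_form_def by blast+
  have closed: "fplus V v w \<in> carrier ?F" if "v \<in> carrier ?F" "w \<in> carrier ?F" for v w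
    using real_vsD(2)[OF vs that] by simp
  have closed': "fscale V c v \<in> carrier ?F" if "v \<in> carrier ?F" for c v
    using real_vsD(3)[OF vs that] by simp
  have flat_add: "flat V g v \<oplus>\<^bsub>?D\<^esub> flat V g w = flat V g (fplus V v w)" if "v \<in> carrier ?F" "w \<in> carrier ?F" for v w
    unfolding flat_apply[OF that(1)] flat_apply[OF that(2)] flat_apply[OF closed[OF that]]
    using that by (auto simp: fun_eq_iff sym[OF closed[OF that]] add sym[of _ v] sym[of _ w] simp del: fibre_simps(1) simp: fibre_simps(2))
  have flat_scale: "c \<odot>\<^bsub>?D\<^esub> flat V g v = flat V g (fscale V c v)" if "v \<in> carrier ?F" for c v
    unfolding flat_apply[OF that(1)] flat_apply[OF closed'[OF that]]
    using that by (auto simp: fun_eq_iff sym[OF closed'[OF that]] scale sym[of _ v] simp del: fibre_simps(1))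
  show ?thesis
  proof (intro quadratic_space.intro real_vec_space.intro quadratic_space_axioms.intro)
    show "real_vs ?D" by (rule dual_fibre_real_vs[OF V])
  next
    fix \<xi> \<eta> assume "\<xi> \<in> carrier ?D" "\<eta> \<in> carrier ?D"
    then obtain v w where "v \<in> carrier ?F" "w \<in> carrier ?F" "\<xi> = flat V g v" "\<eta> = flat V g w"
      using surj by metis
    then show "dual_metric V g x \<xi> \<eta> = dual_metric V g x \<eta> \<xi>"
      by (simp only: dual_metric_flat[OF dz] sym[of v w])
  next
    fix \<zeta> \<xi> \<eta> assume "\<zeta> \<in> carrier ?D" "\<xi> \<in> carrier ?D" "\<eta> \<in> carrier ?D"
    then obtain u v w where *: "u \<in> carrier ?F" "v \<in> carrier ?F" "w \<in> carrier ?F"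
      "\<zeta> = flat V g u" "\<xi> = flat V g v" "\<eta> = flat V g w"
      using surj by metis
    then show "dual_metric V g x \<zeta> (\<xi> \<oplus>\<^bsub>?D\<^esub> \<eta>) = dual_metric V g x \<zeta> \<xi> + dual_metric V g x \<zeta> \<eta>"
      by (simp only: flat_add dual_metric_flat[OF dz] closed add)
  next
    fix c \<xi> \<eta> assume "\<xi> \<in> carrier ?D" "\<eta> \<in> carrier ?D"
    then obtain v w where *: "v \<in> carrier ?F" "w \<in> carrier ?F" "\<xi> = flat V g v" "\<eta> = flat V g w"
      using surj by metis
    then show "dual_metric V g x \<xi> (c \<odot>\<^bsub>?D\<^esub> \<eta>) = c * dual_metric V g x \<xi> \<eta>"
      by (simp only: flat_scale dual_metric_flat[OF dz] closed' scale)
  qed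
qed

section \<open>Bilinear forms given by elements of V* \<otimes> V*\<close>

definition word_form :: "('x \<times> ('v \<Rightarrow> real)) fword \<Rightarrow> 'v \<Rightarrow> 'v \<Rightarrow> real" where
  "word_form u v w = snd (letters u ! 0) v * snd (letters u ! 1) w"

lemma scal_sum: "scal (\<Sum>u\<in>A. c u) = (\<Sum>u\<in>A. scal (c u))"
  by (induction A rule: infinite_finite_induct) (simp_all add: scal_add)

lemma scal_inject: "scal c = scal d \<longleftrightarrow> c = d"
  by (metis lookup_single_eq)

text \<open>Evaluation at a pair of vectors is bilinear in the two letters of a word, so it vanishes
  on the tensor ideal and depends only on the class.\<close>

lemma tensor_form_tc:
  assumes D: "fun_module x S D" "fun_subspace S" and a: "a \<in> fcar D"
  shows "tensor_form (tensor_class D a) v w =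
    (\<Sum>u | u \<in> Poly_Mapping.keys a \<and> length (letters u) = 2. Poly_Mapping.lookup a u * word_form u v w)"
proof -
  interpret D: real_vec_space D
    using fun_module_real_vs[OF D] by (rule real_vec_space.intro)
  let ?\<phi> = "\<lambda>a. \<Sum>u | u \<in> Poly_Mapping.keys a \<and> length (letters u) = 2.
     Poly_Mapping.lookup a u * snd (letters u ! 0) v * snd (letters u ! 1) w"
  \<comment> \<open>\<open>wlin_tensor_ideal\<close> takes functions with values in a free algebra,
    so a real number is stored as a scalar of the free algebra over \<open>unit\<close>; the
    subspace is \<open>{0}\<close>.\<close>
  define \<psi> :: "('a \<times> ('b \<Rightarrow> real)) list \<Rightarrow> unit fword \<Rightarrow>\<^sub>0 real" where
    "\<psi> l = (if length l = 2 then scal (snd (l ! 0) v * snd (l ! 1) w) else 0)" for l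
  have \<phi>: "scal (?\<phi> a) = wlin \<psi> a" for a
    unfolding wlin_def \<psi>_def scal_sum
    by (simp add: sum.inter_filter[symmetric] scal_mult if_distrib mult.assoc cong: if_cong)
  have zero: "wlin \<psi> a = 0" if "a \<in> tensor_ideal D" for a
  proof -
    have "wlin \<psi> a \<in> {0}"
    proof (rule D.wlin_tensor_ideal[OF _ _ _ that])
      show "scal_subgroup {0 :: unit fword \<Rightarrow>\<^sub>0 real}" by (simp add: scal_subgroup_def)
      \<comment> \<open>The word has two letters only if exactly one letter stands beside the
        varying one; otherwise all terms are 0.\<close>
      have cases: "length p = 0 \<and> length q = 1 \<or> length p = 1 \<and> length q = 0 \<or> length p + length q \<noteq> 1"
        for p q :: "('a \<times> ('b \<Rightarrow> real)) list" by linarith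
      fix p q :: "('a \<times> ('b \<Rightarrow> real)) list" and \<xi> \<eta> c
      show "\<psi> (p @ (\<xi> \<oplus>\<^bsub>D\<^esub> \<eta>) # q) - \<psi> (p @ \<xi> # q) - \<psi> (p @ \<eta> # q) \<in> {0}"
        using cases[of p q] D(1)
        by (auto simp: \<psi>_def nth_append fun_module_def algebra_simps scal_add)
      show "\<psi> (p @ (c \<odot>\<^bsub>D\<^esub> \<xi>) # q) - scal c * \<psi> (p @ \<xi> # q) \<in> {0}"
        using cases[of p q] D(1)
        by (auto simp: \<psi>_def nth_append fun_module_def algebra_simps scal_mult)
    qed
    then show ?thesis by simp
  qed
  have "?\<phi> a' = ?\<phi> a" if "a' - a \<in> tensor_ideal D" for a'
  proof -
    have "scal (?\<phi> a') - scal (?\<phi> a) = (0 :: unit fword \<Rightarrow>\<^sub>0 real)"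
      unfolding \<phi> wlin_diff[symmetric] by (rule zero[OF that])
    then show ?thesis by (simp only: right_minus_eq scal_inject)
  qed
  then have "tensor_form (tensor_class D a) v w = ?\<phi> a"
    unfolding tensor_form_def using a by (intro D.the_elem_tc) auto
  then show ?thesis by (simp add: word_form_def mult.assoc)
qed

lemma fun_subspace_sum:
  assumes "fun_subspace S" "\<And>i. i \<in> A \<Longrightarrow> \<phi> i \<in> S"
  shows "(\<lambda>v. \<Sum>i\<in>A. \<phi> i v) \<in> S"
  using assms(2) by (induction A rule: infinite_finite_induct) (use assms(1) in \<open>auto simp: fun_subspace_def\<close>)

text \<open>The section presents \<open>g x\<close> as a finite sum of products \<xi>(v) \<eta>(w)
  of smooth functionals. Hence \<open>g x\<close> is bilinear, and \<open>flat V g v\<close>, a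
  combination of the \<eta>, is smooth. The image of the fibre is a subspace of the dual of the same
  dimension, so it is everything.\<close>

lemma pseudo_metric_flat:
  assumes V: "pseudo_bundle V" and g: "pseudo_metric V g" and x: "x \<in> points (base V)"
  shows "dualizing_form V g x" and "carrier (dual_fibre V x) = flat V g ` vecs V x"
proof -
  let ?F = "fibre V x" and ?D = "dual_fibre V x" and ?S = "dual_vectors V x"
  have S: "fun_subspace ?S" using V by (intro dual_vectors_subspace pseudo_bundle_open_plots)
  have D: "fun_module x ?S ?D" using x by (rule dual_fibre_fun_module)
  have vs: "real_vs ?F" using V x by (simp add: pseudo_bundle_def)
  have sym: "\<And>v w. v \<in> carrier ?F \<Longrightarrow> w \<in> carrier ?F \<Longrightarrow> g x v w = g x w v"
    using g x unfolding pseudo_metric_def by blast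
  obtain s where s: "smooth_map (base V) (total (tensor_bundle {2} (dual_bundle V))) s"
    "\<forall>x\<in>points (base V). fst (s x) = x \<and>
       (\<forall>v\<in>vecs V x. \<forall>w\<in>vecs V x. g x v w = tensor_form (snd (s x)) v w)"
    using g unfolding pseudo_metric_def by blast
  have "s x \<in> tensor_points {2} (dual_bundle V)"
    using s(1) x by (auto simp: smooth_map_def tensor_bundle_def tensor_bundle_with_def)
  then have "snd (s x) \<in> tensors ?D {2}"
    using s(2) x by (cases "s x") (auto simp: tensor_points_def)
  then obtain a where a: "a \<in> fcar ?D" "snd (s x) = tensor_class ?D a"
    by (auto simp: tensors_def)
  let ?K = "{u \<in> Poly_Mapping.keys a. length (letters u) = 2}"
  have gx: "g x v w = (\<Sum>u\<in>?K. Poly_Mapping.lookup a u * word_form u v w)"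
    if "v \<in> carrier ?F" "w \<in> carrier ?F" for v w
    using that s(2) x tensor_form_tc[OF D S a(1)] a(2) by simp
  have second: "snd (letters u ! 1) \<in> ?S" if "u \<in> ?K" for u
  proof -
    have "FWord (letters u) \<in> Poly_Mapping.keys a" using that by simp
    then have "set (letters u) \<subseteq> carrier ?D" using a(1) unfolding mem_fcar by blast
    moreover have "letters u ! 1 \<in> set (letters u)" using that by (intro nth_mem) simp
    ultimately have "letters u ! 1 \<in> carrier ?D" by blast
    then show ?thesis unfolding dual_fibre_carrier[OF x] by auto
  qed
  have lin: "\<phi> (fplus V v w) = \<phi> v + \<phi> w" "\<phi> (fscale V c v) = c * \<phi> v" "v' \<notin> carrier ?F \<Longrightarrow> \<phi> v' = 0"
    if "\<phi> \<in> ?S" "v \<in> carrier ?F" "w \<in> carrier ?F" for \<phi> v w v' c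
    using that unfolding dual_vectors_def by blast+
  have closed: "fplus V v w \<in> carrier ?F" if "v \<in> carrier ?F" "w \<in> carrier ?F" for v w
    using real_vsD(2)[OF vs that] by simp
  have closed': "fscale V c v \<in> carrier ?F" if "v \<in> carrier ?F" for c v
    using real_vsD(3)[OF vs that] by simp
  have add: "g x u (fplus V v w) = g x u v + g x u w"
    if "u \<in> carrier ?F" "v \<in> carrier ?F" "w \<in> carrier ?F" for u v w
    unfolding gx[OF that(1,2)] gx[OF that(1,3)] gx[OF that(1) closed[OF that(2,3)]] word_form_def
    by (simp only: lin(1)[OF second that(2,3)] sum.distrib[symmetric] distrib_left cong: sum.cong)
  have scale: "g x v (fscale V c w) = c * g x v w"
    if "v \<in> carrier ?F" "w \<in> carrier ?F" for v w c
    unfolding gx[OF that] gx[OF that(1) closed'[OF that(2)]] word_form_def sum_distrib_left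
    by (rule sum.cong[OF refl]) (simp only: lin(2)[OF second that(2) that(2)] mult.left_commute)
  have flat_in: "flat V g v \<in> carrier ?D" if v: "v \<in> carrier ?F" for v
  proof -
    have "(\<lambda>w. \<Sum>u\<in>?K. (Poly_Mapping.lookup a u * snd (letters u ! 0) v) * snd (letters u ! 1) w) \<in> ?S"
      using S second by (intro fun_subspace_sum) (auto simp: fun_subspace_def)
    also have "(\<lambda>w. \<Sum>u\<in>?K. (Poly_Mapping.lookup a u * snd (letters u ! 0) v) * snd (letters u ! 1) w) =
        (\<lambda>w. if w \<in> carrier ?F then g x v w else 0)"
    proof
      fix w
      show "(\<Sum>u\<in>?K. (Poly_Mapping.lookup a u * snd (letters u ! 0) v) * snd (letters u ! 1) w) =
          (if w \<in> carrier ?F then g x v w else 0)"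
      proof (cases "w \<in> carrier ?F")
        case True
        then show ?thesis using gx[OF v True] by (simp only: word_form_def mult.assoc if_True)
      next
        case False
        have "snd (letters u ! 1) w = 0" if "u \<in> ?K" for u
          by (rule lin(3)[OF second[OF that] v v False])
        then show ?thesis using False by (simp only: mult_zero_right sum.neutral_const if_False cong: sum.cong)
      qed
    qed
    finally show ?thesis
      unfolding flat_apply[OF v] dual_fibre_carrier[OF x] by simp
  qed
  define W where "W = snd ` flat V g ` carrier ?F"
  have W_flat: "{x} \<times> W = flat V g ` carrier ?F"
    unfolding W_def using flat_apply[of _ V x g] by (auto simp: image_image simp del: fibre_simps)
  have W_sub: "W \<subseteq> ?S"
  proof -
    have "{x} \<times> W \<subseteq> {x} \<times> ?S"
      unfolding W_flat using flat_in dual_fibre_carrier[OF x] by blast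
    then show ?thesis by blast
  qed
  have W_elem: "\<phi> \<in> W \<longleftrightarrow> (\<exists>v\<in>carrier ?F. \<phi> = (\<lambda>w. if w \<in> carrier ?F then g x v w else 0))" for \<phi>
    unfolding W_def image_image using flat_apply[of _ V x g] by (auto simp del: fibre_simps)
  have W: "fun_subspace W"
    unfolding fun_subspace_def
  proof (intro conjI ballI allI)
    have z: "fzero V x \<in> carrier ?F" using real_vsD(1)[OF vs] by simp
    have "g x (fzero V x) w = 0" if "w \<in> carrier ?F" for w
      using scale[of w "fzero V x" 0] sym[OF z that] real_vsD(4)[OF vs z] z that by simp
    then show "(\<lambda>_. 0) \<in> W" unfolding W_elem using z by (intro bexI[of _ "fzero V x"]) (auto simp: fun_eq_iff)
  next
    fix \<phi> \<psi> assume "\<phi> \<in> W" "\<psi> \<in> W"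
    then obtain v w where vw: "v \<in> carrier ?F" "\<phi> = (\<lambda>z. if z \<in> carrier ?F then g x v z else 0)"
      "w \<in> carrier ?F" "\<psi> = (\<lambda>z. if z \<in> carrier ?F then g x w z else 0)"
      unfolding W_elem by blast
    have "g x (fplus V v w) z = g x v z + g x w z" if "z \<in> carrier ?F" for z
      using add[OF that vw(1,3)] sym[OF that] closed[OF vw(1,3)] vw(1,3) by metis
    then show "(\<lambda>z. \<phi> z + \<psi> z) \<in> W"
      unfolding W_elem vw(2,4) using closed[OF vw(1,3)]
      by (intro bexI[of _ "fplus V v w"]) (auto simp: fun_eq_iff simp del: fibre_simps)
  next
    fix c \<phi> assume "\<phi> \<in> W"
    then obtain v where v: "v \<in> carrier ?F" "\<phi> = (\<lambda>z. if z \<in> carrier ?F then g x v z else 0)"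
      unfolding W_elem by blast
    have "g x (fscale V c v) z = c * g x v z" if "z \<in> carrier ?F" for z
      using scale[OF that v(1)] sym[OF that] closed'[OF v(1)] v(1) by metis
    then show "(\<lambda>z. c * \<phi> z) \<in> W"
      unfolding W_elem v(2) using closed'[OF v(1)]
      by (intro bexI[of _ "fscale V c v"]) (auto simp: fun_eq_iff simp del: fibre_simps)
  qed
  obtain n where n: "has_dim ?D n" "has_dim (?D\<lparr>carrier := flat V g ` carrier ?F\<rparr>) n"
    using g x unfolding pseudo_metric_def by blast
  have D': "fun_module x W (?D\<lparr>carrier := flat V g ` carrier ?F\<rparr>)"
    using D unfolding fun_module_def W_flat[symmetric] by simp
  obtain b b' where "fun_basis ?S n b" "fun_basis W n b'"
    using has_dim_fun_basis[OF D S n(1)] has_dim_fun_basis[OF D' W n(2)] by blast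
  then have "W = ?S" by (rule fun_subspace_dim_eq[OF W W_sub])
  then show eq: "carrier ?D = flat V g ` carrier ?F"
    using W_flat dual_fibre_carrier[OF x] by simp
  show "dualizing_form V g x"
    unfolding dualizing_form_def using vs sym add scale eq by blast
qed

subsection \<open>Pulling back functionals along isomorphisms of fibres\<close>

text \<open>On one fibre \<open>j1_dual G\<close> and \<open>j2_dual G\<close> are of this form,
  with the base point given explicitly instead of computed by an inverse inclusion.\<close>

definition pull :: "('v, 'x) vbundle \<Rightarrow> 'x \<Rightarrow> ('v \<Rightarrow> 'w) \<Rightarrow> 'y \<times> ('w \<Rightarrow> real) \<Rightarrow> 'x \<times> ('v \<Rightarrow> real)" where
  "pull V x j \<xi> = (x, \<lambda>v. if v \<in> vecs V x then snd \<xi> (j v) else 0)"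

lemma pull_lin_map:
  assumes "\<And>\<xi>. \<xi> \<in> carrier (dual_fibre V' P) \<Longrightarrow> pull V x j \<xi> \<in> carrier (dual_fibre V x)"
  shows "lin_map (dual_fibre V' P) (dual_fibre V x) (pull V x j)"
  using assms unfolding lin_map_def by (auto simp: pull_def)

text \<open>The last assumption says that \<open>j\<close> maps no other element, and no junk value, into the fibre.\<close>

lemma pull_dual_vector:
  assumes iso: "vs_iso j (fibre V x) (fibre V' P)" and x: "x \<in> points (base V)"
    and plots: "\<And>n U p. plot (total V) n U p \<Longrightarrow> plot (total V') n U (j \<circ> p)"
    and off: "\<And>v. v \<notin> vecs V x \<Longrightarrow> j v \<notin> vecs V' P"
    and \<xi>: "\<xi> \<in> carrier (dual_fibre V' P)"
  shows "pull V x j \<xi> \<in> carrier (dual_fibre V x)"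
proof -
  obtain \<phi> where \<phi>: "\<xi> = (P, \<phi>)" "\<phi> \<in> dual_vectors V' P" using \<xi> by auto
  have \<phi>_lin: "\<And>v w. v \<in> vecs V' P \<Longrightarrow> w \<in> vecs V' P \<Longrightarrow> \<phi> (fplus V' v w) = \<phi> v + \<phi> w"
    "\<And>c v. v \<in> vecs V' P \<Longrightarrow> \<phi> (fscale V' c v) = c * \<phi> v"
    "\<And>v. v \<notin> vecs V' P \<Longrightarrow> \<phi> v = 0"
    and \<phi>_smooth: "smooth_map (sub_space (total V') (preim V' {P})) real_space \<phi>"
    using \<phi>(2) unfolding dual_vectors_def by blast+
  note jin = vs_iso_in[OF iso]
  have j: "fplus V' (j v) (j w) = j (fplus V v w)" "fscale V' c (j v) = j (fscale V c v)"
    if "v \<in> vecs V x" "w \<in> vecs V x" for v w c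
    using iso that unfolding vs_iso_def by simp_all
  \<comment> \<open>If \<open>v\<close> is outside the fibre, so is \<open>j v\<close>, and
    \<open>\<phi>\<close> vanishes there; the case distinction is therefore plain composition,
    through which plots can be followed.\<close>
  have eq: "(\<lambda>v. if v \<in> vecs V x then \<phi> (j v) else 0) = \<phi> \<circ> j"
    using off \<phi>_lin(3) by (auto simp: fun_eq_iff simp del: fibre_simps)
  have "\<phi> \<circ> j \<in> dual_vectors V x"
    unfolding dual_vectors_def
  proof (intro CollectI conjI ballI allI impI)
    fix v w assume "v \<in> vecs V x" "w \<in> vecs V x"
    then show "(\<phi> \<circ> j) (fplus V v w) = (\<phi> \<circ> j) v + (\<phi> \<circ> j) w"
      by (simp only: o_apply j(1)[symmetric] \<phi>_lin(1) jin)
  next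
    fix c v assume "v \<in> vecs V x"
    then show "(\<phi> \<circ> j) (fscale V c v) = c * (\<phi> \<circ> j) v"
      by (simp only: o_apply j(2)[symmetric] \<phi>_lin(2) jin)
  next
    show "smooth_map (sub_space (total V) (preim V {x})) real_space (\<phi> \<circ> j)"
      unfolding smooth_map_def
    proof (intro conjI allI impI)
      show "(\<phi> \<circ> j) ` points (sub_space (total V) (preim V {x})) \<subseteq> points real_space"
        by (simp add: real_space_def)
      fix n U p assume p: "plot (sub_space (total V) (preim V {x})) n U p"
      have "j v \<in> preim V' {P}" if "v \<in> preim V {x}" for v
        using jin[of v] that by (simp add: preim_def)
      with p have "plot (sub_space (total V') (preim V' {P})) n U (j \<circ> p)"
        using plots by (auto simp: sub_space_def)
      then show "plot real_space n U (\<phi> \<circ> j \<circ> p)"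
        unfolding o_assoc[symmetric] using \<phi>_smooth unfolding smooth_map_def by blast
    qed
  next
    fix v assume "v \<notin> vecs V x"
    then show "(\<phi> \<circ> j) v = 0" using off \<phi>_lin(3) by simp
  qed
  then have "(\<lambda>v. if v \<in> vecs V x then \<phi> (j v) else 0) \<in> dual_vectors V x" unfolding eq .
  then show ?thesis
    unfolding pull_def \<phi>(1) dual_fibre_carrier[OF x] snd_conv by blast
qed

text \<open>If the pullback of \<xi> is \<open>flat V g v\<close>, then \<xi> is
  \<open>flat V' g' (j v)\<close>: the two agree on all \<open>j w\<close>, which exhaust the fibre.
  This transports surjectivity of \<open>flat\<close> and the values of the dual metric
  together.\<close>

lemma pull_metric:
  assumes iso: "vs_iso j (fibre V x) (fibre V' P)" and dz: "dualizing_form V g x"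
    and g': "\<And>v w. v \<in> vecs V x \<Longrightarrow> w \<in> vecs V x \<Longrightarrow> g' P (j v) (j w) = g x v w"
    and pull: "\<And>\<xi>. \<xi> \<in> carrier (dual_fibre V' P) \<Longrightarrow> pull V x j \<xi> \<in> carrier (dual_fibre V x)"
  shows "dualizing_form V' g' P"
    and "\<xi> \<in> carrier (dual_fibre V' P) \<Longrightarrow> \<eta> \<in> carrier (dual_fibre V' P) \<Longrightarrow>
      dual_metric V g x (pull V x j \<xi>) (pull V x j \<eta>) = dual_metric V' g' P \<xi> \<eta>"
proof -
  let ?F = "fibre V x" and ?F' = "fibre V' P"
  have vs: "real_vs ?F" and sym: "\<And>v w. v \<in> carrier ?F \<Longrightarrow> w \<in> carrier ?F \<Longrightarrow> g x v w = g x w v"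
    and add: "\<And>u v w. u \<in> carrier ?F \<Longrightarrow> v \<in> carrier ?F \<Longrightarrow> w \<in> carrier ?F \<Longrightarrow>
      g x u (fplus V v w) = g x u v + g x u w"
    and scale: "\<And>c v w. v \<in> carrier ?F \<Longrightarrow> w \<in> carrier ?F \<Longrightarrow> g x v (fscale V c w) = c * g x v w"
    and surj: "\<And>\<xi>. \<xi> \<in> carrier (dual_fibre V x) \<Longrightarrow> \<exists>v\<in>carrier ?F. \<xi> = flat V g v"
    using dz unfolding dualizing_form_def by blast+
  have closed: "fplus V v w \<in> carrier ?F" if "v \<in> carrier ?F" "w \<in> carrier ?F" for v w
    using real_vsD(2)[OF vs that] by simp
  have closed': "fscale V c v \<in> carrier ?F" if "v \<in> carrier ?F" for c v
    using real_vsD(3)[OF vs that] by simp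
  have car: "carrier ?F' = j ` carrier ?F" using iso by (simp only: vs_iso_def bij_betw_def)
  have j: "fplus V' (j v) (j w) = j (fplus V v w)" "fscale V' c (j v) = j (fscale V c v)"
    if "v \<in> carrier ?F" "w \<in> carrier ?F" for v w c
    using iso that unfolding vs_iso_def by simp_all
  have lift: "\<exists>v\<in>carrier ?F. pull V x j \<xi> = flat V g v \<and> \<xi> = flat V' g' (j v)"
    if \<xi>: "\<xi> \<in> carrier (dual_fibre V' P)" for \<xi>
  proof -
    obtain v where v: "v \<in> carrier ?F" "pull V x j \<xi> = flat V g v" using surj[OF pull[OF \<xi>]] by blast
    have jv: "j v \<in> carrier ?F'" using v(1) car by blast
    obtain \<phi> where \<phi>: "\<xi> = (P, \<phi>)" "\<phi> \<in> dual_vectors V' P" using \<xi> by auto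
    have "\<phi> u = (if u \<in> carrier ?F' then g' P (j v) u else 0)" for u
    proof (cases "u \<in> carrier ?F'")
      case True
      then obtain w where w: "w \<in> carrier ?F" "u = j w" unfolding car by blast
      have "snd (pull V x j \<xi>) w = snd (flat V g v) w" by (simp only: v(2))
      then have "\<phi> (j w) = g x v w"
        unfolding flat_apply[OF v(1)] pull_def \<phi>(1) using w(1) by (simp only: snd_conv if_True)
      then show ?thesis using g'[OF v(1) w(1)] w(2) True by (simp only: if_True)
    next
      case False
      then have "\<phi> u = 0" using \<phi>(2) unfolding dual_vectors_def by blast
      then show ?thesis using False by (simp only: if_False)
    qed
    then have "\<xi> = flat V' g' (j v)" unfolding flat_apply[OF jv] \<phi>(1) by (simp only: prod.inject) blast
    with v show ?thesis by blast
  qed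
  show dz': "dualizing_form V' g' P"
    unfolding dualizing_form_def car
  proof (intro conjI)
    show "real_vs ?F'" using iso vs by (rule vs_iso_real_vs)
    show "carrier (dual_fibre V' P) \<subseteq> flat V' g' ` j ` carrier ?F"
      using lift by blast
  qed (auto simp only: ball_simps j g' closed closed' add scale sym)
  assume "\<xi> \<in> carrier (dual_fibre V' P)" "\<eta> \<in> carrier (dual_fibre V' P)"
  then obtain v w where v: "v \<in> carrier ?F" "pull V x j \<xi> = flat V g v" "\<xi> = flat V' g' (j v)"
    and w: "w \<in> carrier ?F" "pull V x j \<eta> = flat V g w" "\<eta> = flat V' g' (j w)"
    using lift by metis
  have jvw: "j v \<in> carrier ?F'" "j w \<in> carrier ?F'" using v(1) w(1) car by blast+
  show "dual_metric V g x (pull V x j \<xi>) (pull V x j \<eta>) = dual_metric V' g' P \<xi> \<eta>"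
    unfolding v(2) w(2) dual_metric_flat[OF dz v(1) w(1)]
    unfolding v(3) w(3) dual_metric_flat[OF dz' jvw] by (rule g'[OF v(1) w(1), symmetric])
qed

subsection \<open>Duals of glued pseudo-bundles\<close>

context fibre_gluing
begin

text \<open>A non-point is sent by \<open>j1 G\<close> or \<open>j2 G\<close> to the empty class;
  nonemptiness separates such junk from the fibres, as \<open>pull_dual_vector\<close>
  requires.\<close>

lemma total_glued_nonempty: "A \<in> points (total (glued G)) \<Longrightarrow> A \<noteq> {}"
  unfolding total_glued_points
proof (elim UnE imageE)
  fix v assume "A = j1 G v" "v \<in> src_pts"
  then have "Inl v \<in> A" by (auto simp: j1_def glue_class_canon)
  then show ?thesis by blast
next
  fix w assume "A = j2 G w" "w \<in> tgt_pts"
  then have "Inr w \<in> A" by (auto simp: j2_def glue_class_canon)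
  then show ?thesis by blast
qed

lemma j1_plot:
  assumes "open_plots (src G)" "plot (total (src G)) n U p"
  shows "plot (total (glued G)) n U (j1 G \<circ> p)"
proof -
  have U: "open_dom n U" using assms unfolding open_plots_def by blast
  have "plot (sum_space (total (src G)) (total (tgt G))) n U (Inl \<circ> p)"
    using U assms(2) by (auto simp: sum_space_def)
  then show ?thesis
    using U by (auto simp: glued_def glue_space_def quotient_space_def j1_def intro!: exI[of _ U])
qed

lemma j2_plot:
  assumes "open_plots (tgt G)" "plot (total (tgt G)) n U p"
  shows "plot (total (glued G)) n U (j2 G \<circ> p)"
proof -
  have U: "open_dom n U" using assms unfolding open_plots_def by blast
  have "plot (sum_space (total (src G)) (total (tgt G))) n U (Inr \<circ> p)"
    using U assms(2) by (auto simp: sum_space_def)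
  then show ?thesis
    using U by (auto simp: glued_def glue_space_def quotient_space_def j2_def intro!: exI[of _ U])
qed

lemma j1_off:
  assumes x: "x \<in> src_base" "x \<notin> locus G" and v: "v \<notin> vecs (src G) x"
  shows "j1 G v \<notin> vecs (glued G) (i1 G x)"
proof (cases "v \<in> src_pts")
  case True
  then show ?thesis using x v by (simp add: proj_glued_j1 i1_eq_i1_iff src_proj)
next
  case False
  then have "j1 G v = {}"
    by (auto simp: j1_def glue_class_canon preim_def split: if_splits)
  then show ?thesis using total_glued_nonempty by auto
qed

lemma j2_off:
  assumes y: "y \<in> tgt_base" and w: "w \<notin> vecs (tgt G) y"
  shows "j2 G w \<notin> vecs (glued G) (i2 G y)"
proof (cases "w \<in> tgt_pts")
  case True
  then show ?thesis using y w by (simp add: proj_glued_j2 i2_eq_i2_iff tgt_proj)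
next
  case False
  \<comment> \<open>A point \<open>Inl z\<close> could share the normal form \<open>Inr w\<close>
    only if \<open>tmap G z = w\<close>, which \<open>tmap_in\<close> excludes for \<open>w\<close>
    outside the target.\<close>
  then have "j2 G w = {}"
    using tmap_in by (auto simp: j2_def glue_class_canon preim_def split: if_splits)
  then show ?thesis using total_glued_nonempty by auto
qed

lemma base_glued_i1: "x \<in> src_base \<Longrightarrow> i1 G x \<in> points (base (glued G))"
  and base_glued_i2: "y \<in> tgt_base \<Longrightarrow> i2 G y \<in> points (base (glued G))"
  by (simp_all add: base_glued_points)

lemma j1_dual_pull: "x \<in> src_base \<Longrightarrow> x \<notin> locus G \<Longrightarrow> fst \<xi> = i1 G x \<Longrightarrow>
    j1_dual G \<xi> = pull (src G) x (j1 G) \<xi>"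
  by (simp add: j1_dual_def pull_def i1_inv_i1)

lemma j2_dual_pull: "y \<in> tgt_base \<Longrightarrow> fst \<xi> = i2 G y \<Longrightarrow> j2_dual G \<xi> = pull (tgt G) y (j2 G) \<xi>"
  by (simp add: j2_dual_def pull_def i2_inv_i2)

end

section \<open>Isometries between quadratic spaces\<close>

definition isometry_between ::
  "(real, 'v) module \<Rightarrow> ('v \<Rightarrow> 'v \<Rightarrow> real) \<Rightarrow> (real, 'w) module \<Rightarrow> ('w \<Rightarrow> 'w \<Rightarrow> real) \<Rightarrow> ('v \<Rightarrow> 'w) \<Rightarrow> bool" where
  "isometry_between E b E' b' h \<longleftrightarrow> quadratic_space E b \<and> quadratic_space E' b' \<and> lin_map E E' h \<and>
     (\<forall>v\<in>carrier E. \<forall>w\<in>carrier E. b' (h v) (h w) = b v w)"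

lemma isometry_compose:
  assumes "isometry_between E b E' b' h" "isometry_between E' b' E'' b'' k"
  shows "isometry_between E b E'' b'' (\<lambda>v. k (h v))"
  using assms unfolding isometry_between_def lin_map_def Pi_def by auto

text \<open>\<open>Phi G\<close> agrees with a composite of simpler maps only over one point, so
  maps are compared on the carrier alone.\<close>

lemma isometry_cong:
  assumes "isometry_between E b E' b' h" "\<And>v. v \<in> carrier E \<Longrightarrow> k v = h v"
  shows "isometry_between E b E' b' k"
proof -
  interpret E: quadratic_space E b using assms(1) by (simp add: isometry_between_def)
  show ?thesis
    using assms unfolding isometry_between_def lin_map_def by auto
qed

lemma vs_iso_isometry:
  assumes "vs_iso j E E'" "quadratic_space E b"
    and "\<And>v w. v \<in> carrier E \<Longrightarrow> w \<in> carrier E \<Longrightarrow> b' (j v) (j w) = b v w"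
  shows "isometry_between E b E' b' j"
  using assms vs_iso_quadratic_space[OF assms] vs_iso_in[OF assms(1)]
  by (auto simp: isometry_between_def lin_map_def vs_iso_def)

lemma pull_isometry:
  assumes "vs_iso j (fibre V x) (fibre V' P)" "dualizing_form V g x"
    and "\<And>v w. v \<in> vecs V x \<Longrightarrow> w \<in> vecs V x \<Longrightarrow> g' P (j v) (j w) = g x v w"
    and pull: "\<And>\<xi>. \<xi> \<in> carrier (dual_fibre V' P) \<Longrightarrow> pull V x j \<xi> \<in> carrier (dual_fibre V x)"
    and V: "open_plots V" "x \<in> points (base V)" and V': "open_plots V'" "P \<in> points (base V')"
  shows "isometry_between (dual_fibre V' P) (dual_metric V' g' P)
    (dual_fibre V x) (dual_metric V g x) (pull V x j)"
proof -
  note p = pull_metric[where g' = g', OF assms(1,2,3) pull]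
  show ?thesis
    unfolding isometry_between_def
    using dual_metric_quadratic_space[OF p(1) V'] dual_metric_quadratic_space[OF assms(2) V]
      pull_lin_map[OF pull] p(2) by blast
qed

section \<open>A gluing with compatible pseudo-metrics\<close>

locale metric_gluing =
  fixes G :: "('v, 'x, 'w, 'y) gluing" and g1 g2
  assumes src: "pseudo_bundle (src G)" and tgt: "pseudo_bundle (tgt G)"
    and gluing: "is_gluing G"
    and bmap_diffeo: "diffeo_onto_image (base (src G)) (locus G) (base (tgt G)) (bmap G)"
    and tmap_dual_diffeo: "diffeo_onto_image (total (dual_bundle (tgt G)))
      (preim (dual_bundle (tgt G)) (bmap G ` locus G)) (total (dual_bundle (src G))) (tmap_dual G)"
    and g1: "pseudo_metric (src G) g1" and g2: "pseudo_metric (tgt G) g2"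
    and compat: "compatible G g1 g2"
begin

lemma proj_in_base: "pseudo_bundle V \<Longrightarrow> v \<in> points (total V) \<Longrightarrow> proj V v \<in> points (base V)"
  unfolding pseudo_bundle_def by blast

lemma fibre_vs: "pseudo_bundle V \<Longrightarrow> x \<in> points (base V) \<Longrightarrow> real_vs (fibre V x)"
  unfolding pseudo_bundle_def by blast

lemma bmap_in_base: "x \<in> locus G \<Longrightarrow> bmap G x \<in> points (base (tgt G))"
  using gluing unfolding is_gluing_def smooth_map_def sub_space_def by auto

sublocale fibre_gluing G
proof (rule fibre_gluing.intro)
  show "locus G \<subseteq> points (base (src G))" using gluing by (simp add: is_gluing_def)
  show "lin_map (fibre (src G) x) (fibre (tgt G) (bmap G x)) (tmap G)" if "x \<in> locus G" for x
    using gluing that by (simp add: is_gluing_def)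
qed (fact proj_in_base[OF src] proj_in_base[OF tgt] bmap_in_base fibre_vs[OF src] fibre_vs[OF tgt])+

lemma open_src: "open_plots (src G)" and open_tgt: "open_plots (tgt G)"
  by (fact pseudo_bundle_open_plots[OF src] pseudo_bundle_open_plots[OF tgt])+

lemma bmap_inj: "inj_on (bmap G) (locus G)"
proof -
  have "points (sub_space (base (src G)) (locus G)) = locus G"
    using locus_sub by (auto simp: sub_space_def)
  then show ?thesis
    using bmap_diffeo by (simp add: diffeo_onto_image_def diffeomorphism_def bij_betw_def)
qed

lemma tmap_dual_bij:
  shows tmap_dual_in: "\<xi> \<in> preim (dual_bundle (tgt G)) (bmap G ` locus G) \<Longrightarrow>
      tmap_dual G \<xi> \<in> points (total (dual_bundle (src G)))"
    and tmap_dual_inj: "inj_on (tmap_dual G) (preim (dual_bundle (tgt G)) (bmap G ` locus G))"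
proof -
  let ?A = "preim (dual_bundle (tgt G)) (bmap G ` locus G)"
  have A: "points (sub_space (total (dual_bundle (tgt G))) ?A) = ?A"
    by (auto simp: sub_space_def preim_def simp del: dual_bundle_simps)
  have "bij_betw (tmap_dual G) ?A (points (total (dual_bundle (src G))) \<inter> tmap_dual G ` ?A)"
    using tmap_dual_diffeo unfolding diffeo_onto_image_def diffeomorphism_def A
    by (simp add: sub_space_def del: dual_bundle_simps)
  then show "inj_on (tmap_dual G) ?A" "\<xi> \<in> ?A \<Longrightarrow> tmap_dual G \<xi> \<in> points (total (dual_bundle (src G)))"
    unfolding bij_betw_def by blast+
qed

lemma dual_fibre_preim:
  "x \<in> locus G \<Longrightarrow> \<xi> \<in> carrier (dual_fibre (tgt G) (bmap G x)) \<Longrightarrow>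
    \<xi> \<in> preim (dual_bundle (tgt G)) (bmap G ` locus G)"
  by (auto simp: preim_def)

lemma tmap_dual_apply:
  assumes "x \<in> locus G" "fst \<xi> = bmap G x"
  shows "tmap_dual G \<xi> = (x, \<lambda>v. if v \<in> vecs (src G) x then snd \<xi> (tmap G v) else 0)"
  using assms bmap_inj by (simp add: tmap_dual_def)

text \<open>That composing with \<open>tmap G\<close> gives a smooth functional again comes from the
  diffeomorphism hypothesis, whose codomain consists of points of the dual of the source.\<close>

lemma tmap_dual_lin_map:
  assumes x: "x \<in> locus G"
  shows "lin_map (dual_fibre (tgt G) (bmap G x)) (dual_fibre (src G) x) (tmap_dual G)"
  unfolding lin_map_def
proof (intro conjI ballI allI)
  show "tmap_dual G \<in> carrier (dual_fibre (tgt G) (bmap G x)) \<rightarrow> carrier (dual_fibre (src G) x)"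
  proof
    fix \<xi> assume \<xi>: "\<xi> \<in> carrier (dual_fibre (tgt G) (bmap G x))"
    then have "tmap_dual G \<xi> \<in> points (total (dual_bundle (src G)))"
      using x by (intro tmap_dual_in dual_fibre_preim)
    moreover have "fst (tmap_dual G \<xi>) = x"
      using tmap_dual_apply[OF x, of \<xi>] \<xi> by simp
    ultimately show "tmap_dual G \<xi> \<in> carrier (dual_fibre (src G) x)" by simp
  qed
qed (use x in \<open>auto simp: tmap_dual_apply\<close>)

lemma src_dualizing: "x \<in> src_base \<Longrightarrow> dualizing_form (src G) g1 x"
  and tgt_dualizing: "y \<in> tgt_base \<Longrightarrow> dualizing_form (tgt G) g2 y"
  by (fact pseudo_metric_flat(1)[OF src g1] pseudo_metric_flat(1)[OF tgt g2])+

lemma tmap_dual_isometry: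
  assumes x: "x \<in> locus G"
  shows "isometry_between (dual_fibre (tgt G) (bmap G x)) (dual_metric (tgt G) g2 (bmap G x))
    (dual_fibre (src G) x) (dual_metric (src G) g1 x) (tmap_dual G)"
proof -
  let ?y = "bmap G x"
  let ?F1 = "fibre (src G) x" and ?F2 = "fibre (tgt G) ?y"
  let ?D1 = "dual_fibre (src G) x" and ?D2 = "dual_fibre (tgt G) ?y"
  have xb: "x \<in> src_base" and yb: "?y \<in> tgt_base"
    using x locus_sub bmap_in by auto
  have ft: "tmap G v \<in> carrier ?F2" if "v \<in> carrier ?F1" for v
    using tmap_lin[OF x] that unfolding lin_map_def by blast
  have flat2: "carrier ?D2 = flat (tgt G) g2 ` carrier ?F2"
    by (rule pseudo_metric_flat(2)[OF tgt g2 yb])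
  have lift: "\<exists>u\<in>carrier ?F1. tmap_dual G \<xi> = flat (src G) g1 u \<and> \<xi> = flat (tgt G) g2 (tmap G u)"
    if \<xi>: "\<xi> \<in> carrier ?D2" for \<xi>
  proof -
    have "tmap_dual G \<xi> \<in> carrier ?D1"
      using tmap_dual_lin_map[OF x] \<xi> unfolding lin_map_def by blast
    \<comment> \<open>\<open>tmap G\<close> is not inverted: the vector comes from surjectivity of
      \<open>flat\<close> on the source side, and its image under \<open>tmap G\<close> is the
      candidate on the target side.\<close>
    then obtain u where u: "u \<in> carrier ?F1" "tmap_dual G \<xi> = flat (src G) g1 u"
      using pseudo_metric_flat(2)[OF src g1 xb] by blast
    have flat_u: "flat (tgt G) g2 (tmap G u) \<in> carrier ?D2" unfolding flat2 using ft[OF u(1)] by blast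
    \<comment> \<open>Compatibility of the metrics with \<open>u\<close> held fixed, read as an
      equation between functionals.\<close>
    have "tmap_dual G (flat (tgt G) g2 (tmap G u)) = flat (src G) g1 u"
    proof -
      have "fst (flat (tgt G) g2 (tmap G u)) = ?y" unfolding flat_apply[OF ft[OF u(1)]] by simp
      then have "tmap_dual G (flat (tgt G) g2 (tmap G u)) =
          (x, \<lambda>v. if v \<in> carrier ?F1 then snd (flat (tgt G) g2 (tmap G u)) (tmap G v) else 0)"
        by (rule tmap_dual_apply[OF x])
      also have "\<dots> = flat (src G) g1 u"
        unfolding flat_apply[OF u(1)] flat_apply[OF ft[OF u(1)]] snd_conv
        using compat x u(1) ft unfolding compatible_def by (auto simp: fun_eq_iff simp del: fibre_simps)
      finally show ?thesis .
    qed
    then have "tmap_dual G (flat (tgt G) g2 (tmap G u)) = tmap_dual G \<xi>" using u(2) by simp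
    then have "flat (tgt G) g2 (tmap G u) = \<xi>"
      using inj_onD[OF tmap_dual_inj] dual_fibre_preim[OF x flat_u] dual_fibre_preim[OF x \<xi>] by blast
    with u show ?thesis by blast
  qed
  have "dual_metric (src G) g1 x (tmap_dual G \<xi>) (tmap_dual G \<eta>) = dual_metric (tgt G) g2 ?y \<xi> \<eta>"
    if "\<xi> \<in> carrier ?D2" "\<eta> \<in> carrier ?D2" for \<xi> \<eta>
  proof -
    obtain u where u: "u \<in> carrier ?F1" "tmap_dual G \<xi> = flat (src G) g1 u" "\<xi> = flat (tgt G) g2 (tmap G u)"
      using lift \<open>\<xi> \<in> carrier ?D2\<close> by blast
    obtain v where v: "v \<in> carrier ?F1" "tmap_dual G \<eta> = flat (src G) g1 v" "\<eta> = flat (tgt G) g2 (tmap G v)"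
      using lift \<open>\<eta> \<in> carrier ?D2\<close> by blast
    have "dual_metric (src G) g1 x (tmap_dual G \<xi>) (tmap_dual G \<eta>) = g1 x u v"
      unfolding u(2) v(2) by (rule dual_metric_flat[OF src_dualizing[OF xb] u(1) v(1)])
    also have "\<dots> = g2 ?y (tmap G u) (tmap G v)"
      using compat x u(1) v(1) unfolding compatible_def by blast
    also have "\<dots> = dual_metric (tgt G) g2 ?y \<xi> \<eta>"
      unfolding u(3) v(3) by (rule dual_metric_flat[OF tgt_dualizing[OF yb] ft[OF u(1)] ft[OF v(1)], symmetric])
    finally show ?thesis .
  qed
  then show ?thesis
    unfolding isometry_between_def
    using dual_metric_quadratic_space[OF src_dualizing[OF xb] open_src xb]
      dual_metric_quadratic_space[OF tgt_dualizing[OF yb] open_tgt yb] tmap_dual_lin_map[OF x] by blast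
qed

lemma dual_gluing_simps [simp]:
  "src (dual_gluing G) = dual_bundle (tgt G)" "tgt (dual_gluing G) = dual_bundle (src G)"
  "locus (dual_gluing G) = bmap G ` locus G" "bmap (dual_gluing G) = inv_into (locus G) (bmap G)"
  "tmap (dual_gluing G) = tmap_dual G"
  by (simp_all add: dual_gluing_def)

text \<open>Source and target exchange roles and the new locus is f(Y); injectivity of f makes the
  inverse base map return the point over which \<open>tmap_dual G\<close> lands.\<close>

sublocale dual: fibre_gluing "dual_gluing G"
proof (rule fibre_gluing.intro)
  show "lin_map (fibre (src (dual_gluing G)) y)
      (fibre (tgt (dual_gluing G)) (bmap (dual_gluing G) y)) (tmap (dual_gluing G))"
    if "y \<in> locus (dual_gluing G)" for y
    using that tmap_dual_lin_map bmap_inj by auto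
qed (use locus_sub bmap_in bmap_inj open_src open_tgt in \<open>auto intro: dual_fibre_real_vs simp del: fibre_simps\<close>)

abbreviation glued_metric where "glued_metric \<equiv> glue_metric G g1 g2"

abbreviation glued_dual_metric where
  "glued_dual_metric \<equiv> glue_metric (dual_gluing G) (dual_metric (tgt G) g2) (dual_metric (src G) g1)"

section \<open>The constituents of \<open>Phi G\<close> on single fibres\<close>

lemma j1_dual_isometry:
  assumes x: "x \<in> src_base" "x \<notin> locus G"
  shows "isometry_between (dual_fibre (glued G) (i1 G x)) (dual_metric (glued G) glued_metric (i1 G x))
    (dual_fibre (src G) x) (dual_metric (src G) g1 x) (j1_dual G)"
proof (rule isometry_cong)
  show "isometry_between (dual_fibre (glued G) (i1 G x)) (dual_metric (glued G) glued_metric (i1 G x))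
    (dual_fibre (src G) x) (dual_metric (src G) g1 x) (pull (src G) x (j1 G))"
  proof (rule pull_isometry[OF vs_iso_j1[OF x] src_dualizing[OF x(1)] _ _ open_src x(1) glued_open_plots
        base_glued_i1[OF x(1)]])
    show "glued_metric (i1 G x) (j1 G v) (j1 G w) = g1 x v w"
      if "v \<in> vecs (src G) x" "w \<in> vecs (src G) x" for v w
      using x that by (rule glue_metric_i1)
    show "pull (src G) x (j1 G) \<xi> \<in> carrier (dual_fibre (src G) x)"
      if "\<xi> \<in> carrier (dual_fibre (glued G) (i1 G x))" for \<xi>
      using vs_iso_j1[OF x] x(1) j1_plot[OF open_src] j1_off[OF x] that by (rule pull_dual_vector)
  qed
  show "j1_dual G \<xi> = pull (src G) x (j1 G) \<xi>" if "\<xi> \<in> carrier (dual_fibre (glued G) (i1 G x))" for \<xi>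
    using x that by (intro j1_dual_pull) auto
qed

lemma j2_dual_isometry:
  assumes y: "y \<in> tgt_base"
  shows "isometry_between (dual_fibre (glued G) (i2 G y)) (dual_metric (glued G) glued_metric (i2 G y))
    (dual_fibre (tgt G) y) (dual_metric (tgt G) g2 y) (j2_dual G)"
proof (rule isometry_cong)
  show "isometry_between (dual_fibre (glued G) (i2 G y)) (dual_metric (glued G) glued_metric (i2 G y))
    (dual_fibre (tgt G) y) (dual_metric (tgt G) g2 y) (pull (tgt G) y (j2 G))"
  proof (rule pull_isometry[OF vs_iso_j2[OF y] tgt_dualizing[OF y] _ _ open_tgt y glued_open_plots
        base_glued_i2[OF y]])
    show "glued_metric (i2 G y) (j2 G v) (j2 G w) = g2 y v w"
      if "v \<in> vecs (tgt G) y" "w \<in> vecs (tgt G) y" for v w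
      using y that by (rule glue_metric_i2)
    show "pull (tgt G) y (j2 G) \<xi> \<in> carrier (dual_fibre (tgt G) y)"
      if "\<xi> \<in> carrier (dual_fibre (glued G) (i2 G y))" for \<xi>
      using vs_iso_j2[OF y] y j2_plot[OF open_tgt] j2_off[OF y] that by (rule pull_dual_vector)
  qed
  show "j2_dual G \<xi> = pull (tgt G) y (j2 G) \<xi>" if "\<xi> \<in> carrier (dual_fibre (glued G) (i2 G y))" for \<xi>
    using y that by (intro j2_dual_pull) auto
qed

lemma dual_j1_isometry:
  assumes y: "y \<in> tgt_base" "y \<notin> bmap G ` locus G"
  shows "isometry_between (dual_fibre (tgt G) y) (dual_metric (tgt G) g2 y)
    (fibre (glued (dual_gluing G)) (i1 (dual_gluing G) y)) (glued_dual_metric (i1 (dual_gluing G) y))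
    (j1 (dual_gluing G))"
proof (rule vs_iso_isometry)
  show "vs_iso (j1 (dual_gluing G)) (dual_fibre (tgt G) y)
      (fibre (glued (dual_gluing G)) (i1 (dual_gluing G) y))"
    using dual.vs_iso_j1[of y] y by simp
  show "quadratic_space (dual_fibre (tgt G) y) (dual_metric (tgt G) g2 y)"
    by (rule dual_metric_quadratic_space[OF tgt_dualizing[OF y(1)] open_tgt y(1)])
  show "glued_dual_metric (i1 (dual_gluing G) y) (j1 (dual_gluing G) \<xi>) (j1 (dual_gluing G) \<eta>) =
      dual_metric (tgt G) g2 y \<xi> \<eta>"
    if "\<xi> \<in> carrier (dual_fibre (tgt G) y)" "\<eta> \<in> carrier (dual_fibre (tgt G) y)" for \<xi> \<eta>
    using dual.glue_metric_i1[of y \<xi> \<eta>] y that by simp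
qed

lemma dual_j2_isometry:
  assumes x: "x \<in> src_base"
  shows "isometry_between (dual_fibre (src G) x) (dual_metric (src G) g1 x)
    (fibre (glued (dual_gluing G)) (i2 (dual_gluing G) x)) (glued_dual_metric (i2 (dual_gluing G) x))
    (j2 (dual_gluing G))"
proof (rule vs_iso_isometry)
  show "vs_iso (j2 (dual_gluing G)) (dual_fibre (src G) x)
      (fibre (glued (dual_gluing G)) (i2 (dual_gluing G) x))"
    using dual.vs_iso_j2[of x] x by simp
  show "quadratic_space (dual_fibre (src G) x) (dual_metric (src G) g1 x)"
    by (rule dual_metric_quadratic_space[OF src_dualizing[OF x] open_src x])
  show "glued_dual_metric (i2 (dual_gluing G) x) (j2 (dual_gluing G) \<xi>) (j2 (dual_gluing G) \<eta>) =
      dual_metric (src G) g1 x \<xi> \<eta>"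
    if "\<xi> \<in> carrier (dual_fibre (src G) x)" "\<eta> \<in> carrier (dual_fibre (src G) x)" for \<xi> \<eta>
    using dual.glue_metric_i2[of x \<xi> \<eta>] x that by simp
qed

text \<open>On one fibre each branch of \<open>Phi\<close> is a composite of isometries, three over
  f(Y) and two elsewhere. The target point is left existential, since \<open>covered\<close>
  recovers it from the zero vector.\<close>

lemma Phi_isometry:
  assumes "P \<in> points (base (glued G))"
  shows "\<exists>P'. isometry_between (dual_fibre (glued G) P) (dual_metric (glued G) glued_metric P)
    (fibre (glued (dual_gluing G)) P') (glued_dual_metric P') (Phi G)"
  using assms
proof (cases rule: base_glued_cases)
  case (off x)
  have "isometry_between (dual_fibre (glued G) P) (dual_metric (glued G) glued_metric P)
    (fibre (glued (dual_gluing G)) (i2 (dual_gluing G) x)) (glued_dual_metric (i2 (dual_gluing G) x)) (Phi G)"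
  proof (rule isometry_cong[OF isometry_compose[OF j1_dual_isometry[OF off(1,2), folded off(3)] dual_j2_isometry[OF off(1)]]])
    show "Phi G \<xi> = j2 (dual_gluing G) (j1_dual G \<xi>)" if "\<xi> \<in> carrier (dual_fibre (glued G) P)" for \<xi>
      using that off by (auto simp: Phi_def)
  qed
  then show ?thesis by blast
next
  case (on y)
  show ?thesis
  proof (cases "y \<in> bmap G ` locus G")
    case True
    then obtain x where x: "x \<in> locus G" "y = bmap G x" by blast
    then have xb: "x \<in> src_base" using locus_sub by blast
    have "isometry_between (dual_fibre (glued G) P) (dual_metric (glued G) glued_metric P)
      (fibre (glued (dual_gluing G)) (i2 (dual_gluing G) x)) (glued_dual_metric (i2 (dual_gluing G) x)) (Phi G)"
    proof (rule isometry_cong[OF isometry_compose[OF isometry_compose[OF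
            j2_dual_isometry[OF on(1), folded on(2), unfolded x(2)] tmap_dual_isometry[OF x(1)]] dual_j2_isometry[OF xb]]])
      fix \<xi> assume "\<xi> \<in> carrier (dual_fibre (glued G) P)"
      then have "fst \<xi> = i2 G y" using on by auto
      then show "Phi G \<xi> = j2 (dual_gluing G) (tmap_dual G (j2_dual G \<xi>))"
        using i2_not_off[OF on(1)] True by (auto simp: Phi_def)
    qed
    then show ?thesis by blast
  next
    case False
    have "isometry_between (dual_fibre (glued G) P) (dual_metric (glued G) glued_metric P)
      (fibre (glued (dual_gluing G)) (i1 (dual_gluing G) y)) (glued_dual_metric (i1 (dual_gluing G) y)) (Phi G)"
    proof (rule isometry_cong[OF isometry_compose[OF j2_dual_isometry[OF on(1), folded on(2)] dual_j1_isometry[OF on(1) False]]])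
      fix \<xi> assume "\<xi> \<in> carrier (dual_fibre (glued G) P)"
      then have "fst \<xi> = i2 G y" using on by auto
      \<comment> \<open>\<open>Phi\<close> tests the glued point, not \<open>y\<close>; injectivity
        of \<open>i2 G\<close> connects the two.\<close>
      moreover have "i2 G y \<notin> i2 G ` bmap G ` locus G"
        using False on(1) bmap_in i2_eq_i2_iff by blast
      ultimately show "Phi G \<xi> = j1 (dual_gluing G) (j2_dual G \<xi>)"
        using i2_not_off[OF on(1)] by (simp add: Phi_def)
    qed
    then show ?thesis by blast
  qed
qed

lemma total_tensor_bundle: "points (total (tensor_bundle L V)) = tensor_points L V"
  by (simp add: tensor_bundle_def tensor_bundle_with_def)

text \<open>\<open>sub_space\<close> intersects with the points of the tensor bundle; exterior
  elements are tensors, so nothing is lost.\<close>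

lemma exterior_points:
  assumes "\<And>x. x \<in> points (base V) \<Longrightarrow> real_vs (fibre V x)"
  shows "points (total (exterior_bundle V)) = Sigma (points (base V)) (\<lambda>x. ext_carrier (fibre V x))"
proof -
  have "ext_carrier (fibre V x) \<subseteq> tensors (fibre V x) UNIV" if "x \<in> points (base V)" for x
  proof -
    interpret real_vec_space "fibre V x" using assms[OF that] by (rule real_vec_space.intro)
    show ?thesis by (auto simp: tensors_UNIV ext_carrier_ec)
  qed
  then show ?thesis
    by (auto simp: exterior_bundle_def sub_space_def total_tensor_bundle tensor_points_def)
qed

theorem Phi_clifford_action:
  assumes v: "v \<in> points (total (clifford_bundle (dual_bundle (glued G)) (dual_metric (glued G) glued_metric)))"
    and e: "e \<in> points (total (exterior_bundle (dual_bundle (glued G))))"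
    and ve: "proj (exterior_bundle (dual_bundle (glued G))) e =
         proj (clifford_bundle (dual_bundle (glued G)) (dual_metric (glued G) glued_metric)) v"
  shows
    "exterior_map (dual_bundle (glued G)) (glued (dual_gluing G)) (Phi G)
       (clifford_action (dual_bundle (glued G)) (dual_metric (glued G) glued_metric) v e) =
     clifford_action (glued (dual_gluing G)) glued_dual_metric
       (clifford_map (dual_bundle (glued G)) (glued (dual_gluing G)) glued_dual_metric (Phi G) v)
       (exterior_map (dual_bundle (glued G)) (glued (dual_gluing G)) (Phi G) e)"
proof -
  let ?W = "dual_bundle (glued G)" and ?g = "dual_metric (glued G) glued_metric"
  let ?W' = "glued (dual_gluing G)"
  have vs: "real_vs (fibre ?W P)" if "P \<in> points (base ?W)" for P
    using that by (intro dual_fibre_real_vs glued_open_plots) simp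
  have ext: "points (total (exterior_bundle ?W)) = Sigma (points (base ?W)) (\<lambda>x. ext_carrier (fibre ?W x))"
    by (rule exterior_points) (rule vs)
  obtain P A where v': "v = (P, clifford_class (fibre ?W P) (?g P) A)" "P \<in> points (base ?W)"
    "A \<in> tensors (fibre ?W P) UNIV"
    using v by (auto simp: clifford_bundle_def quotient_space_def total_tensor_bundle tensor_points_def)
  have "fst e = fst v"
    using ve by (simp add: exterior_bundle_def clifford_bundle_def tensor_bundle_def tensor_bundle_with_def)
  with e v' obtain B where e': "e = (P, B)" "B \<in> ext_carrier (fibre ?W P)"
    unfolding ext by (cases e) auto
  have "P \<in> points (base (glued G))" using v'(2) by simp
  then obtain P' where iso: "isometry_between (fibre ?W P) (?g P) (fibre ?W' P') (glued_dual_metric P') (Phi G)"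
    using Phi_isometry by blast
  then have qs: "quadratic_space (fibre ?W P) (?g P)" "quadratic_space (fibre ?W' P') (glued_dual_metric P')"
    and lin: "lin_map (fibre ?W P) (fibre ?W' P') (Phi G)"
    and isom: "\<And>\<xi> \<eta>. \<xi> \<in> vecs ?W P \<Longrightarrow> \<eta> \<in> vecs ?W P \<Longrightarrow>
      glued_dual_metric P' (Phi G \<xi>) (Phi G \<eta>) = ?g P \<xi> \<eta>"
    unfolding isometry_between_def by blast+
  interpret E: quadratic_space "fibre ?W P" "?g P" by (rule qs(1))
  have "fzero ?W P \<in> vecs ?W P" using real_vsD(1)[OF vs[OF v'(2)]] unfolding fibre_simps .
  then have "Phi G (fzero ?W P) \<in> vecs ?W' P'" using lin unfolding lin_map_def by blast
  \<comment> \<open>\<open>covered\<close> is read off from the zero vector over \<open>P\<close>,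
    which \<open>Phi G\<close> maps into the fibre over \<open>P'\<close>.\<close>
  then have cov: "covered ?W ?W' (Phi G) P = P'" by (simp add: covered_def)
  have C: "clifford_class (fibre ?W P) (?g P) A \<in> carrier (clifford_alg (fibre ?W P) (?g P))"
    using v'(3) by (auto simp: E.tensors_UNIV)
  \<comment> \<open>The membership half matters as well: \<open>exterior_map\<close> is
    \<open>undefined\<close> outside the points of the exterior pseudo-bundle.\<close>
  note nat = standard_action_natural[OF qs lin isom C e'(2)]
  show ?thesis
    using nat v'(2) e'(2) unfolding exterior_map_def ext
    by (simp add: v'(1) e'(1) clifford_action_def clifford_map_def tensor_map_def cov Let_def
        del: dual_bundle_simps)
qed

end

theorem theorem8p4:
  fixes V1 :: "('v, 'x) vbundle" and V2 :: "('w, 'y) vbundle"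
    and Y :: "'x set" and f :: "'x \<Rightarrow> 'y" and ft :: "'v \<Rightarrow> 'w"
    and G :: "('v, 'x, 'w, 'y) gluing"
    and g1 :: "'x \<Rightarrow> 'v \<Rightarrow> 'v \<Rightarrow> real" and g2 :: "'y \<Rightarrow> 'w \<Rightarrow> 'w \<Rightarrow> real"
  assumes "G = \<lparr>src = V1, tgt = V2, locus = Y, bmap = f, tmap = ft\<rparr>"
    and "pseudo_bundle V1" and "finite_dim_bundle V1" and "locally_trivial V1"
    and "pseudo_bundle V2" and "finite_dim_bundle V2" and "locally_trivial V2"
    and "bounded_dim_bundle V1" and "bounded_dim_bundle V2"
    and "is_gluing G"
    and "diffeo_onto_image (base V1) Y (base V2) f"
    and "diffeo_onto_image (total (dual_bundle V2)) (preim (dual_bundle V2) (f ` Y))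
           (total (dual_bundle V1)) (tmap_dual G)"
    and "pseudo_metric V1 g1" and "pseudo_metric V2 g2"
    and "compatible G g1 g2"
    and "v \<in> points (total (clifford_bundle (dual_bundle (glued G))
           (dual_metric (glued G) (glue_metric G g1 g2))))"
    and "e \<in> points (total (exterior_bundle (dual_bundle (glued G))))"
    and "proj (exterior_bundle (dual_bundle (glued G))) e =
         proj (clifford_bundle (dual_bundle (glued G))
           (dual_metric (glued G) (glue_metric G g1 g2))) v"
  shows
    "exterior_map (dual_bundle (glued G)) (glued (dual_gluing G)) (Phi G)
       (clifford_action (dual_bundle (glued G)) (dual_metric (glued G) (glue_metric G g1 g2)) v e) =
     clifford_action (glued (dual_gluing G))
       (glue_metric (dual_gluing G) (dual_metric V2 g2) (dual_metric V1 g1))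
       (clifford_map (dual_bundle (glued G)) (glued (dual_gluing G))
          (glue_metric (dual_gluing G) (dual_metric V2 g2) (dual_metric V1 g1)) (Phi G) v)
       (exterior_map (dual_bundle (glued G)) (glued (dual_gluing G)) (Phi G) e)"
proof -
  have G: "src G = V1" "tgt G = V2" "locus G = Y" "bmap G = f"
    using assms(1) by simp_all
  interpret metric_gluing G g1 g2
    by (rule metric_gluing.intro; (unfold G)?; fact assms)
  show ?thesis
    using Phi_clifford_action[OF assms(16-18)] unfolding G .
qed

end
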